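(* Let $g\in L^2(\mathbb{R}^m)$ and let $\Lambda$ be a countable family of points of $\mathbb{R}^{2m}$ (repetitions allowed) such that the Gabor set $\mathcal{G}(g,\Lambda)$ is a frame for $L^2(\mathbb{R}^m)$. Then $\mathcal{G}(g,\Lambda)$ is non-expansive with respect to the quasi-metric index set $(\Lambda,\|\cdot\|_\infty)$.
   Context: For $\lambda=(t,\omega)\in\mathbb{R}^m\times\mathbb{R}^m$ and phase $\varphi_\lambda$, $g_\lambda(x)=e^{i\varphi_\lambda}e^{2\pi i\langle\omega,x\rangle}g(x-t)$, $\mathcal{G}(g,\Lambda)=\{g_\lambda\}_{\lambda\in\Lambda}$ (arbitrary fixed phases). $\Lambda$ is an index set with quasi-distance $d(\lambda,\lambda')=\|\lambda-\lambda'\|_\infty$ and balls $B_N(\lambda)=\{\lambda':d(\lambda',\lambda)\le N\}$. With $\{\delta_\lambda\}$ the canonical basis of $\ell^2(\Lambda)$, an operator $A$ is row non-expansive if for every $\varepsilon>0$ there is $N$ with $\sum_{\lambda'\notin B_N(\lambda)}|\langle A\delta_\lambda,\delta_{\lambda'}\rangle|^2<\varepsilon$ for all $\lambda$, and non-expansive if $A$ and $A^*$ are row non-expansive. A frame is non-expansive if its associated Gram projection (the orthogonal projection of $\ell^2(\Lambda)$ onto the range of the analysis operator $h\mapsto(\langle h,g_\lambda\rangle)_\lambda$) is non-expansive. *)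

theory Defs
  imports "HOL-Analysis.Analysis"
begin

definition L2 :: "(real^'m \<Rightarrow> complex) set" where
  "L2 = {h. h \<in> borel_measurable lborel \<and> integrable lborel (\<lambda>x. (norm (h x))^2)}"

definition L2_inner :: "(real^'m \<Rightarrow> complex) \<Rightarrow> (real^'m \<Rightarrow> complex) \<Rightarrow> complex" where
  "L2_inner h k = (LINT x|lborel. h x * cnj (k x))"

definition L2_norm :: "(real^'m \<Rightarrow> complex) \<Rightarrow> real" where
  "L2_norm h = sqrt (LINT x|lborel. (norm (h x))^2)"

definition gabor_atom :: "(real^'m \<Rightarrow> complex) \<Rightarrow> real \<Rightarrow> real^'m \<Rightarrow> real^'m \<Rightarrow> (real^'m \<Rightarrow> complex)" where
  "gabor_atom g ph t \<omega> = (\<lambda>x. cis ph * cis (2 * pi * (\<omega> \<bullet> x)) * g (x - t))"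

text \<open>Gabor system G(g,Lambda): Lambda given as a family p indexed by 'i (repetitions allowed),
  with arbitrary fixed phases phi.\<close>
definition gabor_sys :: "(real^'m \<Rightarrow> complex) \<Rightarrow> ('i \<Rightarrow> real) \<Rightarrow> ('i \<Rightarrow> (real^'m) \<times> (real^'m))
    \<Rightarrow> 'i \<Rightarrow> (real^'m \<Rightarrow> complex)" where
  "gabor_sys g phi p = (\<lambda>i. gabor_atom g (phi i) (fst (p i)) (snd (p i)))"

definition is_frame_L2 :: "('i \<Rightarrow> (real^'m \<Rightarrow> complex)) \<Rightarrow> bool" where
  "is_frame_L2 G \<longleftrightarrow> (\<forall>i. G i \<in> L2) \<and>
     (\<exists>A B. 0 < A \<and> 0 < B \<and>
       (\<forall>h\<in>L2. (\<lambda>i. (norm (L2_inner h (G i)))^2) summable_on UNIV \<and>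
          A * (L2_norm h)^2 \<le> (\<Sum>\<^sub>\<infinity>i. (norm (L2_inner h (G i)))^2) \<and>
          (\<Sum>\<^sub>\<infinity>i. (norm (L2_inner h (G i)))^2) \<le> B * (L2_norm h)^2))"

definition analysis_range :: "('i \<Rightarrow> (real^'m \<Rightarrow> complex)) \<Rightarrow> ('i \<Rightarrow> complex) set" where
  "analysis_range G = {(\<lambda>i. L2_inner h (G i)) | h. h \<in> L2}"

definition l2 :: "('i \<Rightarrow> complex) set" where
  "l2 = {c. (\<lambda>i. (norm (c i))^2) summable_on UNIV}"

definition l2_inner :: "('i \<Rightarrow> complex) \<Rightarrow> ('i \<Rightarrow> complex) \<Rightarrow> complex" where
  "l2_inner c d = (\<Sum>\<^sub>\<infinity>i. c i * cnj (d i))"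

definition delta :: "'i \<Rightarrow> 'i \<Rightarrow> complex" where
  "delta j = (\<lambda>i. if i = j then 1 else 0)"

definition orth_proj :: "('i \<Rightarrow> complex) set \<Rightarrow> ('i \<Rightarrow> complex) \<Rightarrow> ('i \<Rightarrow> complex)" where
  "orth_proj R c = (THE y. y \<in> R \<and> (\<forall>z\<in>R. l2_inner (c - y) z = 0))"

definition gram_proj :: "('i \<Rightarrow> (real^'m \<Rightarrow> complex)) \<Rightarrow> ('i \<Rightarrow> complex) \<Rightarrow> ('i \<Rightarrow> complex)" where
  "gram_proj G = orth_proj (analysis_range G)"

definition row_nonexp :: "('i \<Rightarrow> 'i \<Rightarrow> real) \<Rightarrow> (('i \<Rightarrow> complex) \<Rightarrow> ('i \<Rightarrow> complex)) \<Rightarrow> bool" where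
  "row_nonexp d A \<longleftrightarrow> (\<forall>\<epsilon>>0. \<exists>N. \<forall>i.
     (\<Sum>\<^sub>\<infinity>j\<in>{j. \<not> d j i \<le> N}. (norm (l2_inner (A (delta i)) (delta j)))^2) < \<epsilon>)"

text \<open>Row non-expansiveness of the adjoint A*, using
  <A* delta_i, delta_j> = <delta_i, A delta_j> = cnj <A delta_j, delta_i>.\<close>
definition adj_row_nonexp :: "('i \<Rightarrow> 'i \<Rightarrow> real) \<Rightarrow> (('i \<Rightarrow> complex) \<Rightarrow> ('i \<Rightarrow> complex)) \<Rightarrow> bool" where
  "adj_row_nonexp d A \<longleftrightarrow> (\<forall>\<epsilon>>0. \<exists>N. \<forall>i.
     (\<Sum>\<^sub>\<infinity>j\<in>{j. \<not> d j i \<le> N}. (norm (cnj (l2_inner (A (delta j)) (delta i))))^2) < \<epsilon>)"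

definition nonexpansive_op :: "('i \<Rightarrow> 'i \<Rightarrow> real) \<Rightarrow> (('i \<Rightarrow> complex) \<Rightarrow> ('i \<Rightarrow> complex)) \<Rightarrow> bool" where
  "nonexpansive_op d A \<longleftrightarrow> row_nonexp d A \<and> adj_row_nonexp d A"

definition linf_dist :: "('i \<Rightarrow> (real^'m) \<times> (real^'m)) \<Rightarrow> 'i \<Rightarrow> 'i \<Rightarrow> real" where
  "linf_dist p i j = infnorm (p i - p j)"

end

theory Submission
  imports Defs "HOL-Probability.Characteristic_Functions"
begin

text \<open>Let \<open>T\<close> be the analysis operator and \<open>u\<^sub>i\<close> the dual atoms, so that the Gram projection maps \<open>\<delta>\<^sub>i\<close> to
  \<open>T u\<^sub>i\<close>. Since the projection is self-adjoint, it suffices to bound the tails of \<open>T u\<^sub>i\<close> uniformly in \<open>i\<close>.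
  A damped Richardson iteration, truncated to balls around \<open>i\<close>, approximates \<open>u\<^sub>i\<close> uniformly in \<open>i\<close> by
  combinations of the atoms in a ball of fixed radius with bounded coefficients. Balls contain a bounded
  number of indices by the Bessel inequality, so only the tails of the Gram matrix have to be
  uniformly small. They are sampled values of the spectrogram \<open>\<bar>V\<^sub>g g\<bar>\<^sup>2\<close> at the points
  \<open>\<lambda>\<^sub>j - \<lambda>\<^sub>i\<close>. By strong continuity of time-frequency shifts and the Bessel inequality the samples may
  be averaged over a small ball, and the spectrogram is integrable by the \<open>L\<^sup>2\<close> bound for the
  Fourier transform.\<close>

subsection \<open>Semi-inner products\<close>

text \<open>Since \<open>g\<close> is merely square-integrable, no rate of off-diagonal decay of the
  Gram matrix is available; all one has is tails that are small in square sum, uniformly in the row.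
  A combination of boundedly many nearby atoms with bounded coefficients inherits such tails by
  Cauchy-Schwarz, which is why every Richardson step is truncated before the next one starts. The
  contraction factor 1 - A/(4B) allows the number of steps to be fixed first and the truncation
  errors afterwards.

  The dual atoms arise as minimizers of the distance from \<open>delta i\<close> to the analysis
  range, not by inverting the frame operator; completeness of \<open>L2\<close> and the frame bounds
  suffice for this.

  Integrability of the spectrogram says nothing about its values at given points. Averaging is
  legitimate only because moving the window by a small \<open>z\<close> perturbs all Gram entries of
  a row at once, with total square error controlled by the Bessel bound.

  Functions are not identified modulo null sets, so the Hilbert space arguments are made for
  semi-inner products on a carrier set.\<close>

locale semi_inner =
  fixes V :: "('a \<Rightarrow> complex) set" and ip :: "('a \<Rightarrow> complex) \<Rightarrow> ('a \<Rightarrow> complex) \<Rightarrow> complex"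
  assumes zero_mem: "(\<lambda>_. 0) \<in> V"
    and add_mem: "x \<in> V \<Longrightarrow> y \<in> V \<Longrightarrow> (\<lambda>a. x a + y a) \<in> V"
    and scale_mem: "x \<in> V \<Longrightarrow> (\<lambda>a. c * x a) \<in> V"
    and ip_add: "x \<in> V \<Longrightarrow> y \<in> V \<Longrightarrow> z \<in> V \<Longrightarrow> ip (\<lambda>a. x a + y a) z = ip x z + ip y z"
    and ip_scale: "x \<in> V \<Longrightarrow> z \<in> V \<Longrightarrow> ip (\<lambda>a. c * x a) z = c * ip x z"
    and ip_cnj: "x \<in> V \<Longrightarrow> y \<in> V \<Longrightarrow> ip y x = cnj (ip x y)"
    and ip_ge_0: "x \<in> V \<Longrightarrow> 0 \<le> Re (ip x x)"
begin

definition nrm :: "('a \<Rightarrow> complex) \<Rightarrow> real" where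
  "nrm x = sqrt (Re (ip x x))"

lemma nrm_ge_0: "x \<in> V \<Longrightarrow> 0 \<le> nrm x"
  by (simp add: nrm_def ip_ge_0)

lemma nrm_sq: "x \<in> V \<Longrightarrow> (nrm x)\<^sup>2 = Re (ip x x)"
  by (simp add: nrm_def ip_ge_0)

lemma ip_self: "x \<in> V \<Longrightarrow> ip x x = complex_of_real ((nrm x)\<^sup>2)"
  using ip_cnj[of x x] by (simp add: nrm_sq complex_eq_iff)

lemma diff_mem: "x \<in> V \<Longrightarrow> y \<in> V \<Longrightarrow> (\<lambda>a. x a - y a) \<in> V"
  using add_mem[of x "\<lambda>a. (-1) * y a"] scale_mem[of y "-1"] by simp

lemma ip_diff: "x \<in> V \<Longrightarrow> y \<in> V \<Longrightarrow> z \<in> V \<Longrightarrow> ip (\<lambda>a. x a - y a) z = ip x z - ip y z"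
  using ip_add[of x "\<lambda>a. (-1) * y a" z] ip_scale[of y z "-1"] scale_mem[of y "-1"] by simp

lemma ip_diff_right: "x \<in> V \<Longrightarrow> y \<in> V \<Longrightarrow> z \<in> V \<Longrightarrow> ip z (\<lambda>a. x a - y a) = ip z x - ip z y"
  using ip_diff[of x y z] ip_cnj[of "\<lambda>a. x a - y a" z] ip_cnj[of x z] ip_cnj[of y z] diff_mem[of x y]
  by simp

lemma ip_scale_right: "x \<in> V \<Longrightarrow> z \<in> V \<Longrightarrow> ip z (\<lambda>a. c * x a) = cnj c * ip z x"
  using ip_scale[of x z c] ip_cnj[of "\<lambda>a. c * x a" z] ip_cnj[of x z] scale_mem[of x c]
  by simp

lemma sum_mem: "(\<And>j. j \<in> F \<Longrightarrow> f j \<in> V) \<Longrightarrow> (\<lambda>a. \<Sum>j\<in>F. c j * f j a) \<in> V"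
proof (induction F rule: infinite_finite_induct)
  case (insert j F)
  then show ?case
    using add_mem[of "\<lambda>a. c j * f j a" "\<lambda>a. \<Sum>j\<in>F. c j * f j a"] scale_mem[of "f j" "c j"] by simp
qed (simp_all add: zero_mem)

lemma ip_zero: "z \<in> V \<Longrightarrow> ip (\<lambda>_. 0) z = 0"
  using ip_scale[of z z 0] by simp

lemma ip_sum:
  "(\<And>j. j \<in> F \<Longrightarrow> f j \<in> V) \<Longrightarrow> z \<in> V \<Longrightarrow> ip (\<lambda>a. \<Sum>j\<in>F. c j * f j a) z = (\<Sum>j\<in>F. c j * ip (f j) z)"
proof (induction F rule: infinite_finite_induct)
  case (insert j F)
  then show ?case
    using ip_add[of "\<lambda>a. c j * f j a" "\<lambda>a. \<Sum>j\<in>F. c j * f j a" z]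
    by (simp add: scale_mem sum_mem ip_scale)
qed (simp_all add: ip_zero)

text \<open>The single quadratic expansion behind Cauchy-Schwarz, the parallelogram law, the
  triangle inequality, orthogonality at a minimizer and the Richardson step.\<close>

lemma nrm_sq_diff_scale:
  assumes "x \<in> V" "y \<in> V"
  shows "(nrm (\<lambda>a. x a - c * y a))\<^sup>2 = (nrm x)\<^sup>2 - 2 * Re (cnj c * ip x y) + (cmod c)\<^sup>2 * (nrm y)\<^sup>2"
proof -
  have cy: "(\<lambda>a. c * y a) \<in> V" using assms scale_mem by blast
  have "ip (\<lambda>a. x a - c * y a) (\<lambda>a. x a - c * y a)
      = ip x x - cnj c * ip x y - c * cnj (ip x y) + c * cnj c * ip y y"
    using assms cy
    by (simp add: ip_diff ip_diff_right diff_mem ip_scale ip_scale_right ip_cnj[of x y] algebra_simps)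
  moreover have "Re (c * cnj c * ip y y) = (cmod c)\<^sup>2 * (nrm y)\<^sup>2"
    using assms by (simp add: ip_self complex_mult_cnj cmod_power2 del: of_real_power)
  moreover have "Re (c * cnj (ip x y)) = Re (cnj c * ip x y)" by simp
  ultimately show ?thesis
    using assms cy by (simp add: nrm_sq diff_mem)
qed

text \<open>Discriminant argument: subtract \<open>s * ip x y\<close> times \<open>y\<close> from
  \<open>x\<close>, with real \<open>s\<close>. A null vector need not be zero, so
  \<open>nrm y = 0\<close> is a separate case; there the expression is affine in \<open>s\<close>,
  and a large \<open>s\<close> makes it negative unless \<open>ip x y\<close> vanishes.\<close>

lemma Cauchy_Schwarz:
  assumes "x \<in> V" "y \<in> V"
  shows "cmod (ip x y) \<le> nrm x * nrm y"
proof -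
  let ?b = "ip x y"
  have *: "0 \<le> (nrm x)\<^sup>2 - 2 * s * (cmod ?b)\<^sup>2 + s\<^sup>2 * (cmod ?b)\<^sup>2 * (nrm y)\<^sup>2" for s :: real
  proof -
    have "Re (cnj (of_real s * ?b) * ?b) = s * (cmod ?b)\<^sup>2"
    proof -
      have "cnj (of_real s * ?b) * ?b = of_real (s * (cmod ?b)\<^sup>2)"
        by (simp add: complex_norm_square del: of_real_power)
      then show ?thesis by (metis Re_complex_of_real)
    qed
    then show ?thesis
      using nrm_sq_diff_scale[OF assms, of "of_real s * ?b"]
        zero_le_power2[of "nrm (\<lambda>a. x a - of_real s * ?b * y a)"]
      by (simp add: norm_mult power_mult_distrib)
  qed
  have "(cmod ?b)\<^sup>2 \<le> (nrm x * nrm y)\<^sup>2"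
  proof (cases "nrm y = 0")
    case True
    have "cmod ?b = 0"
    proof (rule ccontr)
      assume "cmod ?b \<noteq> 0"
      then have "2 * ((nrm x)\<^sup>2 + 1) / (cmod ?b)\<^sup>2 * (cmod ?b)\<^sup>2 = 2 * ((nrm x)\<^sup>2 + 1)"
        by simp
      then have "0 \<le> (nrm x)\<^sup>2 - 2 * ((nrm x)\<^sup>2 + 1)"
        using *[of "((nrm x)\<^sup>2 + 1) / (cmod ?b)\<^sup>2"] True by simp
      then show False
        using zero_le_power2[of "nrm x"] by (simp add: algebra_simps del: zero_le_power2)
    qed
    then show ?thesis by simp
  next
    case False
    then have pos: "(nrm y)\<^sup>2 > 0" by simp
    \<comment> \<open>This is the quadratic term at its minimizing value
      \<open>s = 1 / (nrm y)^2\<close>.\<close>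
    have "(1 / (nrm y)\<^sup>2)\<^sup>2 * (cmod ?b)\<^sup>2 * (nrm y)\<^sup>2 = (cmod ?b)\<^sup>2 / (nrm y)\<^sup>2"
      using False by (simp add: power2_eq_square)
    then have "(cmod ?b)\<^sup>2 / (nrm y)\<^sup>2 \<le> (nrm x)\<^sup>2"
      using *[of "1 / (nrm y)\<^sup>2"] by simp
    then show ?thesis
      using pos by (simp add: pos_divide_le_eq power_mult_distrib)
  qed
  then show ?thesis
    by (rule power2_le_imp_le) (simp add: assms nrm_ge_0)
qed

lemma nrm_sq_add_diff:
  assumes "x \<in> V" "y \<in> V"
  shows "(nrm (\<lambda>a. x a + y a))\<^sup>2 + (nrm (\<lambda>a. x a - y a))\<^sup>2 = 2 * (nrm x)\<^sup>2 + 2 * (nrm y)\<^sup>2"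
  using nrm_sq_diff_scale[OF assms, of 1] nrm_sq_diff_scale[OF assms, of "-1"] by simp

lemma nrm_triangle:
  assumes "x \<in> V" "y \<in> V"
  shows "nrm (\<lambda>a. x a + y a) \<le> nrm x + nrm y"
proof -
  have "(nrm (\<lambda>a. x a + y a))\<^sup>2 = (nrm x)\<^sup>2 + 2 * Re (ip x y) + (nrm y)\<^sup>2"
    using nrm_sq_diff_scale[OF assms, of "-1"] by simp
  also have "\<dots> \<le> (nrm x + nrm y)\<^sup>2"
    using Cauchy_Schwarz[OF assms] complex_Re_le_cmod[of "ip x y"]
    by (simp add: power2_sum)
  finally show ?thesis
    by (rule power2_le_imp_le) (simp add: assms nrm_ge_0)
qed

lemma nrm_scale:
  assumes "x \<in> V" shows "nrm (\<lambda>a. c * x a) = cmod c * nrm x"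
proof -
  have "(nrm (\<lambda>a. c * x a))\<^sup>2 = Re (c * cnj c * ip x x)"
    using assms by (simp add: nrm_sq scale_mem ip_scale ip_scale_right mult.assoc)
  also have "\<dots> = (cmod c * nrm x)\<^sup>2"
    using assms by (simp add: ip_self complex_mult_cnj cmod_power2 power_mult_distrib del: of_real_power)
  finally show ?thesis
    using assms by (simp add: nrm_ge_0 scale_mem)
qed

text \<open>A short step from \<open>x\<close> along \<open>ip x z\<close> times \<open>z\<close>
  would lower the norm to first order if \<open>ip x z\<close> were nonzero.\<close>

lemma ip_eq_0_of_nrm_min:
  assumes xz: "x \<in> V" "z \<in> V" and min: "\<And>s. nrm x \<le> nrm (\<lambda>a. x a - s * z a)"
  shows "ip x z = 0"
proof (rule ccontr)
  let ?b = "ip x z"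
  assume "?b \<noteq> 0"
  \<comment> \<open>Small enough that the quadratic term is at most half of the linear gain; the
    \<open>+ 1\<close> covers a null vector \<open>z\<close>.\<close>
  define t where "t = 1 / ((nrm z)\<^sup>2 + 1)"
  have pos: "(nrm z)\<^sup>2 + 1 > 0" by (simp add: add_nonneg_pos)
  have t: "t > 0" "t * (nrm z)\<^sup>2 \<le> 1"
    using pos by (simp_all add: t_def divide_le_eq)
  have "(nrm x)\<^sup>2 \<le> (nrm (\<lambda>a. x a - (of_real t * ?b) * z a))\<^sup>2"
    by (intro power_mono min nrm_ge_0 xz)
  also have "\<dots> = (nrm x)\<^sup>2 - 2 * Re (cnj (of_real t * ?b) * ?b) + (cmod (of_real t * ?b))\<^sup>2 * (nrm z)\<^sup>2"
    by (rule nrm_sq_diff_scale[OF xz])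
  also have "cnj (of_real t * ?b) * ?b = of_real (t * (cmod ?b)\<^sup>2)"
    by (simp add: complex_norm_square del: of_real_power)
  finally have "2 * (t * (cmod ?b)\<^sup>2) \<le> t\<^sup>2 * (cmod ?b)\<^sup>2 * (nrm z)\<^sup>2"
    by (simp add: norm_mult power_mult_distrib del: of_real_mult of_real_power)
  also have "\<dots> = (t * (cmod ?b)\<^sup>2) * (t * (nrm z)\<^sup>2)"
    by (simp add: power2_eq_square)
  also have "\<dots> \<le> (t * (cmod ?b)\<^sup>2) * 1"
    using t by (intro mult_left_mono) simp_all
  finally show False using t \<open>?b \<noteq> 0\<close> by (simp add: mult_le_0_iff)
qed

end

subsection \<open>The spaces of square-integrable functions and square-summable families\<close>

lemma cnj_measurable[measurable]: "cnj \<in> borel_measurable borel"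
  by (intro borel_measurable_continuous_onI continuous_intros)

lemma L2_measurable: "h \<in> L2 \<Longrightarrow> h \<in> borel_measurable lborel"
  by (simp add: L2_def)

lemma L2_integrable_sq: "h \<in> L2 \<Longrightarrow> integrable lborel (\<lambda>x. (norm (h x))\<^sup>2)"
  by (simp add: L2_def)

lemma norm_mult_le_sum_squares:
  fixes a b :: complex
  shows "norm (a * b) \<le> (norm a)\<^sup>2 + (norm b)\<^sup>2"
  using sum_squares_bound[of "norm a" "norm b"] mult_nonneg_nonneg[of "norm a" "norm b"]
  by (simp add: norm_mult del: mult_nonneg_nonneg)

lemma norm_add_sq_le:
  fixes a b :: "'b::real_normed_vector"
  shows "(norm (a + b))\<^sup>2 \<le> 2 * (norm a)\<^sup>2 + 2 * (norm b)\<^sup>2"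
proof -
  have "(norm (a + b))\<^sup>2 \<le> (norm a + norm b)\<^sup>2"
    by (intro power_mono norm_triangle_ineq) simp
  also have "\<dots> \<le> 2 * (norm a)\<^sup>2 + 2 * (norm b)\<^sup>2"
    using sum_squares_bound[of "norm a" "norm b"] by (simp add: power2_sum)
  finally show ?thesis .
qed

lemma L2_mult_integrable:
  assumes "h \<in> L2" "k \<in> L2"
  shows "integrable lborel (\<lambda>x. h x * cnj (k x))"
proof (rule Bochner_Integration.integrable_bound)
  show "integrable lborel (\<lambda>x. (norm (h x))\<^sup>2 + (norm (k x))\<^sup>2)"
    using assms by (intro Bochner_Integration.integrable_add L2_integrable_sq)
  show "(\<lambda>x. h x * cnj (k x)) \<in> borel_measurable lborel"
    using assms[THEN L2_measurable] by measurable
  show "AE x in lborel. norm (h x * cnj (k x)) \<le> norm ((norm (h x))\<^sup>2 + (norm (k x))\<^sup>2)"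
  proof (rule AE_I2)
    fix x
    show "norm (h x * cnj (k x)) \<le> norm ((norm (h x))\<^sup>2 + (norm (k x))\<^sup>2)"
      using norm_mult_le_sum_squares[of "h x" "cnj (k x)"] by simp
  qed
qed

lemma L2_add: "h \<in> L2 \<Longrightarrow> k \<in> L2 \<Longrightarrow> (\<lambda>x. h x + k x) \<in> L2"
proof -
  assume hk: "h \<in> L2" "k \<in> L2"
  note [measurable] = hk[THEN L2_measurable]
  have "integrable lborel (\<lambda>x. (norm (h x + k x))\<^sup>2)"
  proof (rule Bochner_Integration.integrable_bound)
    show "integrable lborel (\<lambda>x. 2 * (norm (h x))\<^sup>2 + 2 * (norm (k x))\<^sup>2)"
      using hk by (intro Bochner_Integration.integrable_add integrable_mult_right L2_integrable_sq)
    show "AE x in lborel. norm ((norm (h x + k x))\<^sup>2) \<le> norm (2 * (norm (h x))\<^sup>2 + 2 * (norm (k x))\<^sup>2)"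
    proof (rule AE_I2)
      fix x
      show "norm ((norm (h x + k x))\<^sup>2) \<le> norm (2 * (norm (h x))\<^sup>2 + 2 * (norm (k x))\<^sup>2)"
        using norm_add_sq_le[of "h x" "k x"] by simp
    qed
  qed measurable
  then show ?thesis by (simp add: L2_def)
qed

lemma L2_self: "L2_inner h h = of_real ((L2_norm h)\<^sup>2)"
proof -
  have "L2_inner h h = (LINT x|lborel. complex_of_real ((norm (h x))\<^sup>2))"
    unfolding L2_inner_def by (simp only: complex_norm_square)
  also have "\<dots> = of_real (LINT x|lborel. (norm (h x))\<^sup>2)"
    by (rule integral_complex_of_real)
  finally show ?thesis by (simp add: L2_norm_def)
qed

interpretation L2: semi_inner "L2 :: (real^'m \<Rightarrow> complex) set" L2_inner
  rewrites "semi_inner.nrm (L2_inner :: (real^'m \<Rightarrow> complex) \<Rightarrow> _) = L2_norm"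
proof -
  show si: "semi_inner (L2 :: (real^'m \<Rightarrow> complex) set) L2_inner"
  proof
    show "(\<lambda>_. 0) \<in> (L2 :: (real^'m \<Rightarrow> complex) set)" by (simp add: L2_def)
  next
    fix x y :: "real^'m \<Rightarrow> complex" assume "x \<in> L2" "y \<in> L2"
    then show "(\<lambda>a. x a + y a) \<in> L2" by (rule L2_add)
  next
    fix x :: "real^'m \<Rightarrow> complex" and c assume "x \<in> L2"
    then show "(\<lambda>a. c * x a) \<in> L2"
      by (auto simp: L2_def norm_mult power_mult_distrib intro: borel_measurable_times)
  next
    fix x y z :: "real^'m \<Rightarrow> complex" assume "x \<in> L2" "y \<in> L2" "z \<in> L2"
    then show "L2_inner (\<lambda>a. x a + y a) z = L2_inner x z + L2_inner y z"
      by (simp add: L2_inner_def distrib_right L2_mult_integrable)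
  next
    fix x z :: "real^'m \<Rightarrow> complex" and c assume "x \<in> L2" "z \<in> L2"
    then show "L2_inner (\<lambda>a. c * x a) z = c * L2_inner x z"
      by (simp add: L2_inner_def mult.assoc)
  next
    fix x y :: "real^'m \<Rightarrow> complex"
    have "cnj (L2_inner x y) = (LINT t|lborel. cnj (x t * cnj (y t)))"
      by (simp add: L2_inner_def del: complex_cnj_mult)
    then show "L2_inner y x = cnj (L2_inner x y)" by (simp add: L2_inner_def mult.commute)
  next
    fix x :: "real^'m \<Rightarrow> complex"
    show "0 \<le> Re (L2_inner x x)" by (simp add: L2_self del: of_real_power)
  qed
  show "semi_inner.nrm (L2_inner :: (real^'m \<Rightarrow> complex) \<Rightarrow> _) = L2_norm"
    by (rule ext) (simp add: semi_inner.nrm_def[OF si] L2_self L2_norm_def del: of_real_power)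
qed

section \<open>Square-summable families\<close>

definition l2_norm :: "('i \<Rightarrow> complex) \<Rightarrow> real" where
  "l2_norm c = sqrt (\<Sum>\<^sub>\<infinity>i. (norm (c i))\<^sup>2)"

lemma l2_norm_sq: "(l2_norm c)\<^sup>2 = (\<Sum>\<^sub>\<infinity>i. (norm (c i))\<^sup>2)"
  by (simp add: l2_norm_def infsum_nonneg)

lemma l2_mult_summable:
  assumes "c \<in> l2" "d \<in> l2"
  shows "(\<lambda>i. c i * cnj (d i)) summable_on UNIV"
proof -
  have "(\<lambda>i. (norm (c i))\<^sup>2 + (norm (d i))\<^sup>2) summable_on UNIV"
    using assms by (intro summable_on_add) (auto simp: l2_def)
  then have "(\<lambda>i. norm (c i * cnj (d i))) summable_on UNIV"
  proof (rule summable_on_comparison_test)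
    fix i
    show "norm (c i * cnj (d i)) \<le> (norm (c i))\<^sup>2 + (norm (d i))\<^sup>2"
      using norm_mult_le_sum_squares[of "c i" "cnj (d i)"] by simp
  qed simp
  then show ?thesis by (rule abs_summable_summable)
qed

lemma l2_add: "c \<in> l2 \<Longrightarrow> d \<in> l2 \<Longrightarrow> (\<lambda>i. c i + d i) \<in> l2"
proof -
  assume cd: "c \<in> l2" "d \<in> l2"
  then have "(\<lambda>i. 2 * (norm (c i))\<^sup>2 + 2 * (norm (d i))\<^sup>2) summable_on UNIV"
    by (intro summable_on_add summable_on_cmult_right) (auto simp: l2_def)
  then have "(\<lambda>i. (norm (c i + d i))\<^sup>2) summable_on UNIV"
    by (rule summable_on_comparison_test) (auto intro: norm_add_sq_le)
  then show ?thesis by (simp add: l2_def)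
qed

lemma l2_self: "l2_inner c c = of_real ((l2_norm c)\<^sup>2)"
proof -
  have "l2_inner c c = (\<Sum>\<^sub>\<infinity>i. complex_of_real ((norm (c i))\<^sup>2))"
    unfolding l2_inner_def by (simp only: complex_norm_square)
  also have "\<dots> = of_real (\<Sum>\<^sub>\<infinity>i. (norm (c i))\<^sup>2)"
  proof (cases "(\<lambda>i. (norm (c i))\<^sup>2) summable_on UNIV")
    case True
    then show ?thesis by (intro infsumI has_sum_of_real has_sum_infsum)
  next
    case False
    \<comment> \<open>Outside \<open>l2\<close> both infinite sums take the default value 0.\<close>
    then have "\<not> (\<lambda>i. complex_of_real ((norm (c i))\<^sup>2)) summable_on UNIV"
      using summable_on_Re by fastforce
    from infsum_not_exists[OF this] infsum_not_exists[OF False] show ?thesis by simp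
  qed
  finally show ?thesis by (simp add: l2_norm_sq)
qed

interpretation l2: semi_inner "l2 :: ('i \<Rightarrow> complex) set" l2_inner
  rewrites "semi_inner.nrm (l2_inner :: ('i \<Rightarrow> complex) \<Rightarrow> _) = l2_norm"
proof -
  show si: "semi_inner (l2 :: ('i \<Rightarrow> complex) set) l2_inner"
  proof
    show "(\<lambda>_. 0) \<in> (l2 :: ('i \<Rightarrow> complex) set)" by (simp add: l2_def)
  next
    fix x y :: "'i \<Rightarrow> complex" assume "x \<in> l2" "y \<in> l2"
    then show "(\<lambda>a. x a + y a) \<in> l2" by (rule l2_add)
  next
    fix x :: "'i \<Rightarrow> complex" and c assume "x \<in> l2"
    then show "(\<lambda>a. c * x a) \<in> l2"
      by (simp add: l2_def norm_mult power_mult_distrib summable_on_cmult_right)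
  next
    fix x y z :: "'i \<Rightarrow> complex" assume "x \<in> l2" "y \<in> l2" "z \<in> l2"
    then show "l2_inner (\<lambda>a. x a + y a) z = l2_inner x z + l2_inner y z"
      by (simp add: l2_inner_def distrib_right l2_mult_summable infsum_add)
  next
    fix x z :: "'i \<Rightarrow> complex" and c assume "x \<in> l2" "z \<in> l2"
    then show "l2_inner (\<lambda>a. c * x a) z = c * l2_inner x z"
      by (simp add: l2_inner_def mult.assoc infsum_cmult_right')
  next
    fix x y :: "'i \<Rightarrow> complex"
    have "cnj (l2_inner x y) = (\<Sum>\<^sub>\<infinity>i. cnj (x i * cnj (y i)))"
      unfolding l2_inner_def by (simp only: infsum_cnj)
    then show "l2_inner y x = cnj (l2_inner x y)" by (simp add: l2_inner_def mult.commute)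
  next
    fix x :: "'i \<Rightarrow> complex"
    show "0 \<le> Re (l2_inner x x)" by (simp add: l2_self del: of_real_power)
  qed
  show "semi_inner.nrm (l2_inner :: ('i \<Rightarrow> complex) \<Rightarrow> _) = l2_norm"
    by (rule ext) (simp add: semi_inner.nrm_def[OF si] l2_self l2_norm_def infsum_nonneg del: of_real_power)
qed

lemma delta_mem_l2: "delta j \<in> l2"
proof -
  have "(\<lambda>i. (norm (delta j i))\<^sup>2) summable_on UNIV \<longleftrightarrow> (\<lambda>i. (norm (delta j i))\<^sup>2) summable_on {j}"
    by (rule summable_on_cong_neutral) (auto simp: delta_def)
  then show ?thesis by (simp add: l2_def)
qed

lemma l2_inner_delta: "l2_inner c (delta j) = c j"
proof -
  have "l2_inner c (delta j) = (\<Sum>\<^sub>\<infinity>i\<in>{j}. c i * cnj (delta j i))"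
    unfolding l2_inner_def by (rule infsum_cong_neutral) (auto simp: delta_def)
  then show ?thesis by (simp add: delta_def)
qed

text \<open>Riesz-Fischer for a rapidly Cauchy sequence. The squared increments are at most 4^(-n),
  so they stay summable after weighting with 2^n. Finiteness of the weighted sum at almost every
  point forces the increments there below 2^(-n/2) eventually, hence the telescoping series
  converges absolutely.\<close>

lemma L2_complete:
  fixes f :: "nat \<Rightarrow> real^'m \<Rightarrow> complex"
  assumes f: "\<And>n. f n \<in> L2"
    and fast: "\<And>n. (L2_norm (\<lambda>x. f (Suc n) x - f n x))\<^sup>2 \<le> (1/4) ^ n"
  obtains u where "u \<in> L2" "(\<lambda>n. L2_norm (\<lambda>x. u x - f n x)) \<longlonglongrightarrow> 0"
proof -
  note [measurable] = L2_measurable[OF f]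
  define e where "e n x = f (Suc n) x - f n x" for n x
  have e_meas[measurable]: "e n \<in> borel_measurable lborel" for n
    unfolding e_def by measurable
  have e_L2: "e n \<in> L2" for n unfolding e_def by (intro L2.diff_mem f)
  have nn: "(\<integral>\<^sup>+x. ennreal ((norm (k x))\<^sup>2) \<partial>lborel) = ennreal ((L2_norm k)\<^sup>2)" if "k \<in> L2" for k :: "real^'m \<Rightarrow> complex"
    using nn_integral_eq_integral[OF L2_integrable_sq[OF that]] by (simp add: L2_norm_def)
  have "(\<integral>\<^sup>+x. (\<Sum>n. ennreal (2 ^ n * (norm (e n x))\<^sup>2)) \<partial>lborel)
      = (\<Sum>n. \<integral>\<^sup>+x. ennreal (2 ^ n * (norm (e n x))\<^sup>2) \<partial>lborel)"
    by (rule nn_integral_suminf) measurable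
  also have "\<dots> = (\<Sum>n. ennreal (2 ^ n * (L2_norm (e n))\<^sup>2))"
    by (simp add: ennreal_mult nn_integral_cmult nn e_L2)
  also have "\<dots> \<le> (\<Sum>n. ennreal ((1/2) ^ n))"
  proof (intro suminf_le allI)
    fix n
    have "(2::real) ^ n * (L2_norm (e n))\<^sup>2 \<le> 2 ^ n * (1/4) ^ n"
      using fast[of n] unfolding e_def[symmetric] by (intro mult_left_mono) (simp_all add: e_def[abs_def])
    also have "\<dots> = (1/2) ^ n" by (simp flip: power_mult_distrib)
    finally show "ennreal (2 ^ n * (L2_norm (e n))\<^sup>2) \<le> ennreal ((1/2) ^ n)"
      by (rule ennreal_leI)
  qed simp_all
  also have "\<dots> = ennreal 2"
    using geometric_sums[of "1/2::real"] by (intro suminf_ennreal_eq) auto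
  finally have fin: "(\<integral>\<^sup>+x. (\<Sum>n. ennreal (2 ^ n * (norm (e n x))\<^sup>2)) \<partial>lborel) < \<infinity>"
    by (simp add: order_le_less_trans)
  have AE_fin: "AE x in lborel. (\<Sum>n. ennreal (2 ^ n * (norm (e n x))\<^sup>2)) \<noteq> \<infinity>"
    using fin by (intro nn_integral_PInf_AE) auto
  have AE_conv: "AE x in lborel. convergent (\<lambda>n. f n x)"
    using AE_fin
  proof eventually_elim
    fix x assume "(\<Sum>n. ennreal (2 ^ n * (norm (e n x))\<^sup>2)) \<noteq> \<infinity>"
    then have "summable (\<lambda>n. 2 ^ n * (norm (e n x))\<^sup>2)"
      by (intro summable_suminf_not_top) auto
    then have "(\<lambda>n. 2 ^ n * (norm (e n x))\<^sup>2) \<longlonglongrightarrow> 0"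
      by (rule summable_LIMSEQ_zero)
    then have ev: "eventually (\<lambda>n. 2 ^ n * (norm (e n x))\<^sup>2 < 1) sequentially"
      by (rule order_tendstoD) simp
    have "summable (\<lambda>n. e n x)"
    proof (rule summable_comparison_test_ev)
      show "eventually (\<lambda>n. norm (e n x) \<le> (sqrt (1/2)) ^ n) sequentially"
        using ev
      proof eventually_elim
        fix n assume "2 ^ n * (norm (e n x))\<^sup>2 < 1"
        then have "(norm (e n x))\<^sup>2 \<le> (1/2) ^ n"
          by (simp add: power_one_over field_simps)
        also have "\<dots> = (sqrt (1/2) ^ n)\<^sup>2"
          by (simp add: power_mult[symmetric] mult.commute[of n]) (simp add: power_mult)
        finally show "norm (e n x) \<le> (sqrt (1/2)) ^ n"
          by (rule power2_le_imp_le) simp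
      qed
      show "summable (\<lambda>n. (sqrt (1/2)) ^ n)"
        by (rule summable_geometric) (simp add: real_sqrt_divide)
    qed
    then have "convergent (\<lambda>n. \<Sum>k<n. e k x)"
      by (simp add: summable_iff_convergent)
    moreover have "(\<lambda>n. \<Sum>k<n. e k x) = (\<lambda>n. f n x - f 0 x)"
      unfolding e_def by (rule ext) (rule sum_lessThan_telescope)
    ultimately show "convergent (\<lambda>n. f n x)"
      using convergent_add[of "\<lambda>n. f n x - f 0 x" "\<lambda>_. f 0 x"] by (simp add: convergent_const)
  qed
  \<comment> \<open>\<open>lim\<close> is unspecified where the sequence diverges, which happens
    only on a null set.\<close>
  define u where "u x = lim (\<lambda>n. f n x)" for x
  have u_meas[measurable]: "u \<in> borel_measurable lborel"
    unfolding u_def by measurable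
  have AE_lim: "AE x in lborel. (\<lambda>n. f n x) \<longlonglongrightarrow> u x"
    using AE_conv by eventually_elim (simp add: u_def convergent_LIMSEQ_iff)
  have geo: "L2_norm (\<lambda>x. f (n + k) x - f n x) \<le> (\<Sum>j<k. (1/2) ^ (n + j))" for n k
  proof (induction k)
    case 0
    then show ?case by (simp add: L2_norm_def)
  next
    case (Suc k)
    have "L2_norm (\<lambda>x. f (n + Suc k) x - f n x)
        = L2_norm (\<lambda>x. (f (n + k) x - f n x) + e (n + k) x)"
      by (simp add: e_def)
    also have "\<dots> \<le> L2_norm (\<lambda>x. f (n + k) x - f n x) + L2_norm (e (n + k))"
      by (intro L2.nrm_triangle L2.diff_mem f e_L2)
    also have "L2_norm (e (n + k)) \<le> (1/2) ^ (n + k)"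
    proof (rule power2_le_imp_le)
      have "((1/2::real) ^ (n + k))\<^sup>2 = (1/4) ^ (n + k)"
        by (simp add: power2_eq_square flip: power_mult_distrib)
      then show "(L2_norm (e (n + k)))\<^sup>2 \<le> ((1/2) ^ (n + k))\<^sup>2"
        using fast[of "n + k"] by (simp add: e_def[abs_def])
    qed simp
    finally show ?case using Suc by simp
  qed
  have sum_le: "(\<Sum>j<k. (1/2::real) ^ (n + j)) \<le> 2 * (1/2) ^ n" for n k
  proof -
    have "(\<Sum>j<k. (1/2::real) ^ (n + j)) = (1/2) ^ n * (\<Sum>j<k. (1/2) ^ j)"
      by (simp add: power_add sum_distrib_left)
    also have "(\<Sum>j<k. (1/2::real) ^ j) \<le> 2"
      by (simp add: sum_gp_strict)
    finally show ?thesis by simp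
  qed
  \<comment> \<open>Fatou in \<open>k\<close>: the limit inherits the geometric bound on
    \<open>f (n + k) - f n\<close>. This gives both membership in \<open>L2\<close> and the rate of
    convergence.\<close>
  have dist_le: "(\<integral>\<^sup>+x. ennreal ((norm (u x - f n x))\<^sup>2) \<partial>lborel) \<le> ennreal ((2 * (1/2) ^ n)\<^sup>2)" for n
  proof -
    have "(\<integral>\<^sup>+x. ennreal ((norm (u x - f n x))\<^sup>2) \<partial>lborel)
        \<le> (\<integral>\<^sup>+x. liminf (\<lambda>k. ennreal ((norm (f (n + k) x - f n x))\<^sup>2)) \<partial>lborel)"
    proof (rule nn_integral_mono_AE)
      show "AE x in lborel. ennreal ((norm (u x - f n x))\<^sup>2) \<le> liminf (\<lambda>k. ennreal ((norm (f (n + k) x - f n x))\<^sup>2))"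
        using AE_lim
      proof eventually_elim
        fix x assume "(\<lambda>n. f n x) \<longlonglongrightarrow> u x"
        then have "(\<lambda>k. f (k + n) x) \<longlonglongrightarrow> u x" by (rule LIMSEQ_ignore_initial_segment)
        then have "(\<lambda>k. ennreal ((norm (f (n + k) x - f n x))\<^sup>2)) \<longlonglongrightarrow> ennreal ((norm (u x - f n x))\<^sup>2)"
          by (intro tendsto_ennrealI tendsto_power tendsto_norm tendsto_diff tendsto_const)
            (simp add: add.commute)
        then have "liminf (\<lambda>k. ennreal ((norm (f (n + k) x - f n x))\<^sup>2)) = ennreal ((norm (u x - f n x))\<^sup>2)"
          by (intro lim_imp_Liminf) simp_all
        then show "ennreal ((norm (u x - f n x))\<^sup>2) \<le> liminf (\<lambda>k. ennreal ((norm (f (n + k) x - f n x))\<^sup>2))"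
          by (simp only: order_refl)
      qed
    qed
    also have "\<dots> \<le> liminf (\<lambda>k. \<integral>\<^sup>+x. ennreal ((norm (f (n + k) x - f n x))\<^sup>2) \<partial>lborel)"
      by (rule nn_integral_liminf) measurable
    also have "\<dots> \<le> ennreal ((2 * (1/2) ^ n)\<^sup>2)"
    proof (rule Liminf_le)
      show "eventually (\<lambda>k. (\<integral>\<^sup>+x. ennreal ((norm (f (n + k) x - f n x))\<^sup>2) \<partial>lborel) \<le> ennreal ((2 * (1/2) ^ n)\<^sup>2)) sequentially"
      proof (rule always_eventually, rule allI)
        fix k
        have "(L2_norm (\<lambda>x. f (n + k) x - f n x))\<^sup>2 \<le> (2 * (1/2) ^ n)\<^sup>2"
          by (intro power_mono order_trans[OF geo sum_le] L2.nrm_ge_0 L2.diff_mem f)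
        then show "(\<integral>\<^sup>+x. ennreal ((norm (f (n + k) x - f n x))\<^sup>2) \<partial>lborel) \<le> ennreal ((2 * (1/2) ^ n)\<^sup>2)"
          by (simp add: nn L2.diff_mem f ennreal_leI)
      qed
    qed simp
    finally show ?thesis .
  qed
  have diff_L2: "(\<lambda>x. u x - f n x) \<in> L2" for n
    using dist_le[of n] unfolding L2_def
    by (auto intro!: integrableI_bounded simp: order_le_less_trans)
  have "(\<lambda>x. (u x - f 0 x) + f 0 x) \<in> L2"
    by (intro L2.add_mem diff_L2 f)
  then have "u \<in> L2" by simp
  moreover have "(\<lambda>n. L2_norm (\<lambda>x. u x - f n x)) \<longlonglongrightarrow> 0"
  proof (rule Lim_null_comparison)
    show "eventually (\<lambda>n. norm (L2_norm (\<lambda>x. u x - f n x)) \<le> 2 * (1/2) ^ n) sequentially"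
    proof (rule always_eventually, rule allI)
      fix n
      have "ennreal ((L2_norm (\<lambda>x. u x - f n x))\<^sup>2) \<le> ennreal ((2 * (1/2) ^ n)\<^sup>2)"
        using dist_le[of n] by (simp add: nn diff_L2)
      then have "(L2_norm (\<lambda>x. u x - f n x))\<^sup>2 \<le> (2 * (1/2) ^ n)\<^sup>2"
        by (simp add: ennreal_le_iff)
      then have "L2_norm (\<lambda>x. u x - f n x) \<le> 2 * (1/2) ^ n"
        by (rule power2_le_imp_le) simp
      then show "norm (L2_norm (\<lambda>x. u x - f n x)) \<le> 2 * (1/2) ^ n"
        using L2.nrm_ge_0[OF diff_L2[of n]] by simp
    qed
    show "(\<lambda>n. 2 * (1/2::real) ^ n) \<longlonglongrightarrow> 0"
      by (intro tendsto_mult_right_zero LIMSEQ_power_zero) simp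
  qed
  ultimately show thesis by (rule that)
qed

subsection \<open>Frames and the Gram projection\<close>

lemma norm_le_l2_norm:
  assumes "c \<in> l2" shows "norm (c i) \<le> l2_norm c"
proof -
  have "(\<Sum>j\<in>{i}. (norm (c j))\<^sup>2) \<le> (\<Sum>\<^sub>\<infinity>j. (norm (c j))\<^sup>2)"
    using assms by (intro finite_sum_le_infsum) (auto simp: l2_def)
  then show ?thesis
    unfolding l2_norm_def by (intro real_le_rsqrt) simp
qed

lemma l2_restrict:
  assumes "c \<in> l2"
  shows "(\<lambda>j. if j \<in> F then 0 else c j) \<in> l2"
    and "(l2_norm (\<lambda>j. if j \<in> F then 0 else c j))\<^sup>2 = (\<Sum>\<^sub>\<infinity>j\<in>-F. (norm (c j))\<^sup>2)"
proof -
  have "(\<lambda>j. (norm (c j))\<^sup>2) summable_on -F"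
    using assms summable_on_subset[of _ UNIV] by (auto simp: l2_def)
  moreover have "(\<lambda>j. (norm (if j \<in> F then 0 else c j))\<^sup>2) summable_on UNIV
      \<longleftrightarrow> (\<lambda>j. (norm (c j))\<^sup>2) summable_on -F"
    by (rule summable_on_cong_neutral) auto
  ultimately show "(\<lambda>j. if j \<in> F then 0 else c j) \<in> l2" by (simp add: l2_def)
  show "(l2_norm (\<lambda>j. if j \<in> F then 0 else c j))\<^sup>2 = (\<Sum>\<^sub>\<infinity>j\<in>-F. (norm (c j))\<^sup>2)"
    unfolding l2_norm_sq by (rule infsum_cong_neutral) auto
qed

lemma l2_inner_split:
  assumes "c \<in> l2" "e \<in> l2" "finite F"
  shows "l2_inner c e = (\<Sum>j\<in>F. c j * cnj (e j)) + l2_inner (\<lambda>j. if j \<in> F then 0 else c j) e"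
proof -
  have "(\<lambda>j. if j \<in> F then c j else 0) = (\<lambda>j. if j \<in> -F then 0 else c j)"
    by auto
  then have on_F: "(\<lambda>j. if j \<in> F then c j else 0) \<in> l2"
    using l2_restrict(1)[OF assms(1), of "-F"] by metis
  have "l2_inner c e = l2_inner (\<lambda>j. (if j \<in> F then c j else 0) + (if j \<in> F then 0 else c j)) e"
    by (rule arg_cong[where f="\<lambda>c. l2_inner c e"]) auto
  also have "\<dots> = l2_inner (\<lambda>j. if j \<in> F then c j else 0) e + l2_inner (\<lambda>j. if j \<in> F then 0 else c j) e"
    by (rule l2.ip_add[OF on_F l2_restrict(1)[OF assms(1)] assms(2)])
  also have "l2_inner (\<lambda>j. if j \<in> F then c j else 0) e = (\<Sum>\<^sub>\<infinity>j\<in>F. c j * cnj (e j))"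
    unfolding l2_inner_def by (rule infsum_cong_neutral) auto
  finally show ?thesis using assms(3) by simp
qed

lemma sum_le_infsum_subset:
  fixes f :: "'i \<Rightarrow> real"
  assumes "f summable_on UNIV" "finite Y" "Y \<subseteq> S" "\<And>i. 0 \<le> f i"
  shows "sum f Y \<le> infsum f S"
  by (rule finite_sum_le_infsum) (use assms summable_on_subset[of f UNIV S] in auto)

text \<open>\<open>A_le_B\<close> keeps the contraction factor 1 - A/(4B) of the Richardson
  iteration nonnegative.\<close>

locale L2_frame =
  fixes G :: "'i \<Rightarrow> real^'m \<Rightarrow> complex" and A B :: real
  assumes G_L2: "G i \<in> L2"
    and A_pos: "0 < A" and A_le_B: "A \<le> B"
    and coeff_summable: "h \<in> L2 \<Longrightarrow> (\<lambda>i. (norm (L2_inner h (G i)))\<^sup>2) summable_on UNIV"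
    and lower: "h \<in> L2 \<Longrightarrow> A * (L2_norm h)\<^sup>2 \<le> (\<Sum>\<^sub>\<infinity>i. (norm (L2_inner h (G i)))\<^sup>2)"
    and upper: "h \<in> L2 \<Longrightarrow> (\<Sum>\<^sub>\<infinity>i. (norm (L2_inner h (G i)))\<^sup>2) \<le> B * (L2_norm h)\<^sup>2"
begin

lemma B_pos: "0 < B" using A_pos A_le_B by linarith

definition analysis :: "(real^'m \<Rightarrow> complex) \<Rightarrow> 'i \<Rightarrow> complex" where
  "analysis h = (\<lambda>i. L2_inner h (G i))"

text \<open>Synthesis is used for finite index sets, so it is a pointwise sum and raises no question
  of convergence in \<open>L2\<close>. For an infinite \<open>F\<close> it is the zero
  function.\<close>

definition synth :: "'i set \<Rightarrow> ('i \<Rightarrow> complex) \<Rightarrow> real^'m \<Rightarrow> complex" where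
  "synth F x = (\<lambda>t. \<Sum>j\<in>F. x j * G j t)"

lemma analysis_l2: "h \<in> L2 \<Longrightarrow> analysis h \<in> l2"
  using coeff_summable by (simp add: analysis_def l2_def)

lemma analysis_add: "h \<in> L2 \<Longrightarrow> k \<in> L2 \<Longrightarrow> analysis (\<lambda>x. h x + k x) = (\<lambda>i. analysis h i + analysis k i)"
  by (simp add: analysis_def L2.ip_add G_L2)

lemma analysis_diff: "h \<in> L2 \<Longrightarrow> k \<in> L2 \<Longrightarrow> analysis (\<lambda>x. h x - k x) = (\<lambda>i. analysis h i - analysis k i)"
  by (simp add: analysis_def L2.ip_diff G_L2)

lemma analysis_scale: "h \<in> L2 \<Longrightarrow> analysis (\<lambda>x. s * h x) = (\<lambda>i. s * analysis h i)"
  by (simp add: analysis_def L2.ip_scale G_L2)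

lemma analysis_lower: "h \<in> L2 \<Longrightarrow> A * (L2_norm h)\<^sup>2 \<le> (l2_norm (analysis h))\<^sup>2"
  using lower by (simp add: analysis_def l2_norm_sq)

lemma analysis_upper: "h \<in> L2 \<Longrightarrow> (l2_norm (analysis h))\<^sup>2 \<le> B * (L2_norm h)\<^sup>2"
  using upper by (simp add: analysis_def l2_norm_sq)

lemma analysis_upper': "h \<in> L2 \<Longrightarrow> l2_norm (analysis h) \<le> sqrt B * L2_norm h"
  by (rule power2_le_imp_le)
    (use analysis_upper B_pos in \<open>simp_all add: power_mult_distrib L2.nrm_ge_0\<close>)

lemma analysis_range_eq: "analysis_range G = analysis ` L2"
  by (auto simp: analysis_range_def analysis_def)

lemma synth_L2: "synth F x \<in> L2"
  unfolding synth_def by (rule L2.sum_mem) (rule G_L2)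

lemma inner_synth:
  assumes "f \<in> L2"
  shows "L2_inner (synth F x) f = (\<Sum>j\<in>F. x j * cnj (analysis f j))"
  unfolding synth_def analysis_def
  by (simp add: L2.ip_sum G_L2 assms L2.ip_cnj[OF assms G_L2])

text \<open>The range of the analysis operator is complete because of the lower frame bound, hence a
  minimizing sequence for the distance from \<open>c\<close> to it converges.\<close>

lemma exists_projection:
  assumes c: "c \<in> l2"
  shows "\<exists>u\<in>L2. \<forall>z\<in>L2. l2_inner (\<lambda>i. c i - analysis u i) (analysis z) = 0"
proof -
  let ?r = "\<lambda>h i. c i - analysis h i"
  define val where "val h = (l2_norm (?r h))\<^sup>2" for h
  define m where "m = Inf (val ` L2)"
  have r_l2: "?r h \<in> l2" if "h \<in> L2" for h
    using l2.diff_mem[OF c analysis_l2[OF that]] .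
  have bdd: "bdd_below (val ` L2)" by (rule bdd_belowI2[of _ 0]) (simp add: val_def)
  have m_le: "m \<le> val h" if "h \<in> L2" for h
    unfolding m_def using that by (intro cInf_lower bdd) simp
  have ne: "val ` L2 \<noteq> {}" using L2.zero_mem by blast
  have m_nonneg: "0 \<le> m" unfolding m_def by (rule cInf_greatest[OF ne]) (auto simp: val_def)
  \<comment> \<open>The parallelogram law will bound the squared distance of consecutive analysis
    sequences by \<open>4 * e n\<close>. Dividing by the lower frame bound \<open>A\<close> leaves
    exactly the (1/4)^n demanded by \<open>L2_complete\<close>.\<close>
  define e where "e n = A / 4 * (1/4) ^ n" for n :: nat
  have e_pos: "0 < e n" for n using A_pos by (simp add: e_def)
  have "\<exists>h\<in>L2. val h < m + e n" for n
    using cInf_lessD[OF ne, of "m + e n"] e_pos[of n] unfolding m_def by auto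
  then obtain h where h: "\<And>n. h n \<in> L2" "\<And>n. val (h n) < m + e n"
    by metis
  have "(L2_norm (\<lambda>x. h (Suc n) x - h n x))\<^sup>2 \<le> (1/4) ^ n" for n
  proof -
    let ?x = "?r (h n)" and ?y = "?r (h (Suc n))"
    \<comment> \<open>The residual of the midpoint is the mean of the two residuals and has squared
      norm at least \<open>m\<close>; in the parallelogram law this leaves little room for the
      difference of the residuals.\<close>
    let ?mid = "\<lambda>x. (1/2) * (h n x + h (Suc n) x)"
    have sum_L2: "(\<lambda>x. h n x + h (Suc n) x) \<in> L2" by (intro L2.add_mem h)
    have mid: "?mid \<in> L2" by (intro L2.scale_mem sum_L2)
    have "analysis ?mid = (\<lambda>i. (1/2) * (analysis (h n) i + analysis (h (Suc n)) i))"
      by (simp only: analysis_scale[OF sum_L2] analysis_add[OF h(1) h(1)])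
    then have "(\<lambda>i. ?x i + ?y i) = (\<lambda>i. 2 * ?r ?mid i)"
      by (simp add: fun_eq_iff algebra_simps)
    then have "(l2_norm (\<lambda>i. ?x i + ?y i))\<^sup>2 = 4 * val ?mid"
      using l2.nrm_scale[OF r_l2[OF mid], of 2] by (simp add: val_def power_mult_distrib)
    moreover have "(l2_norm (\<lambda>i. ?x i + ?y i))\<^sup>2 + (l2_norm (\<lambda>i. ?x i - ?y i))\<^sup>2
        = 2 * val (h n) + 2 * val (h (Suc n))"
      unfolding val_def by (rule l2.nrm_sq_add_diff[OF r_l2[OF h(1)] r_l2[OF h(1)]])
    moreover have "(\<lambda>i. ?x i - ?y i) = analysis (\<lambda>x. h (Suc n) x - h n x)"
      by (simp add: analysis_diff h)
    ultimately have "(l2_norm (analysis (\<lambda>x. h (Suc n) x - h n x)))\<^sup>2 \<le> 2 * e n + 2 * e (Suc n)"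
      using m_le[OF mid] h(2)[of n] h(2)[of "Suc n"] by simp
    also have "\<dots> \<le> 4 * e n"
      using A_pos by (simp add: e_def)
    also have "\<dots> = A * (1/4) ^ n" by (simp add: e_def)
    finally have "A * (L2_norm (\<lambda>x. h (Suc n) x - h n x))\<^sup>2 \<le> A * (1/4) ^ n"
      using analysis_lower[OF L2.diff_mem[OF h(1)[of "Suc n"] h(1)[of n]]] by linarith
    then show ?thesis using A_pos by simp
  qed
  from L2_complete[OF h(1) this]
  obtain u where u: "u \<in> L2" and lim: "(\<lambda>n. L2_norm (\<lambda>x. u x - h n x)) \<longlonglongrightarrow> 0" by blast
  \<comment> \<open>The limit attains the infimum, because the upper frame bound makes the analysis
    operator continuous.\<close>
  have "l2_norm (?r u) \<le> sqrt m"
  proof (rule LIMSEQ_le_const)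
    have "(\<lambda>n. A / 4 * (1/4) ^ n) \<longlonglongrightarrow> 0"
      by (intro tendsto_mult_right_zero LIMSEQ_power_zero) simp
    then have "(\<lambda>n. sqrt (m + e n)) \<longlonglongrightarrow> sqrt (m + 0)"
      unfolding e_def by (intro tendsto_intros)
    moreover have "(\<lambda>n. sqrt B * L2_norm (\<lambda>x. u x - h n x)) \<longlonglongrightarrow> sqrt B * 0"
      by (intro tendsto_mult lim tendsto_const)
    ultimately show "(\<lambda>n. sqrt (m + e n) + sqrt B * L2_norm (\<lambda>x. u x - h n x)) \<longlonglongrightarrow> sqrt m"
      using tendsto_add by force
    show "\<exists>N. \<forall>n\<ge>N. l2_norm (?r u) \<le> sqrt (m + e n) + sqrt B * L2_norm (\<lambda>x. u x - h n x)"
    proof (intro exI allI impI)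
      fix n
      let ?d = "\<lambda>x. u x - h n x"
      have d: "?d \<in> L2" by (intro L2.diff_mem u h)
      have "?r u = (\<lambda>i. ?r (h n) i + (-1) * analysis ?d i)"
        by (simp add: analysis_diff u h fun_eq_iff)
      then have "l2_norm (?r u) \<le> l2_norm (?r (h n)) + l2_norm (\<lambda>i. (-1) * analysis ?d i)"
        using l2.nrm_triangle[OF r_l2[OF h(1)] l2.scale_mem[OF analysis_l2[OF d], of "-1"]] by simp
      also have "l2_norm (\<lambda>i. (-1) * analysis ?d i) = l2_norm (analysis ?d)"
        using l2.nrm_scale[OF analysis_l2[OF d], of "-1"] by simp
      also have "\<dots> \<le> sqrt B * L2_norm ?d" by (rule analysis_upper'[OF d])
      also have "l2_norm (?r (h n)) \<le> sqrt (m + e n)"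
        using h(2)[of n] by (intro real_le_rsqrt) (simp add: val_def)
      finally show "l2_norm (?r u) \<le> sqrt (m + e n) + sqrt B * L2_norm ?d" by simp
    qed
  qed
  then have u_min: "l2_norm (?r u) \<le> l2_norm (?r h)" if "h \<in> L2" for h
  proof (rule order_trans)
    show "sqrt m \<le> l2_norm (?r h)"
      by (rule real_le_lsqrt) (use m_le[OF that] l2.nrm_ge_0[OF r_l2[OF that]] in \<open>simp_all add: val_def\<close>)
  qed
  have "l2_inner (?r u) (analysis z) = 0" if z: "z \<in> L2" for z
  proof (rule l2.ip_eq_0_of_nrm_min[OF r_l2[OF u] analysis_l2[OF z]])
    fix s
    have "(\<lambda>a. ?r u a - s * analysis z a) = ?r (\<lambda>x. u x + s * z x)"
      by (simp add: analysis_add[OF u L2.scale_mem[OF z]] analysis_scale[OF z] fun_eq_iff)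
    then show "l2_norm (?r u) \<le> l2_norm (\<lambda>a. ?r u a - s * analysis z a)"
      using u_min[OF L2.add_mem[OF u L2.scale_mem[OF z]]] by simp
  qed
  then show ?thesis using u by blast
qed

text \<open>Uniqueness for the \<open>THE\<close> in \<open>orth_proj\<close>: the difference of two
  candidates lies in the range and is orthogonal to itself. On families a vanishing
  \<open>l2_norm\<close> does force pointwise zero, so \<open>analysis u\<close> is determined even
  though \<open>u\<close> is so only up to null sets.\<close>

lemma gram_proj_eq:
  assumes c: "c \<in> l2" and u: "u \<in> L2"
    and orth: "\<And>z. z \<in> L2 \<Longrightarrow> l2_inner (\<lambda>i. c i - analysis u i) (analysis z) = 0"
  shows "gram_proj G c = analysis u"
  unfolding gram_proj_def orth_proj_def analysis_range_eq
proof (rule the_equality)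
  show "analysis u \<in> analysis ` L2 \<and> (\<forall>z\<in>analysis ` L2. l2_inner (c - analysis u) z = 0)"
    using u orth by (auto simp: fun_diff_def)
next
  fix y assume "y \<in> analysis ` L2 \<and> (\<forall>z\<in>analysis ` L2. l2_inner (c - y) z = 0)"
  then obtain w where w: "w \<in> L2" "y = analysis w"
    and orth_w: "\<And>z. z \<in> L2 \<Longrightarrow> l2_inner (\<lambda>i. c i - analysis w i) (analysis z) = 0"
    by (auto simp: fun_diff_def)
  let ?d = "\<lambda>x. u x - w x"
  have d: "?d \<in> L2" by (intro L2.diff_mem u w)
  have "l2_inner (analysis ?d) (analysis ?d)
      = l2_inner (\<lambda>i. (c i - analysis w i) - (c i - analysis u i)) (analysis ?d)"
    by (simp add: analysis_diff u w)
  also have "\<dots> = l2_inner (\<lambda>i. c i - analysis w i) (analysis ?d) - l2_inner (\<lambda>i. c i - analysis u i) (analysis ?d)"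
    by (intro l2.ip_diff l2.diff_mem c analysis_l2 u w d)
  also have "\<dots> = 0" using orth[OF d] orth_w[OF d] by simp
  finally have "l2_norm (analysis ?d) = 0" by (simp add: l2_self)
  then have "analysis ?d i = 0" for i
    using norm_le_l2_norm[OF analysis_l2[OF d], of i] by simp
  then show "y = analysis u"
    using w by (simp add: analysis_diff u fun_eq_iff)
qed

text \<open>One step of the damped Richardson iteration for the dual window \<open>u\<close>, with the synthesis
  truncated to the finite set \<open>F\<close>. Since \<open>c - analysis u\<close> is orthogonal to the range of the analysis operator,
  the residual \<open>c - analysis h\<close> acts like \<open>analysis (u - h)\<close>.\<close>

lemma richardson_step:
  assumes c: "c \<in> l2" and u: "u \<in> L2" and h: "h \<in> L2" and F: "finite F"
    and orth: "\<And>z. z \<in> L2 \<Longrightarrow> l2_inner (\<lambda>i. c i - analysis u i) (analysis z) = 0"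
    and tau: "(\<Sum>\<^sub>\<infinity>j\<in>-F. (norm (c j - analysis h j))\<^sup>2) \<le> \<tau>\<^sup>2" "0 \<le> \<tau>"
  shows "(L2_norm (\<lambda>t. u t - (h t + of_real (1 / (2 * B)) * synth F (\<lambda>j. c j - analysis h j) t)))\<^sup>2
    \<le> (1 - A / (4 * B)) * (L2_norm (\<lambda>t. u t - h t))\<^sup>2 + 3 / (2 * B) * \<tau>\<^sup>2"
proof -
  define x where "x = (\<lambda>j. c j - analysis h j)"
  define e where "e = (\<lambda>t. u t - h t)"
  define w where "w = synth F x"
  \<comment> \<open>Half of 1/B: with the bound \<open>w_sq\<close>, the quadratic term a^2 |w|^2
    becomes a (q^2 + \<tau>^2), which eats up only half of the linear gain 2 a q^2.\<close>
  define a where "a = 1 / (2 * B)"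
  define q where "q = l2_norm (analysis e)"
  have e: "e \<in> L2" unfolding e_def by (rule L2.diff_mem[OF u h])
  have w: "w \<in> L2" unfolding w_def by (rule synth_L2)
  have x: "x \<in> l2" unfolding x_def by (rule l2.diff_mem[OF c analysis_l2[OF h]])
  have q0: "0 \<le> q" unfolding q_def by (rule l2.nrm_ge_0[OF analysis_l2[OF e]])
  have a: "0 < a" using B_pos by (simp add: a_def)
  let ?y = "\<lambda>j. if j \<in> F then 0 else x j"
  have y: "?y \<in> l2" by (rule l2_restrict(1)[OF x])
  have "(l2_norm ?y)\<^sup>2 \<le> \<tau>\<^sup>2"
    using tau(1) unfolding l2_restrict(2)[OF x] by (simp add: x_def)
  then have y_le: "l2_norm ?y \<le> \<tau>" by (rule power2_le_imp_le) (rule tau(2))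
  have x_inner: "l2_inner x (analysis f) = l2_inner (analysis e) (analysis f)" if "f \<in> L2" for f
  proof -
    have "x = (\<lambda>j. (c j - analysis u j) + analysis e j)"
      by (simp add: x_def e_def analysis_diff u h)
    then show ?thesis
      using l2.ip_add[OF l2.diff_mem[OF c analysis_l2[OF u]] analysis_l2[OF e] analysis_l2[OF that]] orth[OF that]
      by simp
  qed
  \<comment> \<open>\<open>w\<close> represents the frame operator applied to the error
    \<open>e\<close>, up to the discarded part \<open>?y\<close> of the residual.\<close>
  have w_inner: "L2_inner w f = l2_inner (analysis e) (analysis f) - l2_inner ?y (analysis f)" if "f \<in> L2" for f
    using inner_synth[OF that, of F x] l2_inner_split[OF x analysis_l2[OF that] F] x_inner[OF that]
    by (simp add: w_def)
  have y_inner: "cmod (l2_inner ?y (analysis f)) \<le> \<tau> * l2_norm (analysis f)" if "f \<in> L2" for f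
    using l2.Cauchy_Schwarz[OF y analysis_l2[OF that]]
      mult_right_mono[OF y_le l2.nrm_ge_0[OF analysis_l2[OF that]]] by linarith
  have w_le: "L2_norm w \<le> sqrt B * (q + \<tau>)"
  proof (cases "L2_norm w = 0")
    case True
    then show ?thesis using q0 tau(2) B_pos by simp
  next
    case False
    then have pos: "L2_norm w > 0" using L2.nrm_ge_0[OF w] by simp
    have "(L2_norm w)\<^sup>2 = cmod (L2_inner w w)" by (simp add: L2_self del: of_real_power)
    also have "\<dots> \<le> cmod (l2_inner (analysis e) (analysis w)) + cmod (l2_inner ?y (analysis w))"
      unfolding w_inner[OF w] by (rule norm_triangle_ineq4)
    also have "\<dots> \<le> q * l2_norm (analysis w) + \<tau> * l2_norm (analysis w)"
      unfolding q_def by (intro add_mono l2.Cauchy_Schwarz analysis_l2 e w y_inner)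
    also have "\<dots> = (q + \<tau>) * l2_norm (analysis w)" by (simp add: distrib_right)
    also have "\<dots> \<le> (q + \<tau>) * (sqrt B * L2_norm w)"
      using q0 tau(2) by (intro mult_left_mono analysis_upper' w) simp
    finally have "L2_norm w * L2_norm w \<le> (sqrt B * (q + \<tau>)) * L2_norm w"
      by (simp add: power2_eq_square mult_ac)
    then show ?thesis using pos by (rule mult_right_le_imp_le)
  qed
  have w_sq: "(L2_norm w)\<^sup>2 \<le> B * (2 * q\<^sup>2 + 2 * \<tau>\<^sup>2)"
  proof -
    have "(L2_norm w)\<^sup>2 \<le> (sqrt B * (q + \<tau>))\<^sup>2"
      by (rule power_mono[OF w_le L2.nrm_ge_0[OF w]])
    also have "\<dots> = B * (q + \<tau>)\<^sup>2" using B_pos by (simp add: power_mult_distrib)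
    also have "\<dots> \<le> B * (2 * q\<^sup>2 + 2 * \<tau>\<^sup>2)"
      using sum_squares_bound[of q \<tau>] B_pos by (intro mult_left_mono) (simp_all add: power2_sum)
    finally show ?thesis .
  qed
  have re: "Re (L2_inner e w) \<ge> q\<^sup>2 - \<tau> * q"
  proof -
    have "Re (L2_inner e w) = Re (L2_inner w e)" using L2.ip_cnj[OF w e] by simp
    also have "\<dots> = q\<^sup>2 - Re (l2_inner ?y (analysis e))"
      by (simp add: w_inner[OF e] l2_self q_def del: of_real_power)
    finally show ?thesis
      using y_inner[OF e] complex_Re_le_cmod[of "l2_inner ?y (analysis e)"] by (simp add: q_def)
  qed
  have "(\<lambda>t. u t - (h t + of_real a * w t)) = (\<lambda>t. e t - of_real a * w t)"
    by (simp add: e_def fun_eq_iff)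
  then have "(L2_norm (\<lambda>t. u t - (h t + of_real a * w t)))\<^sup>2
      = (L2_norm e)\<^sup>2 - 2 * (a * Re (L2_inner e w)) + a\<^sup>2 * (L2_norm w)\<^sup>2"
    using L2.nrm_sq_diff_scale[OF e w, of "of_real a"] a by simp
  also have "\<dots> \<le> (L2_norm e)\<^sup>2 - 2 * (a * (q\<^sup>2 - \<tau> * q)) + a\<^sup>2 * (B * (2 * q\<^sup>2 + 2 * \<tau>\<^sup>2))"
    using re w_sq a by (intro add_mono diff_mono mult_left_mono) simp_all
  also have "a\<^sup>2 * (B * (2 * q\<^sup>2 + 2 * \<tau>\<^sup>2)) = a * (q\<^sup>2 + \<tau>\<^sup>2)"
    using B_pos by (simp add: a_def power2_eq_square field_simps)
  also have "(L2_norm e)\<^sup>2 - 2 * (a * (q\<^sup>2 - \<tau> * q)) + a * (q\<^sup>2 + \<tau>\<^sup>2)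
      \<le> (L2_norm e)\<^sup>2 - a / 2 * q\<^sup>2 + 3 * a * \<tau>\<^sup>2"
  proof -
    \<comment> \<open>This square is exactly the difference of the two sides.\<close>
    have "0 \<le> a / 2 * (q - 2 * \<tau>)\<^sup>2" using a by simp
    then show ?thesis by (simp add: power2_diff algebra_simps power2_eq_square)
  qed
  \<comment> \<open>The lower frame bound turns q^2 into decay of the error itself: a A / 2 =
    A/(4B).\<close>
  also have "\<dots> \<le> (L2_norm e)\<^sup>2 - a / 2 * (A * (L2_norm e)\<^sup>2) + 3 * a * \<tau>\<^sup>2"
    using analysis_lower[OF e] a by (intro add_right_mono diff_left_mono mult_left_mono) (simp_all add: q_def)
  also have "\<dots> = (1 - A / (4 * B)) * (L2_norm e)\<^sup>2 + 3 / (2 * B) * \<tau>\<^sup>2"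
    by (simp add: a_def algebra_simps)
  finally show ?thesis unfolding a_def w_def x_def e_def .
qed

end

text \<open>These assumptions are the interface to the Gabor setting: beyond the frame bounds,
  time-frequency structure enters only through uniformly populated balls and uniformly small Gram
  tails.\<close>

locale localized_frame = L2_frame G A B for G :: "'i \<Rightarrow> real^'m \<Rightarrow> complex" and A B +
  fixes d :: "'i \<Rightarrow> 'i \<Rightarrow> real" and C :: real
  assumes d_self: "d i i = 0"
    and d_triangle: "d k i \<le> d k j + d j i"
    and G_bound: "L2_norm (G i) \<le> C"
    and ball_card: "\<exists>K::nat. \<forall>i. finite {j. d j i \<le> N} \<and> card {j. d j i \<le> N} \<le> K"
    and gram_tail: "0 < \<epsilon> \<Longrightarrow> \<exists>N. \<forall>i. (\<Sum>\<^sub>\<infinity>j\<in>{j. \<not> d j i \<le> N}. (norm (L2_inner (G i) (G j)))\<^sup>2) \<le> \<epsilon>"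
begin

lemma C_nonneg: "0 \<le> C"
  using G_bound[of undefined] L2.nrm_ge_0[OF G_L2[of undefined]] by linarith

lemma gram_bound: "norm (L2_inner (G i) (G j)) \<le> C * C"
  using L2.Cauchy_Schwarz[OF G_L2[of i] G_L2[of j]]
    mult_mono[OF G_bound[of i] G_bound[of j] C_nonneg L2.nrm_ge_0[OF G_L2]] by linarith

lemma analysis_synth: "analysis (synth F x) k = (\<Sum>j\<in>F. x j * L2_inner (G j) (G k))"
  unfolding analysis_def synth_def by (rule L2.ip_sum) (rule G_L2)+

text \<open>An index farther than \<open>R0 + N\<close> from \<open>i\<close> is farther than
  \<open>R0\<close> from every \<open>j\<close> in the ball of radius \<open>N\<close>.
  Cauchy-Schwarz over the at most \<open>K\<close> terms then reduces the claim to \<open>K\<close>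
  Gram tails. The radius depends neither on \<open>i\<close> nor on the coefficients.\<close>

lemma analysis_synth_tail:
  assumes "0 < \<epsilon>" "0 \<le> M"
  shows "\<exists>R. \<forall>x i. (\<forall>j. norm (x j) \<le> M) \<longrightarrow>
    (\<Sum>\<^sub>\<infinity>k\<in>{k. \<not> d k i \<le> R}. (norm (analysis (synth {j. d j i \<le> N} x) k))\<^sup>2) \<le> \<epsilon>"
proof -
  obtain K :: nat where K: "\<And>i. finite {j. d j i \<le> N}" "\<And>i. card {j. d j i \<le> N} \<le> K"
    using ball_card by metis
  \<comment> \<open>One factor \<open>K\<close> is the Cauchy-Schwarz loss, the other counts the
    Gram tails; the \<open>+ 1\<close> keeps the denominator positive when \<open>M\<close> or
    \<open>K\<close> is 0.\<close>
  define \<epsilon>' where "\<epsilon>' = \<epsilon> / (M\<^sup>2 * (real K)\<^sup>2 + 1)"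
  have pos: "0 < M\<^sup>2 * (real K)\<^sup>2 + 1" by (simp add: add_nonneg_pos)
  then have \<epsilon>': "0 < \<epsilon>'" using assms by (simp add: \<epsilon>'_def)
  from gram_tail[OF this] obtain R0
    where R0: "\<And>i. (\<Sum>\<^sub>\<infinity>j\<in>{j. \<not> d j i \<le> R0}. (norm (L2_inner (G i) (G j)))\<^sup>2) \<le> \<epsilon>'" by blast
  show ?thesis
  proof (intro exI allI impI)
    fix x :: "'i \<Rightarrow> complex" and i assume x: "\<forall>j. norm (x j) \<le> M"
    let ?F = "{j. d j i \<le> N}" and ?S = "{k. \<not> d k i \<le> R0 + N}"
    let ?f = "\<lambda>k. (norm (analysis (synth ?F x) k))\<^sup>2"
    have sm: "?f summable_on UNIV" using analysis_l2[OF synth_L2] by (simp add: l2_def)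
    show "infsum ?f ?S \<le> \<epsilon>"
    proof (rule infsum_le_finite_sums)
      show "?f summable_on ?S" by (rule summable_on_subset[OF sm]) simp
      fix Y assume Y: "finite Y" "Y \<subseteq> ?S"
      have "sum ?f Y \<le> (\<Sum>k\<in>Y. M\<^sup>2 * K * (\<Sum>j\<in>?F. (norm (L2_inner (G j) (G k)))\<^sup>2))"
      proof (rule sum_mono)
        fix k
        have "norm (analysis (synth ?F x) k) \<le> (\<Sum>j\<in>?F. norm (x j * L2_inner (G j) (G k)))"
          unfolding analysis_synth by (rule norm_sum)
        also have "\<dots> \<le> (\<Sum>j\<in>?F. M * norm (L2_inner (G j) (G k)))"
          using x by (intro sum_mono) (simp add: norm_mult mult_right_mono)
        also have "\<dots> = M * (\<Sum>j\<in>?F. norm (L2_inner (G j) (G k)))" by (simp add: sum_distrib_left)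
        finally have "?f k \<le> (M * (\<Sum>j\<in>?F. norm (L2_inner (G j) (G k))))\<^sup>2"
          by (intro power_mono) simp_all
        also have "\<dots> = M\<^sup>2 * (\<Sum>j\<in>?F. norm (L2_inner (G j) (G k)))\<^sup>2"
          by (simp add: power_mult_distrib)
        also have "\<dots> \<le> M\<^sup>2 * ((\<Sum>j\<in>?F. (norm (L2_inner (G j) (G k)))\<^sup>2) * card ?F)"
          by (intro mult_left_mono sum_squared_le_sum_of_squares) (simp_all add: K)
        also have "\<dots> \<le> M\<^sup>2 * ((\<Sum>j\<in>?F. (norm (L2_inner (G j) (G k)))\<^sup>2) * K)"
          using K(2)[of i] by (intro mult_left_mono) (simp_all add: sum_nonneg)
        finally show "?f k \<le> M\<^sup>2 * K * (\<Sum>j\<in>?F. (norm (L2_inner (G j) (G k)))\<^sup>2)"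
          by (simp add: mult_ac)
      qed
      also have "\<dots> = M\<^sup>2 * K * (\<Sum>j\<in>?F. \<Sum>k\<in>Y. (norm (L2_inner (G j) (G k)))\<^sup>2)"
        by (subst sum.swap) (simp add: sum_distrib_left)
      also have "\<dots> \<le> M\<^sup>2 * K * (\<Sum>j\<in>?F. \<epsilon>')"
      proof (intro mult_left_mono sum_mono)
        fix j assume j: "j \<in> ?F"
        have "(\<Sum>k\<in>Y. (norm (L2_inner (G j) (G k)))\<^sup>2)
            \<le> (\<Sum>\<^sub>\<infinity>k\<in>{k. \<not> d k j \<le> R0}. (norm (L2_inner (G j) (G k)))\<^sup>2)"
        proof (rule sum_le_infsum_subset[OF coeff_summable[OF G_L2] Y(1)])
          show "Y \<subseteq> {k. \<not> d k j \<le> R0}"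
          proof
            fix k assume "k \<in> Y"
            then have "R0 + N < d k i" using Y(2) by auto
            then show "k \<in> {k. \<not> d k j \<le> R0}" using d_triangle[of k i j] j by simp
          qed
        qed simp
        also have "\<dots> \<le> \<epsilon>'" by (rule R0)
        finally show "(\<Sum>k\<in>Y. (norm (L2_inner (G j) (G k)))\<^sup>2) \<le> \<epsilon>'" .
      qed simp
      also have "\<dots> \<le> M\<^sup>2 * K * (K * \<epsilon>')"
        using K(2)[of i] \<epsilon>' by (intro mult_left_mono) (simp_all add: mult_right_mono)
      also have "\<dots> \<le> (M\<^sup>2 * (real K)\<^sup>2 + 1) * \<epsilon>'"
        using \<epsilon>' by (simp add: power2_eq_square algebra_simps)
      also have "\<dots> = \<epsilon>" using pos by (simp add: \<epsilon>'_def)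
      finally show "sum ?f Y \<le> \<epsilon>" .
    qed
  qed
qed

text \<open>The point is the order of quantifiers: one radius \<open>N\<close> and one coefficient
  bound \<open>M\<close> serve all \<open>i\<close>. \<open>E\<close> bounds the squared
  error.\<close>

definition approximable :: "('i \<Rightarrow> real^'m \<Rightarrow> complex) \<Rightarrow> real \<Rightarrow> bool" where
  "approximable u E \<longleftrightarrow> (\<exists>N M x. 0 \<le> M \<and> (\<forall>i. (\<forall>j. norm (x i j) \<le> M) \<and>
     (L2_norm (\<lambda>t. u i t - synth {j. d j i \<le> N} (x i) t))\<^sup>2 \<le> E))"

text \<open>One truncated Richardson step for all \<open>i\<close> at once. The enlarged ball must
  contain the old one and leave only a small tail of the residual outside;
  \<open>analysis_synth_tail\<close> supplies a radius independent of \<open>i\<close>. The new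
  coefficients stay bounded because each analysis coefficient is a sum of at most \<open>K\<close>
  products of size at most \<open>M * (C * C)\<close>.\<close>

lemma approximable_step:
  assumes u: "\<And>i. u i \<in> L2"
    and orth: "\<And>i z. z \<in> L2 \<Longrightarrow> l2_inner (\<lambda>j. delta i j - analysis (u i) j) (analysis z) = 0"
    and approx: "approximable u E" and \<eta>: "0 < \<eta>"
  shows "approximable u ((1 - A / (4 * B)) * E + \<eta>)"
proof -
  from approx obtain N M x where M: "0 \<le> M" and x: "\<And>i j. norm (x i j) \<le> M"
    and E: "\<And>i. (L2_norm (\<lambda>t. u i t - synth {j. d j i \<le> N} (x i) t))\<^sup>2 \<le> E"
    unfolding approximable_def by blast
  \<comment> \<open>Chosen so that the error term 3/(2B) times \<epsilon> of
    \<open>richardson_step\<close> equals \<eta>.\<close>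
  define \<epsilon> where "\<epsilon> = \<eta> * (2 * B) / 3"
  have \<epsilon>: "0 < \<epsilon>" using \<eta> B_pos by (simp add: \<epsilon>_def)
  from analysis_synth_tail[OF \<epsilon> M, of N] obtain R
    where R: "\<And>x i. (\<forall>j. norm (x j) \<le> M) \<Longrightarrow>
      (\<Sum>\<^sub>\<infinity>k\<in>{k. \<not> d k i \<le> R}. (norm (analysis (synth {j. d j i \<le> N} x) k))\<^sup>2) \<le> \<epsilon>" by blast
  \<comment> \<open>The maximum with 0 puts \<open>i\<close> into its own ball, so
    \<open>delta i\<close> contributes nothing to the tail.\<close>
  define N' where "N' = max (max N R) 0"
  obtain K :: nat where K: "\<And>i. finite {j. d j i \<le> N}" "\<And>i. card {j. d j i \<le> N} \<le> K"
    using ball_card by metis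
  have fin: "finite {j. d j i \<le> N'}" for i using ball_card by metis
  define h where "h i = synth {j. d j i \<le> N} (x i)" for i
  define a where "a = 1 / (2 * B)"
  have a: "0 < a" using B_pos by (simp add: a_def)
  \<comment> \<open>The old coefficients must be cut off at radius \<open>N\<close>:
    \<open>x i j\<close> may be nonzero beyond it, where the old synthesis ignored it.\<close>
  define x' where "x' i j = (if d j i \<le> N then x i j else 0) + of_real a * (delta i j - analysis (h i) j)" for i j
  have h: "h i \<in> L2" for i unfolding h_def by (rule synth_L2)
  have analysis_h: "norm (analysis (h i) k) \<le> K * (M * (C * C))" for i k
  proof -
    have "norm (analysis (h i) k) \<le> (\<Sum>j\<in>{j. d j i \<le> N}. norm (x i j * L2_inner (G j) (G k)))"
      unfolding h_def analysis_synth by (rule norm_sum)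
    also have "\<dots> \<le> (\<Sum>j\<in>{j. d j i \<le> N}. M * (C * C))"
      unfolding norm_mult by (intro sum_mono mult_mono x gram_bound M) simp
    also have "\<dots> \<le> K * (M * (C * C))"
      using K(2)[of i] M C_nonneg by (simp add: mult_right_mono)
    finally show ?thesis .
  qed
  define M' where "M' = M + a * (1 + K * (M * (C * C)))"
  have x': "norm (x' i j) \<le> M'" for i j
  proof -
    have "norm (x' i j) \<le> norm (if d j i \<le> N then x i j else 0) + norm (of_real a * (delta i j - analysis (h i) j))"
      unfolding x'_def by (rule norm_triangle_ineq)
    also have "\<dots> \<le> M + a * norm (delta i j - analysis (h i) j)"
      using a M x by (simp add: norm_mult)
    also have "norm (delta i j - analysis (h i) j) \<le> norm (delta i j) + norm (analysis (h i) j)"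
      by (rule norm_triangle_ineq4)
    also have "\<dots> \<le> 1 + K * (M * (C * C))"
      using analysis_h[of i j] by (intro add_mono) (simp_all add: delta_def)
    finally show ?thesis using a by (simp add: M'_def)
  qed
  have synth_eq: "synth {j. d j i \<le> N'} (x' i)
      = (\<lambda>t. h i t + of_real a * synth {j. d j i \<le> N'} (\<lambda>j. delta i j - analysis (h i) j) t)" for i
  proof
    fix t
    have "(\<Sum>j\<in>{j. d j i \<le> N'}. (if d j i \<le> N then x i j else 0) * G j t) = (\<Sum>j\<in>{j. d j i \<le> N}. x i j * G j t)"
      using fin by (intro sum.mono_neutral_cong_right) (auto simp: N'_def)
    then show "synth {j. d j i \<le> N'} (x' i) t
        = h i t + of_real a * synth {j. d j i \<le> N'} (\<lambda>j. delta i j - analysis (h i) j) t"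
      by (simp add: synth_def x'_def h_def distrib_right sum.distrib sum_distrib_left mult.assoc)
  qed
  have res_l2: "(\<lambda>j. delta i j - analysis (h i) j) \<in> l2" for i
    by (rule l2.diff_mem[OF delta_mem_l2 analysis_l2[OF h]])
  have tail: "(\<Sum>\<^sub>\<infinity>j\<in>-{j. d j i \<le> N'}. (norm (delta i j - analysis (h i) j))\<^sup>2) \<le> (sqrt \<epsilon>)\<^sup>2" for i
  proof -
    have sm: "(\<lambda>j. (norm (analysis (h i) j))\<^sup>2) summable_on UNIV"
      using analysis_l2[OF h] by (simp add: l2_def)
    have "(\<Sum>\<^sub>\<infinity>j\<in>-{j. d j i \<le> N'}. (norm (delta i j - analysis (h i) j))\<^sup>2)
        = (\<Sum>\<^sub>\<infinity>j\<in>-{j. d j i \<le> N'}. (norm (analysis (h i) j))\<^sup>2)"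
    proof (rule infsum_cong)
      fix j assume "j \<in> -{j. d j i \<le> N'}"
      then have "j \<noteq> i" using d_self[of i] by (auto simp: N'_def)
      then show "(norm (delta i j - analysis (h i) j))\<^sup>2 = (norm (analysis (h i) j))\<^sup>2"
        by (simp add: delta_def)
    qed
    also have "\<dots> \<le> (\<Sum>\<^sub>\<infinity>j\<in>{j. \<not> d j i \<le> R}. (norm (analysis (h i) j))\<^sup>2)"
      by (intro infsum_mono2 summable_on_subset[OF sm]) (auto simp: N'_def)
    also have "\<dots> \<le> \<epsilon>" unfolding h_def by (rule R) (simp add: x)
    finally show ?thesis using \<epsilon> by simp
  qed
  have "(L2_norm (\<lambda>t. u i t - synth {j. d j i \<le> N'} (x' i) t))\<^sup>2 \<le> (1 - A / (4 * B)) * E + \<eta>" for i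
  proof -
    have "(L2_norm (\<lambda>t. u i t - synth {j. d j i \<le> N'} (x' i) t))\<^sup>2
        \<le> (1 - A / (4 * B)) * (L2_norm (\<lambda>t. u i t - h i t))\<^sup>2 + 3 / (2 * B) * (sqrt \<epsilon>)\<^sup>2"
      unfolding synth_eq a_def
      using \<epsilon> by (intro richardson_step delta_mem_l2 u h fin orth tail) simp_all
    also have "3 / (2 * B) * (sqrt \<epsilon>)\<^sup>2 = \<eta>" using \<epsilon> B_pos by (simp add: \<epsilon>_def)
    also have "(1 - A / (4 * B)) * (L2_norm (\<lambda>t. u i t - h i t))\<^sup>2 \<le> (1 - A / (4 * B)) * E"
    proof (rule mult_left_mono)
      show "(L2_norm (\<lambda>t. u i t - h i t))\<^sup>2 \<le> E" unfolding h_def by (rule E)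
      show "0 \<le> 1 - A / (4 * B)" using A_le_B B_pos by simp
    qed
    finally show ?thesis by simp
  qed
  moreover have "0 \<le> M'" using a M C_nonneg by (simp add: M'_def)
  ultimately show ?thesis
    unfolding approximable_def using x' by blast
qed

lemma approximable_mono: "approximable u E \<Longrightarrow> E \<le> E' \<Longrightarrow> approximable u E'"
  unfolding approximable_def by (meson order_trans)

text \<open>Start from zero and iterate \<open>approximable_step\<close>: the initial error is
  multiplied by \<rho> < 1 each time, and the additive errors add up to at most n \<eta>. First
  \<open>n\<close> is fixed to kill the initial error, then \<eta> is chosen depending on
  \<open>n\<close>.\<close>

lemma dual_approximable:
  assumes u: "\<And>i. u i \<in> L2"
    and orth: "\<And>i z. z \<in> L2 \<Longrightarrow> l2_inner (\<lambda>j. delta i j - analysis (u i) j) (analysis z) = 0"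
    and "0 < \<epsilon>"
  shows "approximable u \<epsilon>"
proof -
  define \<rho> where "\<rho> = 1 - A / (4 * B)"
  have \<rho>: "0 \<le> \<rho>" "\<rho> < 1" using A_le_B B_pos A_pos by (simp_all add: \<rho>_def)
  \<comment> \<open>\<open>analysis (u i)\<close> is the projection of a unit vector, so its norm is
    at most 1; the lower frame bound then controls \<open>u i\<close>.\<close>
  have u_bound: "(L2_norm (u i))\<^sup>2 \<le> 1 / A" for i
  proof -
    let ?y = "analysis (u i)"
    have y: "?y \<in> l2" by (rule analysis_l2[OF u])
    have "l2_inner (delta i) ?y - l2_inner ?y ?y = 0"
      using orth[OF u, of i i] l2.ip_diff[OF delta_mem_l2[of i] y y] by simp
    then have "(l2_norm ?y)\<^sup>2 = cmod (l2_inner (delta i) ?y)" by (simp add: l2_self del: of_real_power)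
    also have "\<dots> \<le> l2_norm (delta i) * l2_norm ?y" by (rule l2.Cauchy_Schwarz[OF delta_mem_l2 y])
    also have "l2_norm (delta i) = 1"
    proof -
      have "(l2_norm (delta i))\<^sup>2 = 1"
        using l2_self[of "delta i"] l2_inner_delta[of "delta i" i]
        by (metis delta_def of_real_eq_1_iff)
      then show ?thesis using l2.nrm_ge_0[OF delta_mem_l2[of i]] by (simp add: power2_eq_1_iff)
    qed
    finally have le: "(l2_norm ?y)\<^sup>2 \<le> l2_norm ?y" by simp
    have "(l2_norm ?y)\<^sup>2 \<le> 1"
      using le sum_squares_bound[of "l2_norm ?y" 1] by simp
    then have "A * (L2_norm (u i))\<^sup>2 \<le> 1" using analysis_lower[OF u, of i] by linarith
    then show ?thesis using A_pos by (simp add: field_simps)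
  qed
  have step: "approximable u (\<rho> ^ n * (1 / A) + n * \<eta>)" if "0 < \<eta>" for n and \<eta> :: real
  proof (induction n)
    case 0
    have "(L2_norm (\<lambda>t. u i t - synth {j. d j i \<le> 0} (\<lambda>_. 0) t))\<^sup>2 \<le> 1 / A" for i
      using u_bound[of i] by (simp add: synth_def)
    then show ?case
      unfolding approximable_def by (intro exI[of _ 0] exI[of _ "\<lambda>_ _. 0"]) simp
  next
    case (Suc n)
    from approximable_step[OF u orth this that]
    have "approximable u (\<rho> * (\<rho> ^ n * (1 / A) + n * \<eta>) + \<eta>)"
      by (simp add: \<rho>_def)
    moreover have "\<rho> * (n * \<eta>) \<le> 1 * (n * \<eta>)" using \<rho> that by (intro mult_right_mono) simp_all
    ultimately show ?case
      by (elim approximable_mono) (simp add: algebra_simps)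
  qed
  have "(\<lambda>n. \<rho> ^ n * (1 / A)) \<longlonglongrightarrow> 0"
    using \<rho> by (intro tendsto_mult_left_zero LIMSEQ_power_zero) simp
  then have "eventually (\<lambda>n. \<rho> ^ n * (1 / A) < \<epsilon> / 2) sequentially"
    by (rule order_tendstoD) (use \<open>0 < \<epsilon>\<close> in simp)
  then obtain n where n: "\<rho> ^ n * (1 / A) < \<epsilon> / 2" by (auto simp: eventually_sequentially)
  \<comment> \<open>The value of \<eta> for this \<open>n\<close>; the \<open>+ 1\<close> admits
    \<open>n = 0\<close>.\<close>
  have "n * (\<epsilon> / (2 * (real n + 1))) \<le> \<epsilon> / 2"
    using \<open>0 < \<epsilon>\<close> by (simp add: field_simps)
  then have "\<rho> ^ n * (1 / A) + n * (\<epsilon> / (2 * (real n + 1))) \<le> \<epsilon>"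
    using n by linarith
  moreover have "approximable u (\<rho> ^ n * (1 / A) + n * (\<epsilon> / (2 * (real n + 1))))"
    by (rule step) (use \<open>0 < \<epsilon>\<close> in simp)
  ultimately show ?thesis by (rule approximable_mono[rotated])
qed

theorem nonexpansive_gram_proj: "nonexpansive_op d (gram_proj G)"
proof -
  have "\<exists>u. \<forall>i. u i \<in> L2 \<and> (\<forall>z\<in>L2. l2_inner (\<lambda>j. delta i j - analysis (u i) j) (analysis z) = 0)"
    using exists_projection[OF delta_mem_l2] by (intro choice) blast
  then obtain u where u: "\<And>i. u i \<in> L2"
    and orth: "\<And>i z. z \<in> L2 \<Longrightarrow> l2_inner (\<lambda>j. delta i j - analysis (u i) j) (analysis z) = 0"
    by blast
  define y where "y i = analysis (u i)" for i
  have y: "y i \<in> l2" for i unfolding y_def by (rule analysis_l2[OF u])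
  have proj: "gram_proj G (delta i) = y i" for i
    unfolding y_def using gram_proj_eq[OF delta_mem_l2 u orth] by blast
  \<comment> \<open>Orthogonality turns \<open>l2_inner (delta i) (y j)\<close> into
    \<open>l2_inner (y i) (y j)\<close>, which is hermitian in \<open>i\<close> and
    \<open>j\<close>. So the rows of the adjoint have the same tails.\<close>
  have herm: "cnj (y j i) = y i j" for i j
  proof -
    have "l2_inner (delta i) (y j) = l2_inner (y i) (y j)" for i j
      using orth[OF u, of i j] l2.ip_diff[OF delta_mem_l2[of i] y[of i] y[of j]] by (simp add: y_def)
    moreover have "l2_inner (delta i) (y j) = cnj (y j i)" for i j
      using l2.ip_cnj[OF y[of j] delta_mem_l2[of i]] by (simp add: l2_inner_delta)
    ultimately show ?thesis
      using l2.ip_cnj[OF y[of i] y[of j]] by (metis complex_cnj_cnj)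
  qed
  have tail: "\<exists>N. \<forall>i. (\<Sum>\<^sub>\<infinity>j\<in>{j. \<not> d j i \<le> N}. (norm (y i j))\<^sup>2) < \<epsilon>" if \<epsilon>: "0 < \<epsilon>" for \<epsilon>
  proof -
    \<comment> \<open>The error part contributes 2 B \<epsilon>/(8B) and the synthesized part 2
      \<epsilon>/8, together \<epsilon>/2, which leaves room for the strict inequality.\<close>
    have "approximable u (\<epsilon> / (8 * B))"
      by (rule dual_approximable[OF u orth]) (use \<epsilon> B_pos in simp_all)
    then obtain N M x where M: "0 \<le> M" and x: "\<And>i j. norm (x i j) \<le> M"
      and E: "\<And>i. (L2_norm (\<lambda>t. u i t - synth {j. d j i \<le> N} (x i) t))\<^sup>2 \<le> \<epsilon> / (8 * B)"
      unfolding approximable_def by blast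
    have "0 < \<epsilon> / 8" using \<epsilon> by simp
    from analysis_synth_tail[OF this M, of N] obtain R
      where R: "\<And>x i. (\<forall>j. norm (x j) \<le> M) \<Longrightarrow>
        (\<Sum>\<^sub>\<infinity>k\<in>{k. \<not> d k i \<le> R}. (norm (analysis (synth {j. d j i \<le> N} x) k))\<^sup>2) \<le> \<epsilon> / 8" by blast
    have "(\<Sum>\<^sub>\<infinity>j\<in>{j. \<not> d j i \<le> R}. (norm (y i j))\<^sup>2) \<le> \<epsilon> / 2" for i
    proof -
      let ?S = "{j. \<not> d j i \<le> R}"
      let ?h = "synth {j. d j i \<le> N} (x i)"
      let ?e = "\<lambda>t. u i t - ?h t"
      have h: "?h \<in> L2" by (rule synth_L2)
      have e: "?e \<in> L2" by (rule L2.diff_mem[OF u h])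
      have sm: "(\<lambda>j. (norm (analysis f j))\<^sup>2) summable_on UNIV" if "f \<in> L2" for f
        using analysis_l2[OF that] by (simp add: l2_def)
      note smS = summable_on_subset[OF sm subset_UNIV]
      have "(\<Sum>\<^sub>\<infinity>j\<in>?S. (norm (y i j))\<^sup>2)
          \<le> (\<Sum>\<^sub>\<infinity>j\<in>?S. 2 * (norm (analysis ?e j))\<^sup>2 + 2 * (norm (analysis ?h j))\<^sup>2)"
      proof (rule infsum_mono)
        show "(\<lambda>j. (norm (y i j))\<^sup>2) summable_on ?S" unfolding y_def by (rule smS[OF u])
        show "(\<lambda>j. 2 * (norm (analysis ?e j))\<^sup>2 + 2 * (norm (analysis ?h j))\<^sup>2) summable_on ?S"
          by (intro summable_on_add summable_on_cmult_right smS e h)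
        fix j
        have "y i j = analysis ?e j + analysis ?h j"
          by (simp add: y_def analysis_diff u h)
        then show "(norm (y i j))\<^sup>2 \<le> 2 * (norm (analysis ?e j))\<^sup>2 + 2 * (norm (analysis ?h j))\<^sup>2"
          by (simp add: norm_add_sq_le)
      qed
      also have "\<dots> = 2 * (\<Sum>\<^sub>\<infinity>j\<in>?S. (norm (analysis ?e j))\<^sup>2) + 2 * (\<Sum>\<^sub>\<infinity>j\<in>?S. (norm (analysis ?h j))\<^sup>2)"
        by (subst infsum_add) (auto intro!: summable_on_cmult_right smS e h simp: infsum_cmult_right')
      also have "(\<Sum>\<^sub>\<infinity>j\<in>?S. (norm (analysis ?h j))\<^sup>2) \<le> \<epsilon> / 8"
        by (rule R) (simp add: x)
      also have "(\<Sum>\<^sub>\<infinity>j\<in>?S. (norm (analysis ?e j))\<^sup>2) \<le> (\<Sum>\<^sub>\<infinity>j. (norm (analysis ?e j))\<^sup>2)"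
        by (intro infsum_mono2 smS sm e) simp_all
      also have "\<dots> \<le> B * (L2_norm ?e)\<^sup>2"
        using analysis_upper[OF e] by (simp add: l2_norm_sq)
      also have "\<dots> \<le> B * (\<epsilon> / (8 * B))" using E B_pos by (intro mult_left_mono) simp_all
      also have "\<dots> = \<epsilon> / 8" using B_pos by simp
      finally show ?thesis by simp
    qed
    then show ?thesis using \<epsilon> by (intro exI[of _ R] allI) (smt (verit) field_sum_of_halves)
  qed
  have "row_nonexp d (gram_proj G)"
    unfolding row_nonexp_def proj l2_inner_delta using tail by blast
  moreover have "adj_row_nonexp d (gram_proj G)"
    unfolding adj_row_nonexp_def proj l2_inner_delta herm using tail by blast
  ultimately show ?thesis by (simp add: nonexpansive_op_def)
qed

end

subsection \<open>An \<open>L\<^sup>2\<close> bound for the Fourier transform\<close>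

lemma cis_measurable[measurable]: "cis \<in> borel_measurable borel"
  by (intro borel_measurable_continuous_onI continuous_intros)

text \<open>Lebesgue measure is the image of the finite product measure under \<open>?S\<close>, and
  there integrals of coordinate products factor.\<close>

lemma lborel_prod_integral:
  fixes f :: "'a::euclidean_space \<Rightarrow> real \<Rightarrow> complex"
  assumes int: "\<And>b. b \<in> Basis \<Longrightarrow> integrable lborel (f b)"
  shows "integrable lborel (\<lambda>x::'a. \<Prod>b\<in>Basis. f b (x \<bullet> b))"
    and "(LINT x|lborel. (\<Prod>b\<in>Basis. f b ((x::'a) \<bullet> b))) = (\<Prod>b\<in>Basis. (LINT t|lborel. f b t))"
proof -
  interpret product_sigma_finite "\<lambda>_::'a. lborel :: real measure" ..
  have meas[measurable]: "\<And>b. b \<in> Basis \<Longrightarrow> f b \<in> borel_measurable borel"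
    using int borel_measurable_integrable by fastforce
  let ?S = "\<lambda>g::'a \<Rightarrow> real. \<Sum>b\<in>Basis. g b *\<^sub>R b"
  have S: "?S \<in> measurable (\<Pi>\<^sub>M b\<in>Basis. lborel) borel" by measurable
  have P: "(\<lambda>x::'a. \<Prod>b\<in>Basis. f b (x \<bullet> b)) \<in> borel_measurable borel"
    by measurable
  have eq: "(\<Prod>b\<in>Basis. f b (?S g \<bullet> b)) = (\<Prod>b\<in>Basis. f b (g b))" for g
    by (intro prod.cong refl arg_cong2[where f=f]) simp
  show "integrable lborel (\<lambda>x::'a. \<Prod>b\<in>Basis. f b (x \<bullet> b))"
    unfolding lborel_eq[where 'a='a] integrable_distr_eq[OF S P] eq
    using int by (intro product_integrable_prod) auto
  show "(LINT x|lborel. (\<Prod>b\<in>Basis. f b ((x::'a) \<bullet> b))) = (\<Prod>b\<in>Basis. (LINT t|lborel. f b t))"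
    unfolding lborel_eq[where 'a='a] integral_distr[OF S P] eq
    using int by (intro product_integral_prod) auto
qed

text \<open>The characteristic function of the standard normal distribution at t/s, after
  substituting 2 pi s x. The width of the Gaussian is chosen so that its transform is a probability
  density of standard deviation \<open>s\<close>.\<close>

lemma gaussian_fourier_1d:
  fixes s t :: real
  assumes "s > 0"
  shows "integrable lborel (\<lambda>x. of_real (exp (- (2 * pi * s * x)\<^sup>2 / 2)) * cis (2 * pi * (x * t)))" (is "integrable _ ?f")
    and "(LINT x|lborel. of_real (exp (- (2 * pi * s * x)\<^sup>2 / 2)) * cis (2 * pi * (x * t)))
      = complex_of_real (normal_density 0 s t)"
proof -
  let ?g = "\<lambda>x. of_real (std_normal_density x) * cis ((t / s) * x)"
  have g_int: "integrable lborel ?g"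
    by (rule Bochner_Integration.integrable_bound[OF integrable_normal_density[of 1 0]])
       (measurable, auto simp: norm_mult normal_density_nonneg)
  have "(LINT x|lborel. ?g x) = char std_normal_distribution (t / s)"
    unfolding char_def
    by (subst integral_density) (auto simp: normal_density_nonneg cis_conv_exp scaleR_conv_of_real mult_ac)
  then have g_val: "(LINT x|lborel. ?g x) = complex_of_real (exp (- (t / s)\<^sup>2 / 2))"
    by (simp add: char_std_normal_distribution)
  have c: "2 * pi * s \<noteq> 0" using assms by simp
  have eq: "?g (0 + (2 * pi * s) * x) = of_real (1 / sqrt (2 * pi)) * ?f x" for x
    using assms by (simp add: std_normal_density_def mult_ac)
  have "integrable lborel (\<lambda>x. ?g (0 + (2 * pi * s) * x))"
    using lborel_integrable_real_affine[OF g_int c, of 0] .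
  then have "integrable lborel (\<lambda>x. of_real (1 / sqrt (2 * pi)) * ?f x)"
    unfolding eq .
  from integrable_mult_right[OF this, of "of_real (sqrt (2 * pi))"]
  show "integrable lborel ?f"
    by (rule Bochner_Integration.integrable_cong[THEN iffD1, rotated -1]) auto
  have "(LINT x|lborel. ?g x) = \<bar>2 * pi * s\<bar> *\<^sub>R (LINT x|lborel. ?g (0 + (2 * pi * s) * x))"
    by (rule lborel_integral_real_affine[OF c])
  also have "\<dots> = of_real (2 * pi * s / sqrt (2 * pi)) * (LINT x|lborel. ?f x)"
    unfolding eq using assms by (simp add: scaleR_conv_of_real)
  also have "2 * pi * s / sqrt (2 * pi) = sqrt (2 * pi) * s"
    using real_div_sqrt[of "2 * pi"] by (metis less_eq_real_def pi_gt_zero times_divide_eq_left zero_le_mult_iff zero_le_numeral)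
  finally have "complex_of_real (exp (- (t / s)\<^sup>2 / 2)) = of_real (sqrt (2 * pi) * s) * (LINT x|lborel. ?f x)"
    unfolding g_val .
  moreover have "of_real (sqrt (2 * pi) * s) * complex_of_real (normal_density 0 s t) = complex_of_real (exp (- (t / s)\<^sup>2 / 2))"
  proof -
    have "sqrt (2 * pi) * s * normal_density 0 s t = exp (- (t / s)\<^sup>2 / 2)"
      using assms by (simp add: normal_density_def real_sqrt_mult power_divide mult.commute)
    then show ?thesis by (metis of_real_mult)
  qed
  ultimately have "of_real (sqrt (2 * pi) * s) * (LINT x|lborel. ?f x)
      = of_real (sqrt (2 * pi) * s) * complex_of_real (normal_density 0 s t)"
    by (simp only:)
  moreover have "complex_of_real (sqrt (2 * pi) * s) \<noteq> 0"
    using assms by (simp del: of_real_mult)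
  ultimately show "(LINT x|lborel. ?f x) = complex_of_real (normal_density 0 s t)"
    by (rule mult_left_cancel[THEN iffD1, rotated])
qed

text \<open>This is exp(-2 pi^2 s^2 |w|^2), written coordinatewise to fit
  \<open>lborel_prod_integral\<close>. It tends to 1 as \<open>s\<close> tends to 0, while its
  Fourier transform \<open>gauss_kernel s\<close> keeps mass 1.\<close>

definition gauss_window :: "real \<Rightarrow> 'a::euclidean_space \<Rightarrow> real" where
  "gauss_window s w = (\<Prod>b\<in>Basis. exp (- (2 * pi * s * (w \<bullet> b))\<^sup>2 / 2))"

definition gauss_kernel :: "real \<Rightarrow> 'a::euclidean_space \<Rightarrow> real" where
  "gauss_kernel s z = (\<Prod>b\<in>Basis. normal_density 0 s (z \<bullet> b))"

lemma gauss_window_measurable[measurable]: "gauss_window s \<in> borel_measurable borel"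
  unfolding gauss_window_def[abs_def] by measurable

lemma gauss_kernel_measurable[measurable]: "gauss_kernel s \<in> borel_measurable borel"
  unfolding gauss_kernel_def[abs_def] by measurable

lemma gauss_window_nonneg: "0 \<le> gauss_window s w"
  by (simp add: gauss_window_def prod_nonneg)

lemma gauss_kernel_nonneg: "0 \<le> gauss_kernel s z"
  by (simp add: gauss_kernel_def prod_nonneg normal_density_nonneg)

lemma gaussian_fourier:
  fixes z :: "'a::euclidean_space"
  assumes "s > 0"
  shows "integrable lborel (\<lambda>w. of_real (gauss_window s w) * cis (2 * pi * (w \<bullet> z)))"
    and "(LINT w|lborel. of_real (gauss_window s w) * cis (2 * pi * (w \<bullet> z))) = complex_of_real (gauss_kernel s z)"
proof -
  let ?f = "\<lambda>b x. of_real (exp (- (2 * pi * s * x)\<^sup>2 / 2)) * cis (2 * pi * (x * (z \<bullet> b)))"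
  have cis_sum: "cis (sum h A) = (\<Prod>b\<in>A. cis (h b))" for h and A :: "'a set"
    by (induction A rule: infinite_finite_induct) (simp_all add: cis_mult[symmetric])
  have eq: "of_real (gauss_window s w) * cis (2 * pi * (w \<bullet> z)) = (\<Prod>b\<in>Basis. ?f b (w \<bullet> b))" for w
    unfolding gauss_window_def euclidean_inner[of w z] sum_distrib_left cis_sum of_real_prod prod.distrib ..
  show "integrable lborel (\<lambda>w. of_real (gauss_window s w) * cis (2 * pi * (w \<bullet> z)))"
    unfolding eq using assms by (intro lborel_prod_integral gaussian_fourier_1d)
  have "(LINT w|lborel. of_real (gauss_window s w) * cis (2 * pi * (w \<bullet> z)))
      = (\<Prod>b\<in>Basis. (LINT t|lborel. ?f b t))"
    unfolding eq using assms by (intro lborel_prod_integral gaussian_fourier_1d)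
  also have "\<dots> = complex_of_real (gauss_kernel s z)"
    unfolding gauss_kernel_def of_real_prod using assms
    by (intro prod.cong refl gaussian_fourier_1d)
  finally show "(LINT w|lborel. of_real (gauss_window s w) * cis (2 * pi * (w \<bullet> z))) = complex_of_real (gauss_kernel s z)" .
qed

lemma gauss_kernel_nn_integral:
  assumes "s > 0"
  shows "(\<integral>\<^sup>+z. ennreal (gauss_kernel s (z::'a::euclidean_space)) \<partial>lborel) = 1"
proof -
  have "(\<integral>\<^sup>+z. ennreal (gauss_kernel s (z::'a)) \<partial>lborel)
      = (\<integral>\<^sup>+z. (\<Prod>b\<in>Basis. ennreal (normal_density 0 s ((z::'a) \<bullet> b))) \<partial>lborel)"
    by (simp add: gauss_kernel_def prod_ennreal normal_density_nonneg)
  also have "\<dots> = (\<Prod>b\<in>(Basis :: 'a set). (\<integral>\<^sup>+t. ennreal (normal_density 0 s t) \<partial>lborel))"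
    by (rule nn_integral_lborel_prod) auto
  also have "(\<integral>\<^sup>+t. ennreal (normal_density 0 s t) \<partial>lborel) = 1"
    using assms by (subst nn_integral_eq_integral) (auto simp: normal_density_nonneg)
  finally show ?thesis by simp
qed

section \<open>Plancherel inequality by Gaussian regularization\<close>

definition fourier :: "('a::euclidean_space \<Rightarrow> complex) \<Rightarrow> 'a \<Rightarrow> complex" where
  "fourier F w = (LINT y|lborel. F y * cis (- (2 * pi * (w \<bullet> y))))"

lemma integrable_pair_product:
  fixes F :: "'a::euclidean_space \<Rightarrow> complex" and G :: "'b::euclidean_space \<Rightarrow> complex"
  assumes F: "integrable lborel F" and G: "integrable lborel G"
  shows "integrable (lborel \<Otimes>\<^sub>M lborel) (\<lambda>(x, y). F x * G y)"
proof -
  have F_meas[measurable]: "F \<in> borel_measurable borel" "G \<in> borel_measurable borel"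
    using F G borel_measurable_integrable by fastforce+
  show ?thesis
  proof (rule lborel_pair.Fubini_integrable)
    show "(\<lambda>(x, y). F x * G y) \<in> borel_measurable (lborel \<Otimes>\<^sub>M lborel)" by measurable
    show "integrable lborel (\<lambda>x. LINT y|lborel. norm (case (x, y) of (x, y) \<Rightarrow> F x * G y))"
      using F by (simp add: norm_mult)
    show "AE x in lborel. integrable lborel (\<lambda>y. case (x, y) of (x, y) \<Rightarrow> F x * G y)"
      using G by simp
  qed
qed

lemma nn_integral_lborel_translate:
  fixes f :: "'a::euclidean_space \<Rightarrow> ennreal"
  assumes [measurable]: "f \<in> borel_measurable borel"
  shows "(\<integral>\<^sup>+x. f (c + x) \<partial>lborel) = (\<integral>\<^sup>+x. f x \<partial>lborel)"
proof -
  have "(\<integral>\<^sup>+x. f x \<partial>distr lborel borel ((+) c)) = (\<integral>\<^sup>+x. f (c + x) \<partial>lborel)"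
    by (rule nn_integral_distr) measurable
  then show ?thesis by (simp add: lborel_distr_plus)
qed

text \<open>Write the squared modulus of the transform as a double integral over (y, y'). The window
  makes the triple integral absolutely convergent, so \<open>w\<close> can be integrated out first,
  which leaves the kernel at y' - y. As the kernel has mass 1 in either variable, bounding |F(y)
  F(y')| by half the sum of squares gives the claim, as in the Schur test.\<close>

lemma fourier_windowed_le:
  fixes F :: "'a::euclidean_space \<Rightarrow> complex"
  assumes F: "integrable lborel F" and s: "s > 0"
  shows "(\<integral>\<^sup>+w. ennreal (gauss_window s w * (norm (fourier F w))\<^sup>2) \<partial>lborel)
    \<le> (\<integral>\<^sup>+y. ennreal ((norm (F y))\<^sup>2) \<partial>lborel)"
proof -
  have F_meas[measurable]: "F \<in> borel_measurable borel"
    using F borel_measurable_integrable by fastforce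
  have fourier_meas[measurable]: "fourier F \<in> borel_measurable lborel"
    unfolding fourier_def[abs_def]
    by (rule lborel.borel_measurable_lebesgue_integral) measurable
  define P where "P = (\<lambda>q::'a \<times> 'a. F (fst q) * cnj (F (snd q)))"
  have P_int: "integrable lborel P"
    using integrable_pair_product[OF F, of "\<lambda>y. cnj (F y)"] F
    by (simp add: P_def lborel_prod case_prod_beta')
  have P_meas[measurable]: "P \<in> borel_measurable borel"
    using P_int borel_measurable_integrable by fastforce
  define E where "E = (\<lambda>(w::'a) (q::'a \<times> 'a). cis (2 * pi * (w \<bullet> (snd q - fst q))))"
  define H where "H = (\<lambda>w q. of_real (gauss_window s w) * P q * E w q)"
  have kernel_meas: "(\<lambda>q::'a \<times> 'a. gauss_kernel s (snd q - fst q)) \<in> borel_measurable borel"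
    by (rule measurable_compose[OF _ gauss_kernel_measurable])
      (intro borel_measurable_continuous_onI continuous_intros)
  have norm_F_meas: "(\<lambda>x. norm (F x)) \<in> borel_measurable borel" by measurable
  have fst_meas: "(\<lambda>q::'a \<times> 'a. norm (F (fst q))) \<in> borel_measurable borel"
    by (rule measurable_compose[OF _ norm_F_meas]) (intro borel_measurable_continuous_onI continuous_intros)
  have snd_meas: "(\<lambda>q::'a \<times> 'a. norm (F (snd q))) \<in> borel_measurable borel"
    by (rule measurable_compose[OF _ norm_F_meas]) (intro borel_measurable_continuous_onI continuous_intros)
  have fst_weight: "(\<lambda>q. ennreal ((norm (F (fst q)))\<^sup>2 / 2 * gauss_kernel s (snd q - fst q))) \<in> borel_measurable lborel"
    and snd_weight: "(\<lambda>q. ennreal ((norm (F (snd q)))\<^sup>2 / 2 * gauss_kernel s (snd q - fst q))) \<in> borel_measurable lborel"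
    unfolding measurable_lborel1 measurable_lborel2
    by (intro measurable_compose[OF _ measurable_ennreal] borel_measurable_times borel_measurable_divide
      borel_measurable_power borel_measurable_const fst_meas snd_meas kernel_meas)+
  have W_int: "integrable lborel (\<lambda>w::'a. complex_of_real (gauss_window s w))"
    using gaussian_fourier(1)[OF s, of "0::'a"] by simp
  have H_int: "integrable (lborel \<Otimes>\<^sub>M lborel) (\<lambda>(w, q). H w q)"
  proof (rule Bochner_Integration.integrable_bound[OF integrable_pair_product[OF W_int P_int]])
    show "(\<lambda>(w, q). H w q) \<in> borel_measurable (lborel \<Otimes>\<^sub>M lborel)"
    proof -
      have "(\<lambda>x::'a \<times> 'a \<times> 'a. gauss_window s (fst x)) \<in> borel_measurable borel"
        by (rule measurable_compose[OF _ gauss_window_measurable])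
          (intro borel_measurable_continuous_onI continuous_intros)
      moreover have "(\<lambda>x::'a \<times> 'a \<times> 'a. P (snd x)) \<in> borel_measurable borel"
        by (rule measurable_compose[OF _ P_meas])
          (intro borel_measurable_continuous_onI continuous_intros)
      moreover have "(\<lambda>x::'a \<times> 'a \<times> 'a. E (fst x) (snd x)) \<in> borel_measurable borel"
        unfolding E_def by (intro borel_measurable_continuous_onI continuous_intros)
      ultimately show ?thesis
        unfolding lborel_prod H_def case_prod_beta'
        by (intro borel_measurable_times borel_measurable_of_real) simp_all
    qed
  qed (auto simp: H_def E_def norm_mult)
  have inner: "(LINT q|lborel. P q * E w q) = of_real ((norm (fourier F w))\<^sup>2)" for w
  proof -
    let ?e = "\<lambda>y. F y * cis (- (2 * pi * (w \<bullet> y)))"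
    have e_int: "integrable lborel ?e"
      by (rule Bochner_Integration.integrable_bound[OF F]) (measurable, auto simp: norm_mult)
    then have ce_int: "integrable lborel (\<lambda>y. cnj (?e y))"
      by (simp only: integrable_cnj)
    have "(LINT q|lborel. P q * E w q) = (LINT q|(lborel \<Otimes>\<^sub>M lborel). (\<lambda>(y, y'). ?e y * cnj (?e y')) q)"
      unfolding lborel_prod
    proof (rule Bochner_Integration.integral_cong[OF refl])
      fix q :: "'a \<times> 'a"
      have "E w q = cis (- (2 * pi * (w \<bullet> fst q))) * cis (2 * pi * (w \<bullet> snd q))"
        unfolding E_def cis_mult by (simp add: inner_diff_right right_diff_distrib)
      then show "P q * E w q = (\<lambda>(y, y'). ?e y * cnj (?e y')) q"
        by (simp add: P_def case_prod_beta' cis_cnj)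
    qed
    also have "\<dots> = (LINT y|lborel. LINT y'|lborel. ?e y * cnj (?e y'))"
      using integrable_pair_product[OF e_int ce_int]
      by (subst lborel_pair.integral_fst'[symmetric]) simp_all
    also have "\<dots> = fourier F w * cnj (fourier F w)"
      by (simp add: fourier_def del: complex_cnj_mult)
    finally show ?thesis by (simp only: complex_norm_square)
  qed
  have left: "(LINT q|lborel. H w q) = of_real (gauss_window s w * (norm (fourier F w))\<^sup>2)" for w
    unfolding H_def by (simp add: mult.assoc inner del: of_real_power)
  have right: "(LINT w|lborel. H w q) = P q * of_real (gauss_kernel s (snd q - fst q))" for q
  proof -
    have "(LINT w|lborel. H w q) = P q * (LINT w|lborel. of_real (gauss_window s w) * E w q)"
      by (simp add: H_def mult.left_commute mult.assoc flip: integral_mult_right_zero)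
    then show ?thesis using gaussian_fourier(2)[OF s, of "snd q - fst q"] by (simp add: E_def)
  qed
  have int_left: "integrable lborel (\<lambda>w. gauss_window s w * (norm (fourier F w))\<^sup>2)"
  proof -
    have "integrable lborel (\<lambda>w. LINT q|lborel. H w q)"
      using lborel_pair.integrable_fst'[OF H_int] by simp
    then show ?thesis unfolding left by (simp only: complex_of_real_integrable_eq)
  qed
  have "complex_of_real (LINT w|lborel. gauss_window s w * (norm (fourier F w))\<^sup>2)
      = (LINT w|lborel. LINT q|lborel. H w q)"
    unfolding left by (rule integral_complex_of_real[symmetric])
  also have "\<dots> = (LINT q|lborel. LINT w|lborel. H w q)"
    using lborel_pair.Fubini_integral[OF H_int] by simp
  also have "\<dots> = (LINT q|lborel. P q * of_real (gauss_kernel s (snd q - fst q)))"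
    unfolding right ..
  finally have eq: "complex_of_real (LINT w|lborel. gauss_window s w * (norm (fourier F w))\<^sup>2) = \<dots>" .
  have "(\<integral>\<^sup>+w. ennreal (gauss_window s w * (norm (fourier F w))\<^sup>2) \<partial>lborel)
      = ennreal (LINT w|lborel. gauss_window s w * (norm (fourier F w))\<^sup>2)"
    by (rule nn_integral_eq_integral[OF int_left]) (simp add: gauss_window_nonneg)
  also have "\<dots> \<le> ennreal (norm (complex_of_real (LINT w|lborel. gauss_window s w * (norm (fourier F w))\<^sup>2)))"
    by (simp add: ennreal_leI del: norm_of_real) (simp add: abs_le_iff)
  also have "\<dots> \<le> (\<integral>\<^sup>+q. ennreal (norm (P q * of_real (gauss_kernel s (snd q - fst q)))) \<partial>lborel)"
  proof -
    have "integrable lborel (\<lambda>q. LINT w|lborel. H w q)"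
      by (rule lborel_pair.integrable_snd[OF H_int])
    then show ?thesis unfolding eq right by (rule integral_norm_bound_ennreal)
  qed
  also have "\<dots> \<le> (\<integral>\<^sup>+q. ennreal ((norm (F (fst q)))\<^sup>2 / 2 * gauss_kernel s (snd q - fst q))
      + ennreal ((norm (F (snd q)))\<^sup>2 / 2 * gauss_kernel s (snd q - fst q)) \<partial>lborel)"
  proof (rule nn_integral_mono)
    fix q :: "'a \<times> 'a"
    have "norm (P q * of_real (gauss_kernel s (snd q - fst q)))
        = norm (F (fst q)) * norm (F (snd q)) * gauss_kernel s (snd q - fst q)"
      by (simp add: P_def norm_mult gauss_kernel_nonneg)
    also have "\<dots> \<le> ((norm (F (fst q)))\<^sup>2 / 2 + (norm (F (snd q)))\<^sup>2 / 2) * gauss_kernel s (snd q - fst q)"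
      using sum_squares_bound[of "norm (F (fst q))" "norm (F (snd q))"]
      by (intro mult_right_mono) (simp_all add: gauss_kernel_nonneg)
    finally show "ennreal (norm (P q * of_real (gauss_kernel s (snd q - fst q))))
        \<le> ennreal ((norm (F (fst q)))\<^sup>2 / 2 * gauss_kernel s (snd q - fst q))
          + ennreal ((norm (F (snd q)))\<^sup>2 / 2 * gauss_kernel s (snd q - fst q))"
      by (simp add: distrib_right gauss_kernel_nonneg ennreal_leI flip: ennreal_plus)
  qed
  also have "\<dots> = (\<integral>\<^sup>+q. ennreal ((norm (F (fst q)))\<^sup>2 / 2 * gauss_kernel s (snd q - fst q)) \<partial>lborel)
      + (\<integral>\<^sup>+q. ennreal ((norm (F (snd q)))\<^sup>2 / 2 * gauss_kernel s (snd q - fst q)) \<partial>lborel)"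
    by (rule nn_integral_add[OF fst_weight snd_weight])
  also have "(\<integral>\<^sup>+q. ennreal ((norm (F (fst q)))\<^sup>2 / 2 * gauss_kernel s (snd q - fst q)) \<partial>lborel)
      = (\<integral>\<^sup>+y. ennreal ((norm (F y))\<^sup>2 / 2) \<partial>lborel)"
  proof -
    have "(\<integral>\<^sup>+q. ennreal ((norm (F (fst q)))\<^sup>2 / 2 * gauss_kernel s (snd q - fst q)) \<partial>(lborel \<Otimes>\<^sub>M lborel))
        = (\<integral>\<^sup>+y. \<integral>\<^sup>+y'. ennreal ((norm (F y))\<^sup>2 / 2 * gauss_kernel s (y' - y)) \<partial>lborel \<partial>lborel)"
      using fst_weight by (subst lborel.nn_integral_fst[symmetric]) (simp_all add: lborel_prod)
    also have "\<dots> = (\<integral>\<^sup>+y. ennreal ((norm (F y))\<^sup>2 / 2) \<partial>lborel)"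
    proof (rule nn_integral_cong)
      fix y :: 'a
      have "(\<integral>\<^sup>+y'. ennreal (gauss_kernel s (y' - y)) \<partial>lborel) = 1"
        using nn_integral_lborel_translate[of "\<lambda>z. ennreal (gauss_kernel s z)" "- y"]
          gauss_kernel_nn_integral[OF s, where 'a='a] by simp
      then show "(\<integral>\<^sup>+y'. ennreal ((norm (F y))\<^sup>2 / 2 * gauss_kernel s (y' - y)) \<partial>lborel) = ennreal ((norm (F y))\<^sup>2 / 2)"
        by (subst ennreal_mult''[OF gauss_kernel_nonneg], subst nn_integral_cmult) simp_all
    qed
    finally show ?thesis unfolding lborel_prod .
  qed
  also have "(\<integral>\<^sup>+q. ennreal ((norm (F (snd q)))\<^sup>2 / 2 * gauss_kernel s (snd q - fst q)) \<partial>lborel)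
      = (\<integral>\<^sup>+y. ennreal ((norm (F y))\<^sup>2 / 2) \<partial>lborel)"
  proof -
    \<comment> \<open>Here the inner integration runs over the subtracted variable; evenness turns
      the integrand into a translate of the kernel.\<close>
    have even: "gauss_kernel s (- z) = gauss_kernel s z" for z :: 'a
      by (simp add: gauss_kernel_def normal_density_def)
    have "(\<integral>\<^sup>+q. ennreal ((norm (F (snd q)))\<^sup>2 / 2 * gauss_kernel s (snd q - fst q)) \<partial>(lborel \<Otimes>\<^sub>M lborel))
        = (\<integral>\<^sup>+y'. \<integral>\<^sup>+y. ennreal ((norm (F y'))\<^sup>2 / 2 * gauss_kernel s (y' - y)) \<partial>lborel \<partial>lborel)"
      using snd_weight by (subst lborel_pair.nn_integral_snd[symmetric]) (simp_all add: lborel_prod)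
    also have "\<dots> = (\<integral>\<^sup>+y'. ennreal ((norm (F y'))\<^sup>2 / 2) \<partial>lborel)"
    proof (rule nn_integral_cong)
      fix y' :: 'a
      have "(\<integral>\<^sup>+y. ennreal (gauss_kernel s (y' - y)) \<partial>lborel) = (\<integral>\<^sup>+y. ennreal (gauss_kernel s (- y' + y)) \<partial>lborel)"
        by (intro nn_integral_cong arg_cong[where f=ennreal]) (metis even minus_diff_eq uminus_add_conv_diff)
      also have "\<dots> = 1"
        using nn_integral_lborel_translate[of "\<lambda>z. ennreal (gauss_kernel s z)" "- y'"]
          gauss_kernel_nn_integral[OF s, where 'a='a] by simp
      finally show "(\<integral>\<^sup>+y. ennreal ((norm (F y'))\<^sup>2 / 2 * gauss_kernel s (y' - y)) \<partial>lborel) = ennreal ((norm (F y'))\<^sup>2 / 2)"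
        by (subst ennreal_mult''[OF gauss_kernel_nonneg], subst nn_integral_cmult) simp_all
    qed
    finally show ?thesis unfolding lborel_prod .
  qed
  also have "(\<integral>\<^sup>+y. ennreal ((norm (F y))\<^sup>2 / 2) \<partial>lborel) + (\<integral>\<^sup>+y. ennreal ((norm (F y))\<^sup>2 / 2) \<partial>lborel)
      = (\<integral>\<^sup>+y. ennreal ((norm (F y))\<^sup>2) \<partial>lborel)"
    by (subst nn_integral_add[symmetric]) (simp_all flip: ennreal_plus)
  finally show ?thesis .
qed

text \<open>Apply the windowed bound with \<open>s = 1 / (n + 1)\<close>; the windows tend to 1
  pointwise, and Fatou preserves the bound.\<close>

lemma fourier_L2_le:
  fixes F :: "'a::euclidean_space \<Rightarrow> complex"
  assumes F: "integrable lborel F"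
  shows "(\<integral>\<^sup>+w. ennreal ((norm (fourier F w))\<^sup>2) \<partial>lborel) \<le> (\<integral>\<^sup>+y. ennreal ((norm (F y))\<^sup>2) \<partial>lborel)"
proof -
  have F_meas[measurable]: "F \<in> borel_measurable borel"
    using F borel_measurable_integrable by fastforce
  have fourier_meas[measurable]: "fourier F \<in> borel_measurable lborel"
    unfolding fourier_def[abs_def]
    by (rule lborel.borel_measurable_lebesgue_integral) measurable
  let ?g = "\<lambda>n w. ennreal (gauss_window (1 / real (Suc n)) w * (norm (fourier F w))\<^sup>2)"
  have lim: "(\<lambda>n. ?g n w) \<longlonglongrightarrow> ennreal ((norm (fourier F w))\<^sup>2)" for w
  proof -
    have "(\<lambda>n. gauss_window (1 / real (Suc n)) w) \<longlonglongrightarrow> (\<Prod>b\<in>(Basis::'a set). exp (- (2 * pi * 0 * (w \<bullet> b))\<^sup>2 / 2))"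
      unfolding gauss_window_def
      by (intro tendsto_prod tendsto_exp tendsto_divide tendsto_minus tendsto_power tendsto_mult tendsto_const
        LIMSEQ_Suc[OF lim_1_over_n]) simp
    then have "(\<lambda>n. gauss_window (1 / real (Suc n)) w * (norm (fourier F w))\<^sup>2) \<longlonglongrightarrow> 1 * (norm (fourier F w))\<^sup>2"
      by (intro tendsto_mult) simp_all
    then show ?thesis by (intro tendsto_ennrealI) simp
  qed
  have "(\<integral>\<^sup>+w. ennreal ((norm (fourier F w))\<^sup>2) \<partial>lborel) = (\<integral>\<^sup>+w. liminf (\<lambda>n. ?g n w) \<partial>lborel)"
    using lim_imp_Liminf[OF sequentially_bot lim] by (intro nn_integral_cong) metis
  also have "\<dots> \<le> liminf (\<lambda>n. \<integral>\<^sup>+w. ?g n w \<partial>lborel)"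
    by (rule nn_integral_liminf) measurable
  also have "\<dots> \<le> (\<integral>\<^sup>+y. ennreal ((norm (F y))\<^sup>2) \<partial>lborel)"
    by (rule Liminf_le) (auto intro!: always_eventually fourier_windowed_le[OF F])
  finally show ?thesis .
qed

subsection \<open>Continuity of translations\<close>

lemma integral_lborel_translate:
  fixes f :: "'a::euclidean_space \<Rightarrow> 'b::{banach, second_countable_topology}"
  assumes [measurable]: "f \<in> borel_measurable borel"
  shows "(LINT x|lborel. f (c + x)) = (LINT x|lborel. f x)"
proof -
  have "(LINT x|distr lborel borel ((+) c). f x) = (LINT x|lborel. f (c + x))"
    by (rule integral_distr) measurable
  then show ?thesis by (simp add: lborel_distr_plus)
qed

lemma integrable_lborel_translate:
  fixes f :: "'a::euclidean_space \<Rightarrow> 'b::{banach, second_countable_topology}"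
  assumes f: "integrable lborel f"
  shows "integrable lborel (\<lambda>x. f (c + x))"
proof -
  have m: "f \<in> borel_measurable borel"
    using borel_measurable_integrable[OF f] by simp
  have "integrable (distr lborel borel ((+) c)) f"
    using f by (simp add: lborel_distr_plus)
  then show ?thesis
    by (subst (asm) integrable_distr_eq) (auto simp: m)
qed

text \<open>Continuity at 0 of translation in the L1 distance, phrased with sequences so that
  dominated convergence applies directly.\<close>

definition translation_continuous :: "('a::euclidean_space \<Rightarrow> 'b::{banach, second_countable_topology}) \<Rightarrow> bool" where
  "translation_continuous f \<longleftrightarrow>
    (\<forall>X. X \<longlonglongrightarrow> 0 \<longrightarrow> (\<lambda>n. LINT x|lborel. norm (f (X n + x) - f x)) \<longlonglongrightarrow> 0)"

text \<open>An e/3 argument: by translation invariance the shifted \<open>h\<close> approximates the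
  shifted \<open>f\<close> exactly as well as \<open>h\<close> approximates \<open>f\<close>,
  whatever the shift.\<close>

lemma translation_continuous_approx:
  fixes f :: "'a::euclidean_space \<Rightarrow> 'b::{banach, second_countable_topology}"
  assumes f: "integrable lborel f"
    and approx: "\<And>e. e > 0 \<Longrightarrow> \<exists>h. integrable lborel h \<and> translation_continuous h \<and> (LINT x|lborel. norm (f x - h x)) < e"
  shows "translation_continuous f"
  unfolding translation_continuous_def
proof (intro allI impI)
  fix X :: "nat \<Rightarrow> 'a" assume X: "X \<longlonglongrightarrow> 0"
  show "(\<lambda>n. LINT x|lborel. norm (f (X n + x) - f x)) \<longlonglongrightarrow> 0"
  proof (rule LIMSEQ_I)
    fix e :: real assume "e > 0"
    then obtain h where h: "integrable lborel h" "translation_continuous h" "(LINT x|lborel. norm (f x - h x)) < e / 3"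
      using approx[of "e / 3"] by auto
    have "(\<lambda>n. LINT x|lborel. norm (h (X n + x) - h x)) \<longlonglongrightarrow> 0"
      using h(2) X by (simp add: translation_continuous_def)
    from LIMSEQ_D[OF this, of "e / 3"] \<open>e > 0\<close>
    obtain N where N: "\<And>n. n \<ge> N \<Longrightarrow> norm (LINT x|lborel. norm (h (X n + x) - h x)) < e / 3"
      by auto
    have "norm (LINT x|lborel. norm (f (X n + x) - f x)) < e" if "n \<ge> N" for n
    proof -
      let ?d = "\<lambda>x. norm (f x - h x)"
      have d: "integrable lborel ?d" using f h by simp
      have [measurable]: "?d \<in> borel_measurable borel"
        using borel_measurable_integrable[OF d] by simp
      have dX: "integrable lborel (\<lambda>x. ?d (X n + x))" by (rule integrable_lborel_translate[OF d])
      have hX: "integrable lborel (\<lambda>x. norm (h (X n + x) - h x))"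
        using h integrable_lborel_translate[OF h(1)] by simp
      have "(LINT x|lborel. norm (f (X n + x) - f x)) \<le> (LINT x|lborel. ?d (X n + x) + norm (h (X n + x) - h x) + ?d x)"
      proof (rule integral_mono)
        show "integrable lborel (\<lambda>x. norm (f (X n + x) - f x))"
          using f integrable_lborel_translate[OF f] by simp
        show "integrable lborel (\<lambda>x. ?d (X n + x) + norm (h (X n + x) - h x) + ?d x)"
          using d dX hX by simp
        fix x
        let ?a = "f (X n + x) - h (X n + x)" and ?b = "h (X n + x) - h x" and ?c = "f x - h x"
        have "f (X n + x) - f x = ?a + ?b - ?c" by simp
        moreover have "norm (?a + ?b - ?c) \<le> norm ?a + norm ?b + norm ?c"
          using norm_triangle_ineq4[of "?a + ?b" ?c] norm_triangle_ineq[of ?a ?b] by linarith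
        ultimately show "norm (f (X n + x) - f x) \<le> ?d (X n + x) + norm (h (X n + x) - h x) + ?d x"
          by simp
      qed
      also have "\<dots> = (LINT x|lborel. ?d (X n + x)) + (LINT x|lborel. norm (h (X n + x) - h x)) + (LINT x|lborel. ?d x)"
        using d dX hX by simp
      also have "(LINT x|lborel. ?d (X n + x)) = (LINT x|lborel. ?d x)"
        by (rule integral_lborel_translate) measurable
      also have "\<dots> + (LINT x|lborel. norm (h (X n + x) - h x)) + \<dots> < e"
        using h(3) N[OF that] by simp
      finally show ?thesis by simp
    qed
    then show "\<exists>N. \<forall>n\<ge>N. norm ((LINT x|lborel. norm (f (X n + x) - f x)) - 0) < e"
      by auto
  qed
qed

text \<open>A point of an open set stays inside under small shifts, so dominated convergence handles
  the part of \<open>U\<close> that a shift loses. The part gained has the same measure, because a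
  translate of \<open>U\<close> has the measure of \<open>U\<close>.\<close>

lemma translation_continuous_indicator_open:
  fixes U :: "'a::euclidean_space set"
  assumes U: "open U" and fin: "emeasure lborel U < \<infinity>"
  shows "translation_continuous (indicator U :: 'a \<Rightarrow> real)"
  unfolding translation_continuous_def
proof (intro allI impI)
  fix X :: "nat \<Rightarrow> 'a" assume X: "X \<longlonglongrightarrow> 0"
  have [measurable]: "U \<in> sets borel" using U by simp
  let ?i = "indicator U :: 'a \<Rightarrow> real"
  have int: "integrable lborel ?i" using fin by simp
  have intX: "integrable lborel (\<lambda>x. ?i (X n + x))" for n
    by (rule integrable_lborel_translate[OF int])
  have lim: "(\<lambda>n. LINT x|lborel. ?i x * (1 - ?i (X n + x))) \<longlonglongrightarrow> (LINT x|(lborel :: 'a measure). 0)"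
  proof (rule integral_dominated_convergence)
    show "integrable lborel ?i" by (rule int)
    show "AE x in lborel. (\<lambda>n. ?i x * (1 - ?i (X n + x))) \<longlonglongrightarrow> 0"
    proof (rule AE_I2)
      fix x
      show "(\<lambda>n. ?i x * (1 - ?i (X n + x))) \<longlonglongrightarrow> 0"
      proof (cases "x \<in> U")
        case True
        have "(\<lambda>n. X n + x) \<longlonglongrightarrow> 0 + x" by (intro tendsto_add X tendsto_const)
        then have "eventually (\<lambda>n. X n + x \<in> U) sequentially"
          using U True by (intro topological_tendstoD) auto
        then have "eventually (\<lambda>n. ?i x * (1 - ?i (X n + x)) = 0) sequentially"
          by eventually_elim simp
        then show ?thesis by (rule tendsto_eventually)
      qed simp
    qed
    show "AE x in lborel. norm (?i x * (1 - ?i (X n + x))) \<le> ?i x" for n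
      by (auto split: split_indicator)
  qed measurable
  have eq: "(LINT x|lborel. norm (?i (X n + x) - ?i x)) = 2 * (LINT x|lborel. ?i x * (1 - ?i (X n + x)))" for n
  proof -
    have "norm (?i (X n + x) - ?i x) = 2 * (?i x * (1 - ?i (X n + x))) + (?i (X n + x) - ?i x)" for x
      by (auto split: split_indicator)
    moreover have "integrable lborel (\<lambda>x. ?i x * (1 - ?i (X n + x)))"
      by (rule Bochner_Integration.integrable_bound[OF int]) (measurable, auto split: split_indicator)
    moreover have "(LINT x|lborel. ?i (X n + x)) = (LINT x|lborel. ?i x)"
      by (rule integral_lborel_translate) measurable
    ultimately show ?thesis using int intX[of n] by simp
  qed
  show "(\<lambda>n. LINT x|lborel. norm (?i (X n + x) - ?i x)) \<longlonglongrightarrow> 0"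
    unfolding eq using tendsto_mult_right_zero[of "\<lambda>n. LINT x|lborel. ?i x * (1 - ?i (X n + x))"] lim by simp
qed

text \<open>Induction over integrable functions: outer regularity passes from open sets to
  measurable sets of finite measure, and dominated approximation passes to the limit.\<close>

lemma translation_continuous_integrable:
  fixes f :: "'a::euclidean_space \<Rightarrow> 'b::{banach, second_countable_topology}"
  assumes "integrable lborel f"
  shows "translation_continuous f"
  using assms
proof (induction f rule: integrable_induct)
  case (base A c)
  let ?i = "\<lambda>A::'a set. indicator A :: 'a \<Rightarrow> real"
  have A[measurable]: "A \<in> sets borel" using base by simp
  have iA: "integrable lborel (?i A)" using base by simp
  have "translation_continuous (?i A)"
  proof (rule translation_continuous_approx[OF iA])
    fix e :: real assume e: "e > 0"
    obtain U where U: "open U" "A \<subseteq> U" "emeasure lborel (U - A) < e"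
      using outer_regular_lborel[OF A e] by auto
    have [measurable]: "U \<in> sets borel" using U by simp
    have "emeasure lborel U \<le> emeasure lborel (U - A) + emeasure lborel A"
      using U(2) emeasure_subadditive[of "U - A" lborel A] by (simp add: Un_absorb2)
    also have "\<dots> < \<infinity>" using U(3) base
      by (metis ennreal_add_less_top ennreal_less_top infinity_ennreal_def order_less_trans)
    finally have fin: "emeasure lborel U < \<infinity>" .
    have finD: "emeasure lborel (U - A) < \<infinity>"
      using U(3) by (metis ennreal_less_top infinity_ennreal_def order_less_trans)
    have "(LINT x|lborel. norm (?i A x - ?i U x)) = (LINT x|lborel. ?i (U - A) x)"
      using U(2) by (intro Bochner_Integration.integral_cong) (auto split: split_indicator)
    also have "\<dots> = measure lborel (U - A)" by simp
    also have "\<dots> < e"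
    proof -
      have "ennreal (measure lborel (U - A)) < ennreal e"
        using U(3) finD by (simp add: emeasure_eq_ennreal_measure[symmetric] less_top)
      then show ?thesis by (simp add: ennreal_less_iff)
    qed
    finally show "\<exists>h. integrable lborel h \<and> translation_continuous h \<and> (LINT x|lborel. norm (?i A x - h x)) < e"
      using translation_continuous_indicator_open[OF U(1) fin] fin by (intro exI[of _ "?i U"]) simp
  qed
  then show ?case
    unfolding translation_continuous_def
  proof (intro allI impI)
    fix X :: "nat \<Rightarrow> 'a"
    assume *: "\<forall>X. X \<longlonglongrightarrow> 0 \<longrightarrow> (\<lambda>n. LINT x|lborel. norm (?i A (X n + x) - ?i A x)) \<longlonglongrightarrow> 0" and X: "X \<longlonglongrightarrow> 0"
    have "(\<lambda>n. norm c * (LINT x|lborel. norm (?i A (X n + x) - ?i A x))) \<longlonglongrightarrow> norm c * 0"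
      using * X by (intro tendsto_mult tendsto_const) blast
    moreover have "norm (?i A (X n + x) *\<^sub>R c - ?i A x *\<^sub>R c) = norm c * norm (?i A (X n + x) - ?i A x)" for n x
      by (simp flip: scaleR_diff_left)
    ultimately show "(\<lambda>n. LINT x|lborel. norm (?i A (X n + x) *\<^sub>R c - ?i A x *\<^sub>R c)) \<longlonglongrightarrow> 0"
      by simp
  qed
next
  case (add f g)
  show ?case
    unfolding translation_continuous_def
  proof (intro allI impI)
    fix X :: "nat \<Rightarrow> 'a" assume X: "X \<longlonglongrightarrow> 0"
    let ?I = "\<lambda>h n. LINT x|lborel. norm (h (X n + x) - h x)"
    have int: "integrable lborel (\<lambda>x. norm (h (X n + x) - h x))" if "integrable lborel h" for h :: "'a \<Rightarrow> 'b" and n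
      using that integrable_lborel_translate[OF that] by simp
    show "(\<lambda>n. LINT x|lborel. norm (f (X n + x) + g (X n + x) - (f x + g x))) \<longlonglongrightarrow> 0"
    proof (rule Lim_null_comparison)
      show "(\<lambda>n. ?I f n + ?I g n) \<longlonglongrightarrow> 0"
        using tendsto_add[of "?I f" 0 sequentially "?I g" 0] add(3,4) X by (simp add: translation_continuous_def)
      show "eventually (\<lambda>n. norm (LINT x|lborel. norm (f (X n + x) + g (X n + x) - (f x + g x))) \<le> ?I f n + ?I g n) sequentially"
      proof (rule always_eventually, rule allI)
        fix n
        have "(LINT x|lborel. norm (f (X n + x) + g (X n + x) - (f x + g x)))
            \<le> (LINT x|lborel. norm (f (X n + x) - f x) + norm (g (X n + x) - g x))"
        proof (rule integral_mono)
          show "integrable lborel (\<lambda>x. norm (f (X n + x) + g (X n + x) - (f x + g x)))"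
            using add(1,2) integrable_lborel_translate[OF add(1)] integrable_lborel_translate[OF add(2)] by simp
          show "integrable lborel (\<lambda>x. norm (f (X n + x) - f x) + norm (g (X n + x) - g x))"
            using int[OF add(1)] int[OF add(2)] by simp
          show "norm (f (X n + x) + g (X n + x) - (f x + g x)) \<le> norm (f (X n + x) - f x) + norm (g (X n + x) - g x)" for x
            by (rule norm_diff_triangle_ineq)
        qed
        also have "\<dots> = ?I f n + ?I g n" using int[OF add(1)] int[OF add(2)] by simp
        finally show "norm (LINT x|lborel. norm (f (X n + x) + g (X n + x) - (f x + g x))) \<le> ?I f n + ?I g n"
          by simp
      qed
    qed
  qed
next
  case (lim f s)
  show ?case
  proof (rule translation_continuous_approx[OF lim(4)])
    fix e :: real assume "e > 0"
    have "(\<lambda>i. LINT x|lborel. norm (f x - s i x)) \<longlonglongrightarrow> (LINT x|(lborel :: 'a measure). 0)"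
    proof (rule integral_dominated_convergence)
      \<comment> \<open>The induction rule supplies approximants bounded by
        \<open>2 * norm (f x)\<close>.\<close>
      show "integrable lborel (\<lambda>x. 3 * norm (f x))" using lim(4) by simp
      show "AE x in lborel. (\<lambda>i. norm (f x - s i x)) \<longlonglongrightarrow> 0"
      proof (rule AE_I2)
        fix x :: 'a
        have "(\<lambda>i. f x - s i x) \<longlonglongrightarrow> f x - f x"
          using lim(2)[of x] by (intro tendsto_diff tendsto_const) simp
        then show "(\<lambda>i. norm (f x - s i x)) \<longlonglongrightarrow> 0" by (simp add: tendsto_norm_zero)
      qed
      show "AE x in lborel. norm (norm (f x - s i x)) \<le> 3 * norm (f x)" for i
      proof (rule AE_I2)
        fix x :: 'a
        have "norm (f x - s i x) \<le> norm (f x) + norm (s i x)" by (rule norm_triangle_ineq4)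
        also have "\<dots> \<le> 3 * norm (f x)" using lim(3)[of x i] by simp
        finally show "norm (norm (f x - s i x)) \<le> 3 * norm (f x)" by simp
      qed
      show "(\<lambda>x. norm (f x - s i x)) \<in> borel_measurable lborel" for i
        using lim(1)[of i] lim(4)
        by (intro borel_measurable_integrable integrable_norm Bochner_Integration.integrable_diff)
    qed simp
    then have "(\<lambda>i. LINT x|lborel. norm (f x - s i x)) \<longlonglongrightarrow> 0" by simp
    from order_tendstoD(2)[OF this \<open>e > 0\<close>]
    obtain i where "(LINT x|lborel. norm (f x - s i x)) < e"
      by (auto simp: eventually_sequentially)
    then show "\<exists>h. integrable lborel h \<and> translation_continuous h \<and> (LINT x|lborel. norm (f x - h x)) < e"
      using lim by (intro exI[of _ "s i"]) simp
  qed
qed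

subsection \<open>Time-frequency shifts and the spectrogram\<close>

lemma gabor_atom_measurable:
  assumes "g \<in> L2" shows "gabor_atom g ph t \<omega> \<in> borel_measurable borel"
proof -
  have [measurable]: "g \<in> borel_measurable borel" using L2_measurable[OF assms] by simp
  show ?thesis unfolding gabor_atom_def by measurable
qed

lemma norm_gabor_atom: "norm (gabor_atom g ph t \<omega> x) = norm (g (- t + x))"
  by (simp add: gabor_atom_def norm_mult)

lemma gabor_atom_L2: "g \<in> L2 \<Longrightarrow> gabor_atom g ph t \<omega> \<in> L2"
  using gabor_atom_measurable[of g ph t \<omega>] integrable_lborel_translate[OF L2_integrable_sq[of g], of "- t"]
  by (simp add: L2_def norm_gabor_atom)

lemma L2_norm_gabor_atom:
  assumes "g \<in> L2" shows "L2_norm (gabor_atom g ph t \<omega>) = L2_norm g"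
proof -
  have [measurable]: "g \<in> borel_measurable borel" using L2_measurable[OF assms] by simp
  have "(LINT x|lborel. (norm (g (- t + x)))\<^sup>2) = (LINT x|lborel. (norm (g x))\<^sup>2)"
    by (rule integral_lborel_translate) measurable
  then show ?thesis by (simp add: L2_norm_def norm_gabor_atom)
qed

text \<open>Covariance: translating the variable by \<open>t\<close> leaves a unimodular constant
  and the difference of the parameters. The left window is kept general because the Gram tail
  estimate replaces it by perturbations of \<open>g\<close>.\<close>

lemma norm_inner_gabor_atom:
  assumes f: "f \<in> L2" and g: "g \<in> L2"
  shows "norm (L2_inner (gabor_atom f ph t \<omega>) (gabor_atom g ph' t' \<omega>'))
    = norm (L2_inner f (gabor_atom g 0 (t' - t) (\<omega>' - \<omega>)))"
proof -
  let ?k = "\<lambda>x. gabor_atom f ph t \<omega> x * cnj (gabor_atom g ph' t' \<omega>' x)"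
  let ?\<theta> = "ph - ph' + 2 * pi * ((\<omega> - \<omega>') \<bullet> t)"
  have [measurable]: "gabor_atom f ph t \<omega> \<in> borel_measurable borel" "gabor_atom g ph' t' \<omega>' \<in> borel_measurable borel"
    by (intro gabor_atom_measurable f g)+
  have "?k (t + x) = cis ?\<theta> * (f x * cnj (gabor_atom g 0 (t' - t) (\<omega>' - \<omega>) x))" for x
  proof -
    have arg: "t + x - t' = x - (t' - t)" by simp
    have "?k (t + x) = cis ph * cis (2 * pi * (\<omega> \<bullet> (t + x))) * (cis (- ph') * cis (- (2 * pi * (\<omega>' \<bullet> (t + x)))))
        * (f x * cnj (g (x - (t' - t))))"
      by (simp add: gabor_atom_def cis_cnj arg mult_ac del: diff_diff_eq2)
    also have "cis ph * cis (2 * pi * (\<omega> \<bullet> (t + x))) * (cis (- ph') * cis (- (2 * pi * (\<omega>' \<bullet> (t + x)))))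
        = cis ?\<theta> * cis (- (2 * pi * ((\<omega>' - \<omega>) \<bullet> x)))"
      unfolding cis_mult by (rule arg_cong[where f=cis]) (simp add: algebra_simps)
    also have "cis ?\<theta> * cis (- (2 * pi * ((\<omega>' - \<omega>) \<bullet> x))) * (f x * cnj (g (x - (t' - t))))
        = cis ?\<theta> * (f x * cnj (gabor_atom g 0 (t' - t) (\<omega>' - \<omega>) x))"
      by (simp only: gabor_atom_def complex_cnj_mult cis_cnj minus_zero cis_zero mult_1_left mult.assoc)
        (simp only: mult.left_commute)
    finally show ?thesis .
  qed
  then have "(LINT x|lborel. ?k (t + x)) = cis ?\<theta> * L2_inner f (gabor_atom g 0 (t' - t) (\<omega>' - \<omega>))"
    by (simp add: L2_inner_def)
  moreover have "(LINT x|lborel. ?k (t + x)) = (LINT x|lborel. ?k x)"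
    by (rule integral_lborel_translate) measurable
  ultimately have "L2_inner (gabor_atom f ph t \<omega>) (gabor_atom g ph' t' \<omega>')
      = cis ?\<theta> * L2_inner f (gabor_atom g 0 (t' - t) (\<omega>' - \<omega>))"
    by (simp add: L2_inner_def)
  then show ?thesis by (simp add: norm_mult)
qed

definition spectrogram :: "(real^'m \<Rightarrow> complex) \<Rightarrow> (real^'m) \<times> (real^'m) \<Rightarrow> real" where
  "spectrogram g w = (norm (L2_inner g (gabor_atom g 0 (fst w) (snd w))))\<^sup>2"

lemma spectrogram_nonneg: "0 \<le> spectrogram g w"
  by (simp add: spectrogram_def)

lemma spectrogram_measurable:
  fixes g :: "real^'m \<Rightarrow> complex"
  assumes "g \<in> L2" shows "spectrogram g \<in> borel_measurable borel"
proof -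
  have g_meas: "g \<in> borel_measurable borel" using L2_measurable[OF assms] by simp
  let ?f = "\<lambda>q::((real^'m) \<times> (real^'m)) \<times> (real^'m). g (snd q) * cnj (gabor_atom g 0 (fst (fst q)) (snd (fst q)) (snd q))"
  have "(\<lambda>q::((real^'m) \<times> (real^'m)) \<times> (real^'m). g (snd q)) \<in> borel_measurable borel"
    by (rule measurable_compose[OF _ g_meas]) (intro borel_measurable_continuous_onI continuous_intros)
  moreover have "(\<lambda>q::((real^'m) \<times> (real^'m)) \<times> (real^'m). g (snd q - fst (fst q))) \<in> borel_measurable borel"
    by (rule measurable_compose[OF _ g_meas]) (intro borel_measurable_continuous_onI continuous_intros)
  moreover have "(\<lambda>q::((real^'m) \<times> (real^'m)) \<times> (real^'m). cis (2 * pi * (snd (fst q) \<bullet> snd q))) \<in> borel_measurable borel"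
    by (intro borel_measurable_continuous_onI continuous_intros)
  ultimately have "?f \<in> borel_measurable borel"
    unfolding gabor_atom_def
    by (intro borel_measurable_times measurable_compose[OF _ cnj_measurable] borel_measurable_const)
  then have "case_prod (\<lambda>w x. g x * cnj (gabor_atom g 0 (fst w) (snd w) x)) \<in> borel_measurable (lborel \<Otimes>\<^sub>M lborel)"
    by (simp add: lborel_prod case_prod_beta')
  then have "(\<lambda>w. L2_inner g (gabor_atom g 0 (fst w) (snd w))) \<in> borel_measurable lborel"
    unfolding L2_inner_def by (rule lborel.borel_measurable_lebesgue_integral)
  then show ?thesis
    unfolding spectrogram_def[abs_def] by simp
qed

text \<open>At a fixed time shift \<open>x\<close> the frequency slice is the squared Fourier
  transform of the integrable function g(y) cnj(g(y - x)). \<open>fourier_L2_le\<close> bounds its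
  integral, and Tonelli over \<open>x\<close> yields the fourth power of the norm of
  \<open>g\<close>.\<close>

lemma spectrogram_integrable:
  fixes g :: "real^'m \<Rightarrow> complex"
  assumes g: "g \<in> L2" shows "integrable lborel (spectrogram g)"
proof (rule integrableI_bounded)
  have g_meas[measurable]: "g \<in> borel_measurable borel" using L2_measurable[OF g] by simp
  note S = spectrogram_measurable[OF g]
  show "spectrogram g \<in> borel_measurable lborel" using S by simp
  let ?n = "\<lambda>y. ennreal ((norm (g y))\<^sup>2)"
  have fin: "(\<integral>\<^sup>+y. ?n y \<partial>lborel) < \<infinity>"
    using nn_integral_eq_integral[OF L2_integrable_sq[OF g]] by simp
  have slice: "(\<integral>\<^sup>+\<omega>. ennreal (spectrogram g (x, \<omega>)) \<partial>lborel) \<le> (\<integral>\<^sup>+y. ?n (x + y) * ?n y \<partial>lborel)" for x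
  proof -
    let ?F = "\<lambda>y. g y * cnj (g (y - x))"
    have T: "gabor_atom g 0 x 0 \<in> L2" by (rule gabor_atom_L2[OF g])
    have "integrable lborel (\<lambda>y. g y * cnj (gabor_atom g 0 x 0 y))"
      by (rule L2_mult_integrable[OF g T])
    then have F: "integrable lborel ?F" by (simp add: gabor_atom_def)
    have "spectrogram g (x, \<omega>) = (norm (fourier ?F \<omega>))\<^sup>2" for \<omega>
      by (simp add: spectrogram_def fourier_def L2_inner_def gabor_atom_def cis_cnj mult_ac)
    then have "(\<integral>\<^sup>+\<omega>. ennreal (spectrogram g (x, \<omega>)) \<partial>lborel) = (\<integral>\<^sup>+\<omega>. ennreal ((norm (fourier ?F \<omega>))\<^sup>2) \<partial>lborel)"
      by simp
    also have "\<dots> \<le> (\<integral>\<^sup>+y. ennreal ((norm (?F y))\<^sup>2) \<partial>lborel)" by (rule fourier_L2_le[OF F])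
    also have "\<dots> = (\<integral>\<^sup>+y. ennreal ((norm (?F (x + y)))\<^sup>2) \<partial>lborel)"
      by (rule nn_integral_lborel_translate[symmetric]) measurable
    also have "\<dots> = (\<integral>\<^sup>+y. ?n (x + y) * ?n y \<partial>lborel)"
      by (simp add: norm_mult power_mult_distrib ennreal_mult)
    finally show ?thesis .
  qed
  have pair_meas: "(\<lambda>(x, y). ?n (x + y) * ?n y) \<in> borel_measurable (lborel \<Otimes>\<^sub>M lborel)"
    by measurable
  have "(\<integral>\<^sup>+w. ennreal (norm (spectrogram g w)) \<partial>lborel)
      = (\<integral>\<^sup>+w. ennreal (spectrogram g w) \<partial>(lborel \<Otimes>\<^sub>M lborel))"
    by (simp add: lborel_prod spectrogram_nonneg)
  also have "\<dots> = (\<integral>\<^sup>+x. \<integral>\<^sup>+\<omega>. ennreal (spectrogram g (x, \<omega>)) \<partial>lborel \<partial>lborel)"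
    by (rule lborel.nn_integral_fst[symmetric])
      (simp add: lborel_prod, rule measurable_compose[OF S measurable_ennreal])
  also have "\<dots> \<le> (\<integral>\<^sup>+x. \<integral>\<^sup>+y. ?n (x + y) * ?n y \<partial>lborel \<partial>lborel)"
    by (intro nn_integral_mono slice)
  also have "\<dots> = (\<integral>\<^sup>+y. \<integral>\<^sup>+x. ?n (x + y) * ?n y \<partial>lborel \<partial>lborel)"
    by (rule lborel_pair.Fubini'[OF pair_meas, symmetric])
  also have "\<dots> = (\<integral>\<^sup>+y. (\<integral>\<^sup>+x. ?n x \<partial>lborel) * ?n y \<partial>lborel)"
  proof (rule nn_integral_cong)
    fix y
    have "(\<integral>\<^sup>+x. ?n (x + y) * ?n y \<partial>lborel) = (\<integral>\<^sup>+x. ?n (y + x) \<partial>lborel) * ?n y"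
      by (subst nn_integral_multc) (simp_all add: add.commute)
    also have "(\<integral>\<^sup>+x. ?n (y + x) \<partial>lborel) = (\<integral>\<^sup>+x. ?n x \<partial>lborel)"
      by (rule nn_integral_lborel_translate) measurable
    finally show "(\<integral>\<^sup>+x. ?n (x + y) * ?n y \<partial>lborel) = (\<integral>\<^sup>+x. ?n x \<partial>lborel) * ?n y" .
  qed
  also have "\<dots> = (\<integral>\<^sup>+x. ?n x \<partial>lborel) * (\<integral>\<^sup>+y. ?n y \<partial>lborel)"
    by (rule nn_integral_cmult) measurable
  also have "\<dots> < \<infinity>" using fin by (simp add: ennreal_mult_less_top)
  finally show "(\<integral>\<^sup>+w. ennreal (norm (spectrogram g w)) \<partial>lborel) < \<infinity>" .
qed

text \<open>Reduces continuity of translations in \<open>L\<^sup>2\<close> to continuity of translations of \<open>\<bar>g\<bar> g\<close> in \<open>L\<^sup>1\<close>.\<close>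

lemma norm_diff_sq_le:
  fixes a b :: complex
  shows "(norm (a - b))\<^sup>2 \<le> 2 * norm (norm a * a - norm b * b)"
proof (cases "a = b")
  case False
  \<comment> \<open>Pair \<open>D\<close> with a - b: the real part equals (|a| + |b|) (|a - b|^2 +
    (|a| - |b|)^2) / 2, where |a| + |b| is at least |a - b|. Then cancel one factor |a - b|.\<close>
  define D where "D = of_real (norm a) * a - of_real (norm b) * b"
  define r where "r = Re (a * cnj b)"
  have sq: "(norm (a - b))\<^sup>2 = (norm a)\<^sup>2 + (norm b)\<^sup>2 - 2 * r"
    unfolding r_def cmod_power2 by (simp add: power2_eq_square algebra_simps)
  have "Re (D * cnj (a - b)) = norm a * (norm a)\<^sup>2 + norm b * (norm b)\<^sup>2 - (norm a + norm b) * r"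
    unfolding D_def r_def cmod_power2 by (simp add: power2_eq_square algebra_simps)
  also have "\<dots> = (norm a + norm b) * (((norm (a - b))\<^sup>2 + (norm a - norm b)\<^sup>2) / 2)"
    unfolding sq by (simp add: power2_eq_square algebra_simps)
  finally have eq: "Re (D * cnj (a - b)) = (norm a + norm b) * (((norm (a - b))\<^sup>2 + (norm a - norm b)\<^sup>2) / 2)" .
  have "norm (a - b) * ((norm (a - b))\<^sup>2 / 2) \<le> (norm a + norm b) * (((norm (a - b))\<^sup>2 + (norm a - norm b)\<^sup>2) / 2)"
    by (intro mult_mono norm_triangle_ineq4) simp_all
  also have "\<dots> \<le> norm D * norm (a - b)"
    unfolding eq[symmetric] using complex_Re_le_cmod[of "D * cnj (a - b)"] by (simp add: norm_mult del: complex_cnj_diff)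
  finally have "norm (a - b) * ((norm (a - b))\<^sup>2 / 2) \<le> norm (a - b) * norm D" by (simp add: mult.commute)
  moreover have "0 < norm (a - b)" using False by simp
  ultimately have "(norm (a - b))\<^sup>2 / 2 \<le> norm D" by (simp only: mult_le_cancel_left_pos)
  then show ?thesis by (simp add: D_def)
qed simp

text \<open>The modulation error (1 - c) g vanishes by dominated convergence, the translation error
  by L1 continuity for \<open>q\<close>, which is integrable since |q| = |g|^2.\<close>

lemma gabor_atom_tendsto:
  fixes g :: "real^'m \<Rightarrow> complex" and z :: "nat \<Rightarrow> (real^'m) \<times> (real^'m)"
  assumes g: "g \<in> L2" and z: "z \<longlonglongrightarrow> 0"
  shows "(\<lambda>n. (L2_norm (\<lambda>x. g x - gabor_atom g 0 (fst (z n)) (snd (z n)) x))\<^sup>2) \<longlonglongrightarrow> 0"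
proof -
  have [measurable]: "g \<in> borel_measurable borel" using L2_measurable[OF g] by simp
  define t where "t n = fst (z n)" for n
  define \<omega> where "\<omega> n = snd (z n)" for n
  have t: "t \<longlonglongrightarrow> 0" and \<omega>: "\<omega> \<longlonglongrightarrow> 0"
    using tendsto_fst[OF z] tendsto_snd[OF z] by (simp_all add: t_def[abs_def] \<omega>_def[abs_def])
  define q where "q x = of_real (norm (g x)) * g x" for x
  have q: "integrable lborel q"
  proof (rule Bochner_Integration.integrable_bound[OF L2_integrable_sq[OF g]])
    show "q \<in> borel_measurable lborel" unfolding q_def by measurable
  qed (simp add: q_def norm_mult power2_eq_square)
  let ?c = "\<lambda>n x. cis (2 * pi * (\<omega> n \<bullet> x))"
  let ?m = "\<lambda>n x. (norm (g x))\<^sup>2 * (norm (1 - ?c n x))\<^sup>2"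
  have m_le: "norm (?m n x) \<le> 4 * (norm (g x))\<^sup>2" for n x
  proof -
    have "norm (1 - ?c n x) \<le> norm (1::complex) + norm (?c n x)" by (rule norm_triangle_ineq4)
    then have "(norm (1 - ?c n x))\<^sup>2 \<le> 2\<^sup>2" by (intro power_mono) simp_all
    from mult_left_mono[OF this, of "(norm (g x))\<^sup>2"] show ?thesis by simp
  qed
  have "(\<lambda>n. LINT x|lborel. ?m n x) \<longlonglongrightarrow> (LINT x|(lborel :: (real^'m) measure). 0)"
  proof (rule integral_dominated_convergence)
    show "integrable lborel (\<lambda>x. 4 * (norm (g x))\<^sup>2)" using L2_integrable_sq[OF g] by simp
    show "AE x in lborel. (\<lambda>n. ?m n x) \<longlonglongrightarrow> 0"
    proof (rule AE_I2)
      fix x :: "real^'m"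
      have "(\<lambda>n. ?m n x) \<longlonglongrightarrow> (norm (g x))\<^sup>2 * (norm (1 - cis (2 * pi * (0 \<bullet> x))))\<^sup>2"
        by (intro tendsto_intros \<omega>)
      then show "(\<lambda>n. ?m n x) \<longlonglongrightarrow> 0" by simp
    qed
    show "AE x in lborel. norm (?m n x) \<le> 4 * (norm (g x))\<^sup>2" for n
      by (rule AE_I2) (rule m_le)
  qed measurable
  then have lim1: "(\<lambda>n. LINT x|lborel. ?m n x) \<longlonglongrightarrow> 0" by simp
  have m_int: "integrable lborel (?m n)" for n
    by (rule Bochner_Integration.integrable_bound[of _ "\<lambda>x. 4 * (norm (g x))\<^sup>2"])
      (use L2_integrable_sq[OF g] m_le in \<open>simp_all add: order_trans[OF m_le]\<close>)
  have "(\<lambda>n. - t n) \<longlonglongrightarrow> 0" using tendsto_minus[OF t] by simp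
  then have lim2: "(\<lambda>n. LINT x|lborel. norm (q (- t n + x) - q x)) \<longlonglongrightarrow> 0"
    using translation_continuous_integrable[OF q] unfolding translation_continuous_def by blast
  have q_int: "integrable lborel (\<lambda>x. norm (q (- t n + x) - q x))" for n
    by (intro integrable_norm Bochner_Integration.integrable_diff integrable_lborel_translate q)
  have le: "(L2_norm (\<lambda>x. g x - gabor_atom g 0 (t n) (\<omega> n) x))\<^sup>2
      \<le> 2 * (LINT x|lborel. ?m n x) + 4 * (LINT x|lborel. norm (q (- t n + x) - q x))" for n
  proof -
    have d: "(\<lambda>x. g x - gabor_atom g 0 (t n) (\<omega> n) x) \<in> L2"
      by (intro L2.diff_mem g gabor_atom_L2)
    have "(L2_norm (\<lambda>x. g x - gabor_atom g 0 (t n) (\<omega> n) x))\<^sup>2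
        = (LINT x|lborel. (norm (g x - gabor_atom g 0 (t n) (\<omega> n) x))\<^sup>2)"
      by (simp add: L2_norm_def)
    also have "\<dots> \<le> (LINT x|lborel. 2 * ?m n x + 4 * norm (q (- t n + x) - q x))"
    proof (rule integral_mono[OF L2_integrable_sq[OF d]])
      show "integrable lborel (\<lambda>x. 2 * ?m n x + 4 * norm (q (- t n + x) - q x))"
        by (intro Bochner_Integration.integrable_add integrable_mult_right m_int q_int)
      fix x
      let ?b = "g (- t n + x)"
      have "g x - gabor_atom g 0 (t n) (\<omega> n) x = (1 - ?c n x) * g x + ?c n x * (g x - ?b)"
        by (simp add: gabor_atom_def algebra_simps)
      then have "(norm (g x - gabor_atom g 0 (t n) (\<omega> n) x))\<^sup>2
          \<le> 2 * (norm ((1 - ?c n x) * g x))\<^sup>2 + 2 * (norm (?c n x * (g x - ?b)))\<^sup>2"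
        by (simp only: norm_add_sq_le)
      also have "\<dots> = 2 * ?m n x + 2 * (norm (?b - g x))\<^sup>2"
        by (simp add: norm_mult power_mult_distrib norm_minus_commute)
      also have "\<dots> \<le> 2 * ?m n x + 4 * norm (q (- t n + x) - q x)"
        using norm_diff_sq_le[of ?b "g x"] by (simp add: q_def)
      finally show "(norm (g x - gabor_atom g 0 (t n) (\<omega> n) x))\<^sup>2 \<le> 2 * ?m n x + 4 * norm (q (- t n + x) - q x)" .
    qed
    also have "\<dots> = 2 * (LINT x|lborel. ?m n x) + 4 * (LINT x|lborel. norm (q (- t n + x) - q x))"
      using m_int q_int by simp
    finally show ?thesis .
  qed
  show ?thesis
    unfolding t_def[symmetric] \<omega>_def[symmetric]
  proof (rule Lim_null_comparison)
    show "eventually (\<lambda>n. norm ((L2_norm (\<lambda>x. g x - gabor_atom g 0 (t n) (\<omega> n) x))\<^sup>2)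
        \<le> 2 * (LINT x|lborel. ?m n x) + 4 * (LINT x|lborel. norm (q (- t n + x) - q x))) sequentially"
      using le by simp
    show "(\<lambda>n. 2 * (LINT x|lborel. ?m n x) + 4 * (LINT x|lborel. norm (q (- t n + x) - q x))) \<longlonglongrightarrow> 0"
      using tendsto_add[OF tendsto_mult_right_zero[OF lim1, of 2] tendsto_mult_right_zero[OF lim2, of 4]] by simp
  qed
qed

lemma gabor_atom_continuous:
  fixes g :: "real^'m \<Rightarrow> complex"
  assumes g: "g \<in> L2" and "0 < \<epsilon>"
  obtains \<delta> where "0 < \<delta>"
    "\<And>z. norm z < \<delta> \<Longrightarrow> (L2_norm (\<lambda>x. g x - gabor_atom g 0 (fst z) (snd z) x))\<^sup>2 < \<epsilon>"
proof -
  let ?f = "\<lambda>z. (L2_norm (\<lambda>x. g x - gabor_atom g 0 (fst z) (snd z) x))\<^sup>2"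
  have "(?f \<longlongrightarrow> 0) (at 0)"
    unfolding tendsto_at_iff_sequentially comp_def using gabor_atom_tendsto[OF g] by blast
  from LIM_D[OF this \<open>0 < \<epsilon>\<close>] obtain \<delta> where \<delta>: "0 < \<delta>"
    "\<And>z. z \<noteq> 0 \<Longrightarrow> norm z < \<delta> \<Longrightarrow> norm (?f z) < \<epsilon>"
    by auto
  have "?f z < \<epsilon>" if "norm z < \<delta>" for z
  proof (cases "z = 0")
    case True
    then have "?f z = 0" by (simp add: gabor_atom_def L2_norm_def)
    then show ?thesis using \<open>0 < \<epsilon>\<close> by simp
  next
    case False
    then show ?thesis using \<delta>(2)[OF False that] by simp
  qed
  with \<delta>(1) show thesis by (rule that)
qed

subsection \<open>Gabor frames\<close>

lemma ball_indicator_L2_norm_pos: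
  defines "h \<equiv> \<lambda>x::real^'m. complex_of_real (indicator (ball 0 1) x)"
  shows "h \<in> L2" "0 < L2_norm h"
proof -
  have sq: "(norm (h x))\<^sup>2 = indicator (ball 0 1) x" for x
    by (simp add: h_def split: split_indicator)
  have [measurable]: "ball (0::real^'m) 1 \<in> sets borel" by simp
  have "h \<in> borel_measurable borel" unfolding h_def by measurable
  then show "h \<in> L2"
    using emeasure_lborel_ball_finite[of "0::real^'m" 1] by (simp add: L2_def sq)
  show "0 < L2_norm h"
    unfolding L2_norm_def sq by (simp add: content_ball_pos)
qed

locale gabor_frame = L2_frame "gabor_sys g phi p" A B
  for g :: "real^'m \<Rightarrow> complex" and phi :: "'i \<Rightarrow> real" and p :: "'i \<Rightarrow> (real^'m) \<times> (real^'m)" and A B +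
  assumes g: "g \<in> L2"
begin

abbreviation G where "G \<equiv> gabor_sys g phi p"

lemma L2_norm_G: "L2_norm (G i) = L2_norm g"
  by (simp add: gabor_sys_def L2_norm_gabor_atom g)

text \<open>With a null window all frame coefficients would vanish, against the lower bound for any
  \<open>h\<close> of positive norm.\<close>

lemma window_pos: "0 < L2_norm g"
proof (rule ccontr)
  assume "\<not> 0 < L2_norm g"
  then have 0: "L2_norm (G i) = 0" for i
    using L2.nrm_ge_0[OF g] by (simp add: L2_norm_G)
  obtain h :: "real^'m \<Rightarrow> complex" where h: "h \<in> L2" "0 < L2_norm h"
    using ball_indicator_L2_norm_pos by blast
  have "L2_inner h (G i) = 0" for i
    using L2.Cauchy_Schwarz[OF h(1) G_L2[of i]] by (simp add: 0)
  then have "A * (L2_norm h)\<^sup>2 \<le> 0" using lower[OF h(1)] by simp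
  then show False using h(2) A_pos by (simp add: mult_le_0_iff)
qed

lemma coeff_sum_le:
  assumes "h \<in> L2" "finite F"
  shows "(\<Sum>j\<in>F. (norm (L2_inner h (G j)))\<^sup>2) \<le> B * (L2_norm h)\<^sup>2"
  using sum_le_infsum_subset[OF coeff_summable[OF assms(1)] assms(2) subset_UNIV] upper[OF assms(1)]
  by fastforce

lemma norm_inner_shift_G:
  assumes "f \<in> L2"
  shows "norm (L2_inner (gabor_atom f ph (fst c) (snd c)) (G j))
    = norm (L2_inner f (gabor_atom g 0 (fst (p j - c)) (snd (p j - c))))"
  by (simp add: gabor_sys_def norm_inner_gabor_atom[OF assms g])

text \<open>All atoms with parameters close to \<open>c\<close> are strongly correlated with the time-frequency shift of \<open>g\<close>
  by \<open>c\<close>, so the Bessel bound limits their number.\<close>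

lemma small_ball_card:
  obtains \<delta> K where "0 < \<delta>" "\<And>c. finite {j. norm (p j - c) < \<delta>} \<and> card {j. norm (p j - c) < \<delta>} \<le> (K::nat)"
proof -
  let ?n = "L2_norm g"
  \<comment> \<open>Within distance n/2 of \<open>g\<close>, an atom has correlation at least n^2 -
    n (n/2) = n^2/2 with \<open>g\<close>.\<close>
  have "0 < (?n / 2)\<^sup>2" using window_pos by simp
  from gabor_atom_continuous[OF g this] obtain \<delta> where \<delta>: "0 < \<delta>"
    and close: "\<And>z. norm z < \<delta> \<Longrightarrow> (L2_norm (\<lambda>x. g x - gabor_atom g 0 (fst z) (snd z) x))\<^sup>2 < (?n / 2)\<^sup>2"
    by blast
  have corr: "?n\<^sup>2 / 2 \<le> norm (L2_inner g (gabor_atom g 0 (fst z) (snd z)))" if "norm z < \<delta>" for z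
  proof -
    let ?k = "gabor_atom g 0 (fst z) (snd z)"
    have k: "?k \<in> L2" by (rule gabor_atom_L2[OF g])
    have d: "(\<lambda>x. g x - ?k x) \<in> L2" by (rule L2.diff_mem[OF g k])
    have "L2_norm (\<lambda>x. g x - ?k x) \<le> ?n / 2"
      by (rule power2_le_imp_le) (use close[OF that] window_pos in simp_all)
    then have "?n * L2_norm (\<lambda>x. g x - ?k x) \<le> ?n * (?n / 2)"
      using window_pos by (intro mult_left_mono) simp_all
    with L2.Cauchy_Schwarz[OF g d] have "norm (L2_inner g (\<lambda>x. g x - ?k x)) \<le> ?n * (?n / 2)"
      by (rule order_trans)
    moreover have "L2_inner g ?k = L2_inner g g - L2_inner g (\<lambda>x. g x - ?k x)"
      by (simp add: L2.ip_diff_right g k)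
    moreover have "norm (L2_inner g g) = ?n\<^sup>2" by (simp add: L2_self del: of_real_power)
    ultimately show ?thesis
      using norm_triangle_ineq2[of "L2_inner g g" "L2_inner g (\<lambda>x. g x - ?k x)"]
      by (simp add: power2_eq_square)
  qed
  \<comment> \<open>Solves card F (n^2/2)^2 \<le> B n^2 for the cardinality.\<close>
  define K where "K = nat \<lfloor>4 * B / ?n\<^sup>2\<rfloor>"
  have "finite {j. norm (p j - c) < \<delta>} \<and> card {j. norm (p j - c) < \<delta>} \<le> K" for c
  proof (rule finite_if_finite_subsets_card_bdd)
    fix F assume F: "F \<subseteq> {j. norm (p j - c) < \<delta>}" "finite F"
    let ?h = "gabor_atom g 0 (fst c) (snd c)"
    have "card F * (?n\<^sup>2 / 2)\<^sup>2 = (\<Sum>j\<in>F. (?n\<^sup>2 / 2)\<^sup>2)" by simp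
    also have "\<dots> \<le> (\<Sum>j\<in>F. (norm (L2_inner ?h (G j)))\<^sup>2)"
      unfolding norm_inner_shift_G[OF g] using F by (intro sum_mono power_mono corr) auto
    also have "\<dots> \<le> B * ?n\<^sup>2"
      using coeff_sum_le[OF gabor_atom_L2[OF g] F(2)] by (simp add: L2_norm_gabor_atom g)
    finally have "real (card F) \<le> 4 * B / ?n\<^sup>2"
      using window_pos by (simp add: field_simps power2_eq_square)
    then show "card F \<le> K" unfolding K_def by linarith
  qed
  then show thesis using \<delta> by (intro that) auto
qed

text \<open>Compactness: finitely many \<delta>-balls cover the large ball around the origin, and
  translating this cover to \<open>p i\<close> does not change their number.\<close>

lemma ball_card:
  "\<exists>K::nat. \<forall>i. finite {j. linf_dist p j i \<le> N} \<and> card {j. linf_dist p j i \<le> N} \<le> K"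
proof -
  obtain \<delta> K where \<delta>: "0 < \<delta>"
    and K: "\<And>c. finite {j. norm (p j - c) < \<delta>} \<and> card {j. norm (p j - c) < \<delta>} \<le> (K::nat)"
    using small_ball_card by blast
  \<comment> \<open>The factor converts the sup norm into the Euclidean norm.\<close>
  define R where "R = sqrt DIM((real^'m) \<times> (real^'m)) * N"
  let ?D = "cball (0::(real^'m) \<times> (real^'m)) R"
  have "?D \<subseteq> (\<Union>c\<in>?D. ball c \<delta>)" using \<delta> by force
  then obtain S where S: "finite S" "?D \<subseteq> (\<Union>c\<in>S. ball c \<delta>)"
    by (rule compactE_image[OF compact_cball open_ball])
  have "finite {j. linf_dist p j i \<le> N} \<and> card {j. linf_dist p j i \<le> N} \<le> card S * K" for i
  proof -
    let ?U = "\<Union>c\<in>S. {j. norm (p j - (p i + c)) < \<delta>}"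
    have sub: "{j. linf_dist p j i \<le> N} \<subseteq> ?U"
    proof
      fix j assume "j \<in> {j. linf_dist p j i \<le> N}"
      then have "infnorm (p j - p i) \<le> N" by (simp add: linf_dist_def)
      then have "sqrt DIM((real^'m) \<times> (real^'m)) * infnorm (p j - p i) \<le> R"
        unfolding R_def by (rule mult_left_mono) (rule real_sqrt_ge_zero, rule of_nat_0_le_iff)
      then have "norm (p j - p i) \<le> R"
        using norm_le_infnorm order_trans by blast
      then have "p j - p i \<in> ?D" by simp
      then have "p j - p i \<in> (\<Union>c\<in>S. ball c \<delta>)" using S(2) by blast
      then show "j \<in> ?U" by (auto simp: dist_norm norm_minus_commute algebra_simps)
    qed
    have fin: "finite ?U" using S(1) K by blast
    have "card ?U \<le> (\<Sum>c\<in>S. card {j. norm (p j - (p i + c)) < \<delta>})" by (rule card_UN_le[OF S(1)])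
    also have "\<dots> \<le> (\<Sum>c\<in>S. K)" by (intro sum_mono) (use K in blast)
    finally have "card ?U \<le> card S * K" by simp
    then show ?thesis
      using finite_subset[OF sub fin] card_mono[OF fin sub] by linarith
  qed
  then show ?thesis by blast
qed

section \<open>Uniform tails of the Gram matrix\<close>

lemma spectrogram_tail:
  assumes "0 < \<epsilon>"
  obtains M where "(\<integral>\<^sup>+w. ennreal (spectrogram g w * indicator {w. M < norm w} w) \<partial>lborel) < ennreal \<epsilon>"
proof -
  have [measurable]: "spectrogram g \<in> borel_measurable borel" by (rule spectrogram_measurable[OF g])
  let ?f = "\<lambda>(n::nat) w. spectrogram g w * indicator {w. real n < norm w} w"
  have "(\<lambda>n. LINT w|lborel. ?f n w) \<longlonglongrightarrow> (LINT w|(lborel :: ((real^'m) \<times> (real^'m)) measure). 0)"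
  proof (rule integral_dominated_convergence)
    show "integrable lborel (spectrogram g)" by (rule spectrogram_integrable[OF g])
    show "AE w in lborel. (\<lambda>n. ?f n w) \<longlonglongrightarrow> 0"
    proof (rule AE_I2)
      fix w :: "(real^'m) \<times> (real^'m)"
      have "eventually (\<lambda>n. norm w \<le> real n) sequentially"
        using eventually_ge_at_top[of "nat \<lceil>norm w\<rceil>"] by eventually_elim linarith
      then have "eventually (\<lambda>n. ?f n w = 0) sequentially" by eventually_elim simp
      then show "(\<lambda>n. ?f n w) \<longlonglongrightarrow> 0" by (rule tendsto_eventually)
    qed
    show "AE w in lborel. norm (?f n w) \<le> spectrogram g w" for n
      by (auto simp: spectrogram_nonneg split: split_indicator)
  qed measurable
  then have "(\<lambda>n. LINT w|lborel. ?f n w) \<longlonglongrightarrow> 0" by simp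
  from order_tendstoD(2)[OF this assms] obtain n where n: "(LINT w|lborel. ?f n w) < \<epsilon>"
    by (auto simp: eventually_sequentially)
  have int: "integrable lborel (?f n)"
    by (rule Bochner_Integration.integrable_bound[OF spectrogram_integrable[OF g]])
      (measurable, auto simp: spectrogram_nonneg split: split_indicator)
  have "(\<integral>\<^sup>+w. ennreal (?f n w) \<partial>lborel) = ennreal (LINT w|lborel. ?f n w)"
    by (rule nn_integral_eq_integral[OF int]) (simp add: spectrogram_nonneg)
  also have "\<dots> < ennreal \<epsilon>" using n assms by (simp add: ennreal_lessI)
  finally show thesis by (rule that)
qed

text \<open>For small \<open>z\<close>, replacing \<open>g\<close> by its time-frequency shift by \<open>z\<close> changes the tail of the Gram matrix by
  little, by the Bessel bound. Averaging over \<open>z\<close> turns the tail into an integral of the spectrogram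
  over a far region that is covered at most \<open>K\<close> times.\<close>

lemma gram_tail:
  assumes \<epsilon>: "0 < \<epsilon>"
  shows "\<exists>N. \<forall>i. (\<Sum>\<^sub>\<infinity>j\<in>{j. \<not> linf_dist p j i \<le> N}. (norm (L2_inner (G i) (G j)))\<^sup>2) \<le> \<epsilon>"
proof -
  let ?s = "spectrogram g"
  have [measurable]: "?s \<in> borel_measurable borel" by (rule spectrogram_measurable[OF g])
  obtain \<delta> K where \<delta>: "0 < \<delta>"
    and K: "\<And>c. finite {j. norm (p j - c) < \<delta>} \<and> card {j. norm (p j - c) < \<delta>} \<le> (K::nat)"
    using small_ball_card by blast
  \<comment> \<open>The perturbation then costs at most 2 B \<epsilon>/(4B) = \<epsilon>/2 of a tail
    exceeding \<epsilon>, so the doubled spectrogram samples retain \<epsilon>/2.\<close>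
  have "0 < \<epsilon> / (4 * B)" using \<epsilon> B_pos by simp
  from gabor_atom_continuous[OF g this] obtain \<delta>' where \<delta>': "0 < \<delta>'"
    and close: "\<And>z. norm z < \<delta>' \<Longrightarrow> (L2_norm (\<lambda>x. g x - gabor_atom g 0 (fst z) (snd z) x))\<^sup>2 < \<epsilon> / (4 * B)"
    by blast
  \<comment> \<open>Below \<delta>' the window perturbation is small, below \<delta> the shifted
    balls overlap at most \<open>K\<close> times.\<close>
  define r where "r = min \<delta> \<delta>'"
  have r: "0 < r" "r \<le> \<delta>" "r \<le> \<delta>'" using \<delta> \<delta>' by (simp_all add: r_def)
  define D where "D = (ball 0 r :: ((real^'m) \<times> (real^'m)) set)"
  have D_sets[measurable]: "D \<in> sets borel" by (simp add: D_def)
  define \<mu> where "\<mu> = measure lborel D"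
  have \<mu>: "0 < \<mu>" using r unfolding \<mu>_def D_def by (simp add: content_ball_pos)
  have emeasure_D: "emeasure lborel D = ennreal \<mu>"
    unfolding \<mu>_def D_def using emeasure_lborel_ball_finite[of "0 :: (real^'m) \<times> (real^'m)" r]
    by (intro emeasure_eq_ennreal_measure) (simp add: less_top)
  \<comment> \<open>Makes \<open>real K * \<epsilon>'\<close> strictly smaller than \<epsilon>/4
    times the volume \<mu>, which is the final contradiction.\<close>
  define \<epsilon>' where "\<epsilon>' = \<epsilon> / 4 * \<mu> / (real K + 1)"
  have "0 < \<epsilon>'" using \<epsilon> \<mu> by (simp add: \<epsilon>'_def)
  from spectrogram_tail[OF this] obtain M
    where M: "(\<integral>\<^sup>+w. ennreal (?s w * indicator {w. M < norm w} w) \<partial>lborel) < ennreal \<epsilon>'" by blast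
  have sm: "(\<lambda>j. (norm (L2_inner (G i) (G j)))\<^sup>2) summable_on S" for i S
    by (rule summable_on_subset[OF coeff_summable[OF G_L2] subset_UNIV])
  have "(\<Sum>j\<in>F. (norm (L2_inner (G i) (G j)))\<^sup>2) \<le> \<epsilon>"
    \<comment> \<open>The extra \<open>r\<close> keeps every point of the ball of radius
      \<open>r\<close> around \<open>v j\<close> at norm greater than \<open>M\<close>.\<close>
    if F: "finite F" "F \<subseteq> {j. \<not> linf_dist p j i \<le> M + r}" for F i
  proof (rule ccontr)
    assume "\<not> (\<Sum>j\<in>F. (norm (L2_inner (G i) (G j)))\<^sup>2) \<le> \<epsilon>"
    then have big: "\<epsilon> < (\<Sum>j\<in>F. (norm (L2_inner (G i) (G j)))\<^sup>2)" by simp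
    define v where "v j = p j - p i" for j
    have far: "M + r < norm (v j)" if "j \<in> F" for j
      using F(2) that infnorm_le_norm[of "p j - p i"] by (force simp: linf_dist_def v_def)
    have lower_z: "\<epsilon> / 4 \<le> (\<Sum>j\<in>F. ?s (v j + z))" if z: "z \<in> D" for z
    proof -
      \<comment> \<open>Shifting the left window by \<open>- z\<close> moves the parameter
        difference from \<open>v j\<close> to \<open>v j + z\<close>.\<close>
      let ?k = "gabor_atom g 0 (fst (- z)) (snd (- z))"
      let ?sh = "\<lambda>f. gabor_atom f (phi i) (fst (p i)) (snd (p i))"
      let ?e = "\<lambda>x. g x - ?k x"
      have k: "?k \<in> L2" by (rule gabor_atom_L2[OF g])
      have e: "?e \<in> L2" by (rule L2.diff_mem[OF g k])
      have G_i: "G i = (\<lambda>x. ?sh ?e x + ?sh ?k x)"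
        by (simp add: gabor_sys_def gabor_atom_def fun_eq_iff right_diff_distrib)
      have "(norm (L2_inner (G i) (G j)))\<^sup>2 \<le> 2 * (norm (L2_inner (?sh ?e) (G j)))\<^sup>2 + 2 * ?s (v j + z)" for j
      proof -
        have "norm (L2_inner (?sh ?k) (G j)) = norm (L2_inner g (gabor_atom g 0 (fst (v j + z)) (snd (v j + z))))"
          unfolding norm_inner_shift_G[OF k] by (simp add: norm_inner_gabor_atom[OF g g] v_def)
        then have "?s (v j + z) = (norm (L2_inner (?sh ?k) (G j)))\<^sup>2" by (simp add: spectrogram_def)
        moreover have "L2_inner (G i) (G j) = L2_inner (?sh ?e) (G j) + L2_inner (?sh ?k) (G j)"
          using L2.ip_add[OF gabor_atom_L2[OF e] gabor_atom_L2[OF k] G_L2[of j]] G_i by metis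
        ultimately show ?thesis by (simp add: norm_add_sq_le)
      qed
      then have "(\<Sum>j\<in>F. (norm (L2_inner (G i) (G j)))\<^sup>2)
          \<le> (\<Sum>j\<in>F. 2 * (norm (L2_inner (?sh ?e) (G j)))\<^sup>2 + 2 * ?s (v j + z))"
        by (intro sum_mono)
      also have "\<dots> = 2 * (\<Sum>j\<in>F. (norm (L2_inner (?sh ?e) (G j)))\<^sup>2) + 2 * (\<Sum>j\<in>F. ?s (v j + z))"
        by (simp add: sum.distrib sum_distrib_left)
      also have "(\<Sum>j\<in>F. (norm (L2_inner (?sh ?e) (G j)))\<^sup>2) \<le> B * (L2_norm ?e)\<^sup>2"
        using coeff_sum_le[OF gabor_atom_L2[OF e] F(1)] unfolding L2_norm_gabor_atom[OF e] .
      also have "\<dots> \<le> B * (\<epsilon> / (4 * B))"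
        using close[of "- z"] z r B_pos by (intro mult_left_mono) (auto simp: D_def)
      also have "\<dots> = \<epsilon> / 4" using B_pos by simp
      finally show ?thesis using big by simp
    qed
    \<comment> \<open>An index counts at \<open>w\<close> when \<open>p j\<close> is within
      \<open>r\<close> of \<open>p i + w\<close>: at most \<open>K\<close> indices do, and none if
      \<open>w\<close> has norm at most \<open>M\<close>.\<close>
    have overlap: "(\<Sum>j\<in>F. indicator D (- v j + w)) \<le> real K * indicator {w. M < norm w} w" for w
    proof -
      have "(\<Sum>j\<in>F. indicator D (- v j + w)) = real (card {j\<in>F. - v j + w \<in> D})"
        using F(1) by (simp add: indicator_def sum.If_cases Int_def)
      also have "\<dots> \<le> real K * indicator {w. M < norm w} w"
      proof (cases "M < norm w")
        case True
        have "{j\<in>F. - v j + w \<in> D} \<subseteq> {j. norm (p j - (p i + w)) < \<delta>}"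
        proof
          fix j assume "j \<in> {j\<in>F. - v j + w \<in> D}"
          then have "norm (- v j + w) < \<delta>" using r by (simp add: D_def)
          moreover have "norm (p j - (p i + w)) = norm (- v j + w)"
            unfolding v_def by (subst norm_minus_cancel[symmetric]) (simp add: algebra_simps)
          ultimately show "j \<in> {j. norm (p j - (p i + w)) < \<delta>}" by simp
        qed
        then have "card {j\<in>F. - v j + w \<in> D} \<le> card {j. norm (p j - (p i + w)) < \<delta>}"
          using K by (intro card_mono) auto
        also have "\<dots> \<le> K" using K by blast
        finally show ?thesis using True by simp
      next
        case False
        have "\<not> - v j + w \<in> D" if "j \<in> F" for j
          using far[OF that] False norm_triangle_ineq4[of "w" "- v j + w"] by (simp add: D_def)
        then have "{j\<in>F. - v j + w \<in> D} = {}" by blast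
        then show ?thesis by (simp only: card.empty) simp
      qed
      finally show ?thesis .
    qed
    \<comment> \<open>Integrate \<open>lower_z\<close> over \<open>D\<close>, substitute
      \<open>w = v j + z\<close> in each summand, and use \<open>overlap\<close> to collect the
      shifted balls into one far region.\<close>
    have "ennreal (\<epsilon> / 4) * ennreal \<mu> = (\<integral>\<^sup>+z. ennreal (\<epsilon> / 4) * indicator D z \<partial>lborel)"
      by (simp add: nn_integral_cmult_indicator emeasure_D)
    also have "\<dots> \<le> (\<integral>\<^sup>+z. (\<Sum>j\<in>F. ennreal (?s (v j + z) * indicator D z)) \<partial>lborel)"
    proof (rule nn_integral_mono)
      fix z
      show "ennreal (\<epsilon> / 4) * indicator D z \<le> (\<Sum>j\<in>F. ennreal (?s (v j + z) * indicator D z))"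
        using ennreal_leI[OF lower_z[of z]]
        by (cases "z \<in> D") (simp_all add: sum_ennreal spectrogram_nonneg)
    qed
    also have "\<dots> = (\<Sum>j\<in>F. \<integral>\<^sup>+z. ennreal (?s (v j + z) * indicator D z) \<partial>lborel)"
      by (rule nn_integral_sum) measurable
    also have "\<dots> = (\<Sum>j\<in>F. \<integral>\<^sup>+w. ennreal (?s w * indicator D (- v j + w)) \<partial>lborel)"
    proof (rule sum.cong[OF refl])
      fix j
      show "(\<integral>\<^sup>+z. ennreal (?s (v j + z) * indicator D z) \<partial>lborel)
          = (\<integral>\<^sup>+w. ennreal (?s w * indicator D (- v j + w)) \<partial>lborel)"
        using nn_integral_lborel_translate[of "\<lambda>w. ennreal (?s w * indicator D (- v j + w))" "v j"] by simp
    qed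
    also have "\<dots> = (\<integral>\<^sup>+w. (\<Sum>j\<in>F. ennreal (?s w * indicator D (- v j + w))) \<partial>lborel)"
      by (rule nn_integral_sum[symmetric]) measurable
    also have "\<dots> \<le> (\<integral>\<^sup>+w. ennreal (real K) * ennreal (?s w * indicator {w. M < norm w} w) \<partial>lborel)"
    proof (rule nn_integral_mono)
      fix w
      have "(\<Sum>j\<in>F. ?s w * indicator D (- v j + w)) \<le> ?s w * (real K * indicator {w. M < norm w} w)"
        unfolding sum_distrib_left[symmetric] by (rule mult_left_mono[OF overlap spectrogram_nonneg])
      also have "\<dots> = real K * (?s w * indicator {w. M < norm w} w)" by simp
      finally show "(\<Sum>j\<in>F. ennreal (?s w * indicator D (- v j + w)))
          \<le> ennreal (real K) * ennreal (?s w * indicator {w. M < norm w} w)"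
        by (subst sum_ennreal) (simp_all add: spectrogram_nonneg ennreal_leI flip: ennreal_mult)
    qed
    also have "\<dots> = ennreal (real K) * (\<integral>\<^sup>+w. ennreal (?s w * indicator {w. M < norm w} w) \<partial>lborel)"
      by (rule nn_integral_cmult) measurable
    also have "\<dots> \<le> ennreal (real K) * ennreal \<epsilon>'"
      using M by (intro mult_left_mono) simp_all
    also have "\<dots> = ennreal (real K * \<epsilon>')" using \<open>0 < \<epsilon>'\<close> by (simp add: ennreal_mult)
    finally have "\<epsilon> / 4 * \<mu> \<le> real K * \<epsilon>'"
      using \<epsilon> \<mu> \<open>0 < \<epsilon>'\<close> by (simp add: ennreal_mult[symmetric] ennreal_le_iff)
    moreover have "(real K + 1) * \<epsilon>' = \<epsilon> / 4 * \<mu>"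
      unfolding \<epsilon>'_def times_divide_eq_right by (rule nonzero_mult_div_cancel_left) linarith
    ultimately show False using \<open>0 < \<epsilon>'\<close> by (simp add: distrib_right)
  qed
  then show ?thesis
    by (intro exI[of _ "M + r"] allI infsum_le_finite_sums[OF sm])
qed

end

sublocale gabor_frame \<subseteq> localized_frame "gabor_sys g phi p" A B "linf_dist p" "L2_norm g"
proof
  show "linf_dist p i i = 0" for i by (simp add: linf_dist_def infnorm_0)
  show "linf_dist p k i \<le> linf_dist p k j + linf_dist p j i" for k i j
    using infnorm_triangle[of "p k - p j" "p j - p i"] by (simp add: linf_dist_def)
qed (simp_all add: L2_norm_G ball_card gram_tail)

theorem theorem9p6:
  fixes g :: "real^'m \<Rightarrow> complex"
    and p :: "'i::countable \<Rightarrow> (real^'m) \<times> (real^'m)"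
    and phi :: "'i \<Rightarrow> real"
  assumes "g \<in> L2"
    and "is_frame_L2 (gabor_sys g phi p)"
  shows "nonexpansive_op (linf_dist p) (gram_proj (gabor_sys g phi p))"
proof -
  let ?G = "gabor_sys g phi p"
  from assms(2) obtain A B where AB: "0 < A" "0 < B"
    and frame: "\<And>h. h \<in> L2 \<Longrightarrow> (\<lambda>i. (norm (L2_inner h (?G i)))^2) summable_on UNIV \<and>
          A * (L2_norm h)^2 \<le> (\<Sum>\<^sub>\<infinity>i. (norm (L2_inner h (?G i)))^2) \<and>
          (\<Sum>\<^sub>\<infinity>i. (norm (L2_inner h (?G i)))^2) \<le> B * (L2_norm h)^2"
    unfolding is_frame_L2_def by blast
  \<comment> \<open>\<open>is_frame_L2\<close> does not record A \<le> B, so the upper bound is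
    enlarged to satisfy \<open>A_le_B\<close>.\<close>
  interpret gabor_frame g phi p A "max A B"
  proof
    show "?G i \<in> L2" for i using assms(2) by (simp add: is_frame_L2_def)
    fix h :: "real^'m \<Rightarrow> complex" assume h: "h \<in> L2"
    have "B * (L2_norm h)\<^sup>2 \<le> max A B * (L2_norm h)\<^sup>2" by (intro mult_right_mono) simp_all
    then show "(\<Sum>\<^sub>\<infinity>i. (norm (L2_inner h (?G i)))\<^sup>2) \<le> max A B * (L2_norm h)\<^sup>2"
      using frame[OF h] by linarith
  qed (use AB frame assms(1) in auto)
  show ?thesis by (rule nonexpansive_gram_proj)
qed

end
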